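(* Let $q=p^r$ with $p\in\{2,3\}$, let $d\in\{-1,3\}$ with $p=2$ if $d=3$, let $a,b\in\mathbb{F}_q$ with $a\neq b$, and let $m=p^ks$ with $k\ge0$ and $p\nmid s$. Then $$G_{0,d}(m)=\sum_{t\mid s}\mu\big(\tfrac st\big)H_{0,d}(p^kt)-S(m),$$ where for every $n\ge1$ $$H_{0,d}(n)=\frac1{q^2}\big(N_{n,d}(0)-1+\epsilon\big),\qquad S(m)=\sum_{i=0}^{k-1}I(p^is),$$ with $\epsilon=0$ if $d=3$ and $\epsilon=(q-1)^2$ if $d=-1$.
   Context: $\mathrm{tr}$ denotes the trace $\mathbb{F}_{q^m}\to\mathbb{F}_q$; convention $0^{-1}=0$. For $c\in\mathbb{F}_q$, $G_{c,d}(m)$ is the number of $z\in\mathbb{F}_{q^m}$ of degree $m$ over $\mathbb{F}_q$ (i.e. $z$ lies in no proper subfield $\mathbb{F}_{q^n}$, $n\mid m$, $n<m$) with $\mathrm{tr}(z)=0$ and $\mathrm{tr}(z^d)=c$. $N_{n,d}(\beta)$ (for $\beta\in\mathbb{F}_{q^n}$) is the number of rational places of the function field $\mathbb{F}_{q^n}(x,y_a,y_b)$ defined by $y_a^q-y_a=x+a(\beta+x^d)$, $y_b^q-y_b=x+b(\beta+x^d)$. $\mu$ is the Möbius function and $I(n)=\sum_{t\mid n}\mu(t)q^{n/t}$. *)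

theory Defs
  imports "HOL-Algebra.Algebraic_Closure_Type" "HOL-Algebra.QuotRing"
    "HOL-Algebra.Embedded_Algebras" "HOL-Algebra.Generated_Fields"
    "HOL-Computational_Algebra.Computational_Algebra" "HOL-Library.Cardinality"
begin

text \<open>
  The ground field \<open>\<F>\<^sub>q\<close> is a type \<open>'a\<close> of class \<^class>\<open>field\<close> and \<^class>\<open>finite\<close>, so that
  \<open>q = CARD('a)\<close>. All its finite extensions are taken inside one algebraic closure \<^typ>\<open>'a alg_closure\<close>.
\<close>

definition moebius_mu :: "nat \<Rightarrow> int" where
  "moebius_mu n = (if squarefree n then (- 1) ^ card (prime_factors n) else 0)"

definition I_sum :: "nat \<Rightarrow> nat \<Rightarrow> int" where
  "I_sum q n = (\<Sum>t | t dvd n. moebius_mu t * int q ^ (n div t))"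

text \<open>The subfield of order \<open>q\<^sup>n\<close> (for \<open>n \<ge> 1\<close>): the splitting field of \<open>X ^ (q ^ n) - X\<close>.\<close>

definition GF :: "nat \<Rightarrow> 'a::{field,finite} alg_closure set" where
  "GF n = {z. z ^ (CARD('a) ^ n) = z}"

text \<open>
  The trace of \<open>GF n\<close> over \<open>GF 1 = range to_ac\<close>; its value is left in the algebraic closure.
\<close>

definition field_trace :: "nat \<Rightarrow> 'a::{field,finite} alg_closure \<Rightarrow> 'a alg_closure" where
  "field_trace n z = (\<Sum>i<n. z ^ (CARD('a) ^ i))"

text \<open>The library fact \<open>inverse 0 = 0\<close> gives the convention for \<open>z powi (-1)\<close> at \<open>z = 0\<close>.\<close>

definition G_count :: "'a::{field,finite} \<Rightarrow> int \<Rightarrow> nat \<Rightarrow> nat" where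
  "G_count c d m = card {z :: 'a alg_closure.
     z \<in> GF m \<and> (\<forall>n. n dvd m \<and> n < m \<longrightarrow> z \<notin> GF n) \<and>
     field_trace m z = 0 \<and> field_trace m (z powi d) = to_ac c}"


text \<open>
  Places of a function field \<open>F/K\<close>, where \<open>K \<subseteq> F\<close> are subfields of an ambient field given as a
  type: a valuation ring is a ring \<open>\<O>\<close> strictly between \<open>K\<close> and \<open>F\<close> that contains \<open>z\<close> or
  \<open>1/z\<close> for every \<open>z \<in> F\<close>, and a place is the maximal ideal of a valuation ring.
\<close>

abbreviation ring_on :: "'b::field set \<Rightarrow> 'b ring" where
  "ring_on A \<equiv> ring_of_type_algebra\<lparr>carrier := A\<rparr>"

definition is_valuation_ring :: "'b::field set \<Rightarrow> 'b set \<Rightarrow> 'b set \<Rightarrow> bool" where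
  "is_valuation_ring K F V \<longleftrightarrow>
     subring V ring_of_type_algebra \<and> K \<subset> V \<and> V \<subset> F \<and> (\<forall>z\<in>F. z \<in> V \<or> inverse z \<in> V)"

text \<open>
  The place \<open>P\<close> with valuation ring \<open>V\<close> has degree \<open>n\<close>: the residue class field \<open>V/P\<close> has
  dimension \<open>n\<close> over the image of \<open>K\<close>. (\<open>V\<close> is determined by \<open>P\<close> and \<open>F\<close>.)
\<close>

definition has_place_degree :: "'b::field set \<Rightarrow> 'b set \<Rightarrow> 'b set \<Rightarrow> nat \<Rightarrow> bool" where
  "has_place_degree K F P n \<longleftrightarrow>
     (\<exists>V. is_valuation_ring K F V \<and> maximalideal P (ring_on V) \<and>
          ring.dimension (ring_on V Quot P) n
            ((\<lambda>c. P +>\<^bsub>ring_on V\<^esub> c) ` K) (carrier (ring_on V Quot P)))"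

definition rational_places :: "'b::field set \<Rightarrow> 'b set \<Rightarrow> 'b set set" where
  "rational_places K F = {P. has_place_degree K F P 1}"


text \<open>
  The function fields are realised inside an algebraic closure of the rational function field
  over \<^typ>\<open>'a alg_closure\<close>.
\<close>

type_synonym 'a ff_closure = "'a alg_closure poly fract alg_closure"

definition ff_const :: "'a::field alg_closure \<Rightarrow> 'a ff_closure" where
  "ff_const c = to_ac (Fract [:c:] 1)"

definition ff_x :: "'a::field ff_closure" where
  "ff_x = to_ac (Fract [:0, 1:] 1)"

text \<open>
  The chosen root is irrelevant: two roots differ by an element of \<open>\<F>\<^sub>q\<close>, hence they generate
  the same field over the rational function field of each \<open>GF n\<close> with \<open>n \<ge> 1\<close>.
\<close>

definition ff_y :: "int \<Rightarrow> 'a::{field,finite} alg_closure \<Rightarrow> 'a \<Rightarrow> 'a ff_closure" where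
  "ff_y d \<beta> a = (SOME y. y ^ CARD('a) - y =
     ff_x + ff_const (to_ac a) * (ff_const \<beta> + ff_x powi d))"

lemma ff_y_equation:
  fixes a :: "'a::{field,finite}"
  shows "ff_y d \<beta> a ^ CARD('a) - ff_y d \<beta> a =
           ff_x + ff_const (to_ac a) * (ff_const \<beta> + ff_x powi d)"
proof -
  define f :: "'a ff_closure" where
    "f = ff_x + ff_const (to_ac a) * (ff_const \<beta> + ff_x powi d)"
  define g :: "'a ff_closure poly" where "g = - [:f, 1:]"
  define h :: "'a ff_closure poly" where "h = Polynomial.monom 1 CARD('a) + g"
  have "card {0, 1 :: 'a} \<le> CARD('a)"
    by (rule card_mono) auto
  hence card: "CARD('a) > 1"
    by simp
  have "Polynomial.degree g < Polynomial.degree (Polynomial.monom (1 :: 'a ff_closure) CARD('a))"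
    using card by (simp add: g_def degree_monom_eq)
  hence "Polynomial.degree h = CARD('a)"
    unfolding h_def by (simp add: degree_add_eq_left degree_monom_eq)
  hence "\<exists>y. poly h y = 0"
    using card by (intro alg_closed_imp_poly_has_root) auto
  then obtain y where "poly h y = 0"
    by blast
  hence "y ^ CARD('a) - y = f"
    by (simp add: h_def g_def poly_monom algebra_simps)
  thus ?thesis
    unfolding ff_y_def f_def by (rule someI)
qed

definition function_field ::
  "nat \<Rightarrow> int \<Rightarrow> 'a::{field,finite} \<Rightarrow> 'a \<Rightarrow> 'a alg_closure \<Rightarrow> 'a ff_closure set" where
  "function_field n d a b \<beta> =
     generate_field ring_of_type_algebra (ff_const ` GF n \<union> {ff_x, ff_y d \<beta> a, ff_y d \<beta> b})"

definition N_count ::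
  "nat \<Rightarrow> int \<Rightarrow> 'a::{field,finite} \<Rightarrow> 'a \<Rightarrow> 'a alg_closure \<Rightarrow> nat" where
  "N_count n d a b \<beta> = card (rational_places (ff_const ` GF n) (function_field n d a b \<beta>))"

definition H0 :: "int \<Rightarrow> 'a::{field,finite} \<Rightarrow> 'a \<Rightarrow> nat \<Rightarrow> rat" where
  "H0 d a b n =
     1 / of_nat CARD('a) ^ 2 *
     (of_nat (N_count n d a b 0) - 1 + (if d = 3 then 0 else (of_nat CARD('a) - 1) ^ 2))"

text \<open>The correction term \<open>S(m)\<close> for \<open>m = p ^ k * s\<close> with \<open>s\<close> prime to \<open>p\<close>.\<close>

definition S_corr :: "nat \<Rightarrow> nat \<Rightarrow> nat \<Rightarrow> nat \<Rightarrow> int" where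
  "S_corr q p k s = (\<Sum>i<k. I_sum q (p ^ i * s))"

end

(*
  The function field is K(w0, w1) with K = GF n, w0^q - w0 = x and w1^q - w1 = x^d, an Artin-Schreier
  extension of the rational function field K(w0). Over a place of K(w0) with uniformizer t, namely
  t = w0 - alpha or t = 1/w0, the rational places of w^q - w = h correspond to the beta in K with
  beta^q - beta = h(t = 0) if h is regular, and there is exactly one if h has a pole of order prime to q.
  For d = 3 and q even one replaces w1 by w1 + w0^3, after which h = w0^(2q+1) + w0^(q+2) has a pole of
  odd order at infinity and no other pole; for d = -1, h = 1/(w0^q - w0) has simple poles at the elements
  of F_q. As the trace-zero elements are exactly the q-fold values of alpha^q - alpha, H0 d a b n counts the
  z in GF n with tr z = tr (z^d) = 0.

  Sorting these z by their degree e, where the trace of GF n restricted to GF e is n/e times the trace of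
  GF e, and inverting over the divisors of s gives the formula: the elements whose codegree n/e is
  divisible by p have trace zero automatically and produce the correction term.
*)
theory Submission
  imports Defs
begin

section \<open>Moebius inversion\<close>

text \<open>The count rests on the linear independence of \<open>1, w, ..., w^(q-1)\<close> over
  \<open>K(w0)\<close>. It is read off at one totally ramified place, where the terms
  \<open>c_j * w^j\<close> have distinct valuations, and is then passed on to all unramified places.
  Hence one pole of order prime to \<open>q\<close> is indispensable: this is why the leading term
  \<open>w0^(3q)\<close> of \<open>x^3\<close> is removed for \<open>d = 3\<close>, and for
  \<open>d = -1\<close> the place \<open>w0 = 0\<close> supplies it. Valuation rings above a place
  come from Zorn's lemma. Their uniqueness comes from membership criteria that do not mention the
  ring. The constant epsilon: let \<open>T\<close> be the number of trace-zero elements. For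
  \<open>d = 3\<close> the place at infinity is the only one in excess, so
  \<open>N = 1 + q^2 * T\<close>. For \<open>d = -1\<close> the \<open>q\<close> ramified places and
  the \<open>q\<close> places at infinity replace the \<open>q^2\<close> pairs that
  \<open>z = 0\<close> would contribute, so \<open>N = 2q + q^2 * (T - 1)\<close> and
  \<open>N - 1 + (q - 1)^2 = q^2 * T\<close>.\<close>

lemma prime_factors_prod_primes:
  fixes P :: "nat set"
  assumes "finite P" "\<And>p. p \<in> P \<Longrightarrow> prime p"
  shows "prime_factors (\<Prod>P) = P"
proof -
  have "prime_factorization (\<Prod>P) = (\<Sum>p\<in>P. prime_factorization p)"
    by (rule prime_factorization_prod[OF assms(1)]) (metis assms(2) not_prime_0)
  also have "\<dots> = (\<Sum>p\<in>P. {#p#})"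
    by (rule sum.cong) (use assms(2) in \<open>auto intro: prime_factorization_prime\<close>)
  also have "\<dots> = mset_set P" using assms(1) by (induction P) auto
  finally show ?thesis using assms(1) by simp
qed

text \<open>A squarefree number is the product of its set of primes, so a sum of Moebius values
  becomes a signed sum over subsets of the prime factors.\<close>

lemma bij_betw_squarefree_divisors:
  assumes "n > (0::nat)"
  shows "bij_betw (\<lambda>P. \<Prod>P) (Pow (prime_factors n)) {d. d dvd n \<and> squarefree d}"
proof -
  have pf: "prime_factors (\<Prod>P) = P" if "P \<subseteq> prime_factors n" for P
    using that finite_subset by (intro prime_factors_prod_primes) auto
  have sf: "squarefree (\<Prod>P)" if "P \<subseteq> prime_factors n" for P
    using that by (intro squarefree_prod_coprime) (auto intro: squarefree_prime primes_coprime)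
  have dv: "\<Prod>P dvd n" if "P \<subseteq> prime_factors n" for P
  proof -
    have "\<Prod>P dvd \<Prod>(prime_factors n)" using that by (intro prod_dvd_prod_subset) auto
    also have "\<dots> dvd (\<Prod>p\<in>prime_factors n. p ^ multiplicity p n)"
      by (intro prod_dvd_prod dvd_power) (auto simp: prime_factors_multiplicity)
    also have "\<dots> = n" using assms by (simp add: prod_prime_factors)
    finally show ?thesis .
  qed
  have sj: "d = \<Prod>(prime_factors d)" if "squarefree d" for d :: nat
  proof -
    have "d \<noteq> 0" using that by (metis not_squarefree_0)
    hence "d = (\<Prod>p\<in>prime_factors d. p ^ multiplicity p d)" by (simp add: prod_prime_factors)
    also have "\<dots> = \<Prod>(prime_factors d)"
    proof (rule prod.cong)
      fix p assume "p \<in> prime_factors d"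
      hence "multiplicity p d = 1" using that squarefree_factorial_semiring'[OF \<open>d \<noteq> 0\<close>] by blast
      thus "p ^ multiplicity p d = p" by simp
    qed simp
    finally show ?thesis .
  qed
  show ?thesis
  proof (rule bij_betwI[where g = prime_factors])
    show "(\<lambda>P. \<Prod>P) \<in> Pow (prime_factors n) \<rightarrow> {d. d dvd n \<and> squarefree d}" using sf dv by auto
    show "prime_factors \<in> {d. d dvd n \<and> squarefree d} \<rightarrow> Pow (prime_factors n)"
      using assms dvd_prime_factors[of n] by blast
  qed (use pf sj in auto)
qed

lemma sum_moebius_mu:
  assumes "n > 0"
  shows "(\<Sum>d | d dvd n. moebius_mu d) = (if n = 1 then 1 else 0)"
proof -
  have fin: "finite {d. d dvd n}" using assms by simp
  have "(\<Sum>d | d dvd n. moebius_mu d) = (\<Sum>d | d dvd n \<and> squarefree d. (-1) ^ card (prime_factors d))"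
    by (rule sum.mono_neutral_cong_right) (use fin in \<open>auto simp: moebius_mu_def\<close>)
  also have "\<dots> = (\<Sum>P\<in>Pow (prime_factors n). (-1) ^ card (prime_factors (\<Prod>P)))"
    by (rule sum.reindex_bij_betw[OF bij_betw_squarefree_divisors[OF assms], symmetric])
  also have "\<dots> = (\<Sum>P\<in>Pow (prime_factors n). (-1) ^ card P)"
  proof (rule sum.cong)
    fix P assume "P \<in> Pow (prime_factors n)"
    hence P: "finite P" "\<And>p. p \<in> P \<Longrightarrow> prime p" using finite_subset by (blast, auto)
    show "(-1) ^ card (prime_factors (\<Prod>P)) = ((-1) ^ card P :: int)"
      by (simp add: prime_factors_prod_primes[OF P])
  qed simp
  \<comment> \<open>Expanding a product of factors \<open>1 - 1\<close> gives the signed sum over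
    subsets; the product is empty exactly for \<open>n = 1\<close>.\<close>
  also have "\<dots> = (\<Prod>p\<in>prime_factors n. 1 - 1)"
    by (subst prod_diff_conv_sum) simp_all
  also have "\<dots> = (if n = 1 then 1 else 0)"
    using assms by (auto simp: prime_factorization_empty_iff card_gt_0_iff)
  finally show ?thesis .
qed

text \<open>Interchanging the sums leaves a full divisor sum of Moebius values over
  \<open>s div u\<close>, which vanishes unless \<open>u = s\<close>. The relation is assumed for
  divisors of \<open>s\<close> only, because the main application knows it only for numbers prime to
  \<open>p\<close>.\<close>

lemma moebius_inversion:
  fixes f g :: "nat \<Rightarrow> 'c::comm_ring_1"
  assumes s: "s > 0" and f: "\<And>t. t dvd s \<Longrightarrow> f t = (\<Sum>u | u dvd t. g u)"
  shows "(\<Sum>t | t dvd s. of_int (moebius_mu (s div t)) * f t) = g s"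
proof -
  let ?D = "{t. t dvd s}"
  have fin: "finite ?D" using s by simp
  have "(\<Sum>t\<in>?D. of_int (moebius_mu (s div t)) * f t) =
      (\<Sum>t\<in>?D. \<Sum>u | u \<in> ?D \<and> u dvd t. of_int (moebius_mu (s div t)) * g u)"
  proof (rule sum.cong)
    fix t assume t: "t \<in> ?D"
    have "{u. u dvd t} = {u. u \<in> ?D \<and> u dvd t}" using t by (auto intro: dvd_trans)
    thus "of_int (moebius_mu (s div t)) * f t = (\<Sum>u | u \<in> ?D \<and> u dvd t. of_int (moebius_mu (s div t)) * g u)"
      using f t by (simp add: sum_distrib_left)
  qed simp
  also have "\<dots> = (\<Sum>u\<in>?D. \<Sum>t | t \<in> ?D \<and> u dvd t. of_int (moebius_mu (s div t)) * g u)"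
    by (rule sum.swap_restrict[OF fin fin])
  also have "\<dots> = (\<Sum>u\<in>?D. if u = s then g u else 0)"
  proof (rule sum.cong)
    fix u assume u: "u \<in> ?D"
    have u0: "u > 0" "s div u > 0" using u s by (auto intro: Nat.gr0I simp: dvd_div_eq_0_iff)
    have "(\<Sum>t | t \<in> ?D \<and> u dvd t. moebius_mu (s div t)) = (\<Sum>v | v dvd s div u. moebius_mu v)"
    proof (rule sum.reindex_bij_witness[where i = "\<lambda>v. s div v" and j = "\<lambda>t. s div t"])
      fix t assume t: "t \<in> {t \<in> ?D. u dvd t}"
      show "s div (s div t) = t" using t s by (auto simp: div_div_eq_right)
      show "s div t \<in> {v. v dvd s div u}" using t s by (auto simp: dvd_div_iff_mult elim!: dvdE)
    next
      fix v assume v: "v \<in> {v. v dvd s div u}"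
      hence vu: "v * u dvd s" using u u0 by (simp add: dvd_div_iff_mult)
      hence vs: "v dvd s" by (rule dvd_mult_left)
      show "s div (s div v) = v" using vs s by (auto simp: div_div_eq_right)
      show "s div v \<in> {t \<in> ?D. u dvd t}"
        using vu vs s by (auto simp: dvd_div_iff_mult mult.commute)
    qed simp
    also have "\<dots> = (if u = s then 1 else 0)"
      using sum_moebius_mu[OF u0(2)] u u0(1) by (auto elim!: dvdE)
    finally have "(\<Sum>t | t \<in> ?D \<and> u dvd t. of_int (moebius_mu (s div t)) :: 'c) = (if u = s then 1 else 0)"
      by (simp flip: of_int_sum)
    thus "(\<Sum>t | t \<in> ?D \<and> u dvd t. of_int (moebius_mu (s div t)) * g u) = (if u = s then g u else 0)"
      by (simp flip: sum_distrib_right)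
  qed simp
  also have "\<dots> = g s" using fin by (simp add: sum.delta)
  finally show ?thesis .
qed

text \<open>\<open>I_sum\<close> puts the Moebius factor on \<open>t\<close> and the power on
  \<open>n div t\<close>; exchanging complementary divisors brings it into the form of
  \<open>moebius_inversion\<close>.\<close>

lemma I_sum_inversion:
  assumes n: "n > 0" and D: "\<And>m. m dvd n \<Longrightarrow> int q ^ m = (\<Sum>e | e dvd m. D e)"
  shows "I_sum q n = D n"
proof -
  have "I_sum q n = (\<Sum>t | t dvd n. of_int (moebius_mu (n div t)) * int q ^ t)"
    unfolding I_sum_def
    by (rule sum.reindex_bij_witness[where i = "\<lambda>t. n div t" and j = "\<lambda>t. n div t"])
      (use n in \<open>auto simp: div_div_eq_right\<close>)
  also have "\<dots> = D n" by (rule moebius_inversion[OF n]) (use D in simp)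
  finally show ?thesis .
qed

text \<open>Unique factorization splits a divisor into a power of \<open>p\<close> and a part prime
  to \<open>p\<close>. The exponent \<open>i\<close> decides whether traces vanish automatically,
  while the inversion runs over \<open>u\<close>.\<close>

lemma sum_divisors_prime_power_mult:
  fixes g :: "nat \<Rightarrow> 'c::comm_monoid_add"
  assumes p: "prime p" and t: "\<not> p dvd t"
  shows "(\<Sum>e | e dvd p ^ k * t. g e) = (\<Sum>u | u dvd t. \<Sum>i\<le>k. g (p ^ i * u))"
proof -
  have t0: "t > 0" using t by (auto intro: Nat.gr0I)
  have nd: "\<not> p dvd u" if "u dvd t" for u using that t dvd_trans by blast
  have "bij_betw (\<lambda>(u, i). p ^ i * u) ({u. u dvd t} \<times> {..k}) {e. e dvd p ^ k * t}"
    unfolding bij_betw_def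
  proof
    show "inj_on (\<lambda>(u, i). p ^ i * u) ({u. u dvd t} \<times> {..k})"
    proof (rule inj_onI, clarify)
      fix u i v j assume *: "u dvd t" "v dvd t" "p ^ i * u = p ^ j * v"
      have mu: "multiplicity p (p ^ i * u) = i" if "u dvd t" for u i
        using that nd[OF that] p t0 by (subst prime_elem_multiplicity_mult_distrib)
          (auto simp: not_dvd_imp_multiplicity_0)
      have "i = j" using mu[OF *(1), of i] mu[OF *(2), of j] *(3) by simp
      thus "u = v \<and> i = j" using *(3) p by (auto simp: prime_gt_0_nat)
    qed
    show "(\<lambda>(u, i). p ^ i * u) ` ({u. u dvd t} \<times> {..k}) = {e. e dvd p ^ k * t}"
    proof safe
      fix e assume "e dvd p ^ k * t"
      then obtain a b where "e = a * b" "a dvd p ^ k" "b dvd t" using division_decomp by blast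
      moreover obtain i where "i \<le> k" "a = p ^ i" using divides_primepow_nat[OF p] calculation by blast
      ultimately show "e \<in> (\<lambda>(u, i). p ^ i * u) ` ({u. u dvd t} \<times> {..k})"
        by (intro image_eqI[of _ _ "(b, i)"]) auto
    qed (auto intro: mult_dvd_mono le_imp_power_dvd)
  qed
  hence "(\<Sum>e | e dvd p ^ k * t. g e) = (\<Sum>x\<in>{u. u dvd t} \<times> {..k}. g (case x of (u, i) \<Rightarrow> p ^ i * u))"
    by (rule sum.reindex_bij_betw[symmetric])
  also have "\<dots> = (\<Sum>u | u dvd t. \<Sum>i\<le>k. g (p ^ i * u))"
    using t0 by (simp add: sum.cartesian_product case_prod_unfold)
  finally show ?thesis .
qed

section \<open>Finite fields\<close>

text \<open>Split off a root, \<open>f = (X - a) * g\<close>. The product rule gives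
  \<open>f'(a) = g(a)\<close>, so a simple root \<open>a\<close> is not a root of \<open>g\<close>,
  and the roots of \<open>g\<close> are again simple.\<close>

lemma card_roots_separable:
  fixes f :: "'b::alg_closed_field poly"
  assumes "f \<noteq> 0" "\<And>a. poly f a = 0 \<Longrightarrow> poly (pderiv f) a \<noteq> 0"
  shows "card {a. poly f a = 0} = Polynomial.degree f"
  using assms
proof (induction "Polynomial.degree f" arbitrary: f)
  case 0
  then obtain c where "f = [:c:]" by (metis degree_eq_zeroE)
  thus ?case using 0 by simp
next
  case (Suc n)
  obtain a where a: "poly f a = 0" using alg_closed_imp_poly_has_root[of f] Suc.hyps(2) by auto
  then obtain g where g: "f = [:-a, 1:] * g" by (metis dvdE poly_eq_0_iff_dvd)
  have g0: "g \<noteq> 0" using Suc.prems g by auto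
  have pd: "poly (pderiv f) b = (b - a) * poly (pderiv g) b + poly g b" for b
    unfolding g pderiv_mult by (simp add: pderiv_pCons algebra_simps)
  have "Polynomial.degree f = Suc (Polynomial.degree g)" unfolding g using g0 by (subst degree_mult_eq) auto
  hence dg: "n = Polynomial.degree g" using Suc.hyps(2) by simp
  have IH: "card {b. poly g b = 0} = Polynomial.degree g"
  proof (rule Suc.hyps(1)[OF dg g0])
    fix b assume b: "poly g b = 0"
    hence "poly f b = 0" by (simp add: g)
    thus "poly (pderiv g) b \<noteq> 0" using Suc.prems(2)[of b] pd[of b] b by auto
  qed
  have "poly g a \<noteq> 0" using Suc.prems(2)[OF a] pd[of a] by auto
  moreover have "{b. poly f b = 0} = insert a {b. poly g b = 0}" by (auto simp: g)
  ultimately show ?case using IH dg Suc.hyps(2) poly_roots_finite[OF g0] by simp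
qed

lemma sum_lessThan_add:
  "(\<Sum>i<a + b. f i) = (\<Sum>i<a. f i) + (\<Sum>i<b. f (a + i :: nat) :: 'b::comm_monoid_add)"
  by (induction b) (simp_all add: add.assoc)

lemma CARD_ge_2: "CARD('a::{field,finite}) \<ge> 2"
proof -
  have "card {0, 1 :: 'a} \<le> CARD('a)" by (rule card_mono) auto
  thus ?thesis by simp
qed

lemma CARD_power_ge_2: "n > 0 \<Longrightarrow> CARD('a::{field,finite}) ^ n \<ge> 2"
  using self_le_power[of "CARD('a)" n] CARD_ge_2[where 'a='a] by linarith

text \<open>Translation by 1 permutes the field, so the sum of all elements does not change when 1
  is added to each of them.\<close>

lemma of_nat_CARD: "of_nat CARD('a::{field,finite}) = (0 :: 'a)"
proof -
  have "(\<Sum>x\<in>UNIV. x + 1 :: 'a) = (\<Sum>x\<in>UNIV. x)"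
    by (rule sum.reindex_bij_witness[where i = "\<lambda>x. x - 1" and j = "\<lambda>x. x + 1"]) auto
  thus ?thesis by (simp add: sum.distrib)
qed

text \<open>Multiplication by a nonzero \<open>x\<close> permutes the nonzero elements; comparing
  their products gives \<open>x ^ (q - 1) = 1\<close>.\<close>

lemma power_CARD_same: "x ^ CARD('a) = (x :: 'a::{field,finite})"
proof (cases "x = 0")
  case False
  let ?U = "UNIV - {0 :: 'a}"
  have "bij_betw ((*) x) ?U ?U"
    by (rule bij_betwI[where g = "\<lambda>y. y / x"]) (use False in auto)
  hence "\<Prod>?U = (\<Prod>y\<in>?U. x * y)" by (rule prod.reindex_bij_betw[symmetric])
  also have "\<dots> = x ^ (CARD('a) - 1) * \<Prod>?U" by (simp add: prod.distrib card_Diff_singleton)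
  finally have "x ^ (CARD('a) - 1) = 1" by simp
  thus ?thesis using CARD_ge_2[where 'a='a] by (cases "CARD('a)") auto
qed (use CARD_ge_2[where 'a='a] in auto)

lemma CHAR_CARD_prime_power:
  assumes "prime p" "CARD('a::{field,finite}) = p ^ r"
  shows "CHAR('a) = p"
proof -
  have "CHAR('a) dvd p ^ r" using of_nat_CARD[where 'a='a] assms(2) by (metis of_nat_eq_0_iff_char_dvd)
  moreover have "prime CHAR('a)" by (simp add: finite_imp_CHAR_pos prime_CHAR_semidom)
  ultimately show ?thesis using assms(1) by (metis prime_dvd_power primes_dvd_imp_eq)
qed

lemma frobenius_diff:
  fixes x y :: "'b::comm_ring_1"
  assumes "prime CHAR('b)" "q = CHAR('b) ^ r"
  shows "(x - y) ^ q = x ^ q - y ^ q"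
  using freshmans_dream'[OF assms, of "x - y" y] by (simp add: algebra_simps)

definition primitive_elements :: "nat \<Rightarrow> 'a::{field,finite} alg_closure set" where
  "primitive_elements e = {z. z \<in> GF e \<and> (\<forall>n. n dvd e \<and> n < e \<longrightarrow> z \<notin> GF n)}"

text \<open>This is \<open>G_count\<close> for \<open>c = 0\<close> without the condition on the
  degree, the set that \<open>H0\<close> turns out to count.\<close>

definition trace_zero_elements :: "int \<Rightarrow> nat \<Rightarrow> 'a::{field,finite} alg_closure set" where
  "trace_zero_elements d n = {z. z \<in> GF n \<and> field_trace n z = 0 \<and> field_trace n (z powi d) = 0}"

context
  fixes p r :: nat
  assumes p: "prime p" and card_eq: "CARD('a::{field,finite}) = p ^ r"
begin

lemma CHAR_a: "CHAR('a) = p"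
  by (rule CHAR_CARD_prime_power[OF p card_eq])

lemma q_ge_2: "CARD('a) \<ge> 2"
  by (rule CARD_ge_2)

lemma frob_diff: "(x - y :: 'a alg_closure) ^ (CARD('a) ^ n) = x ^ (CARD('a) ^ n) - y ^ (CARD('a) ^ n)"
  by (rule frobenius_diff[where r = "r * n"]) (use CHAR_a p card_eq in \<open>simp_all add: power_mult\<close>)

lemma frob_diff1: "(x - y :: 'a alg_closure) ^ CARD('a) = x ^ CARD('a) - y ^ CARD('a)"
  using frob_diff[of x y 1] by simp

text \<open>The derivative of \<open>X^(q^n) - X - z\<close> is the constant -1, so all roots are
  simple. The case \<open>z = 0\<close> gives the order of \<open>GF n\<close>, the case
  \<open>n = 1\<close> the fibres of the Artin-Schreier map.\<close>

lemma card_roots_frobenius: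
  assumes "n > 0"
  shows "card {y :: 'a alg_closure. y ^ (CARD('a) ^ n) - y = z} = CARD('a) ^ n"
proof -
  define f where "f = Polynomial.monom 1 (CARD('a) ^ n) - [:z, 1 :: 'a alg_closure:]"
  have n2: "CARD('a) ^ n \<ge> 2" by (rule CARD_power_ge_2[OF assms])
  have "of_nat CARD('a) = (0 :: 'a alg_closure)"
    using of_nat_CARD[where 'a='a] by (metis to_ac_0 to_ac_of_nat)
  hence "pderiv f = -1" using assms by (simp add: f_def pderiv_diff pderiv_monom pderiv_pCons one_pCons power_0_left)
  have "Polynomial.degree f = CARD('a) ^ n"
  proof -
    have "Polynomial.degree (Polynomial.monom 1 (CARD('a) ^ n) + - [:z, 1 :: 'a alg_closure:]) =
        Polynomial.degree (Polynomial.monom (1 :: 'a alg_closure) (CARD('a) ^ n))"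
      by (rule degree_add_eq_left) (use n2 in \<open>simp add: degree_monom_eq\<close>)
    also have "\<dots> = CARD('a) ^ n" by (simp add: degree_monom_eq)
    finally show ?thesis unfolding f_def diff_conv_add_uminus .
  qed
  moreover have "f \<noteq> 0" using calculation n2 by auto
  moreover have "{y. y ^ (CARD('a) ^ n) - y = z} = {y. poly f y = 0}" by (auto simp: f_def poly_monom algebra_simps)
  ultimately show ?thesis using card_roots_separable[of f] \<open>pderiv f = -1\<close> by simp
qed

section \<open>Finite subfields and the decomposition by degree\<close>

lemma card_GF: "n > 0 \<Longrightarrow> card (GF n :: 'a alg_closure set) = CARD('a) ^ n"
  using card_roots_frobenius[of n 0] by (simp add: GF_def)

lemma finite_GF: "n > 0 \<Longrightarrow> finite (GF n :: 'a alg_closure set)"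
  using card_GF[of n] q_ge_2 by (metis card.infinite power_eq_0_iff not_numeral_le_zero)

lemma GF_iff: "z \<in> GF n \<longleftrightarrow> z ^ (CARD('a) ^ n) = (z :: 'a alg_closure)"
  by (simp add: GF_def)

lemma to_ac_GF: "to_ac c \<in> (GF n :: 'a alg_closure set)"
proof -
  have "c ^ (CARD('a) ^ n) = c" by (induction n) (simp_all add: power_mult power_CARD_same)
  thus ?thesis by (simp add: GF_iff flip: to_ac_power)
qed

lemma GF_power: "z \<in> GF n \<Longrightarrow> (z :: 'a alg_closure) ^ k \<in> GF n"
  unfolding GF_iff by (metis power_mult mult.commute)

lemma GF_inverse: "z \<in> GF n \<Longrightarrow> inverse (z :: 'a alg_closure) \<in> GF n"
  by (simp add: GF_iff power_inverse)

lemma GF_powi: "z \<in> GF n \<Longrightarrow> (z :: 'a alg_closure) powi d \<in> GF n"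
  by (simp add: power_int_def GF_power GF_inverse)

lemma GF_frob_mult: "z \<in> GF e \<Longrightarrow> (z :: 'a alg_closure) ^ (CARD('a) ^ (e * k)) = z"
  by (induction k) (simp_all add: GF_iff power_add power_mult)

lemma GF_mono: "e dvd n \<Longrightarrow> z \<in> GF e \<Longrightarrow> (z :: 'a alg_closure) \<in> GF n"
  using GF_frob_mult by (auto simp: GF_iff elim!: dvdE)

text \<open>Euclidean step: Frobenius powers whose exponent is a multiple of \<open>e\<close> fix
  \<open>z\<close>, so only the remainder acts. It forces the least positive exponent to divide all
  others.\<close>

lemma GF_mod: "z \<in> GF e \<Longrightarrow> z \<in> GF n \<Longrightarrow> (z :: 'a alg_closure) \<in> GF (n mod e)"
proof -
  assume z: "z \<in> GF e" "z \<in> GF n"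
  have "z = z ^ (CARD('a) ^ (e * (n div e) + n mod e))" using z(2) by (simp add: GF_iff)
  also have "\<dots> = (z ^ (CARD('a) ^ (e * (n div e)))) ^ (CARD('a) ^ (n mod e))" by (simp only: power_add power_mult)
  also have "\<dots> = z ^ (CARD('a) ^ (n mod e))" using GF_frob_mult[OF z(1)] by simp
  finally show ?thesis by (simp add: GF_iff)
qed

lemma GF_partition:
  assumes "n > 0"
  shows "GF n = (\<Union>e\<in>{e. e dvd n}. primitive_elements e :: 'a alg_closure set)"
    and "e dvd n \<Longrightarrow> e' dvd n \<Longrightarrow> e \<noteq> e' \<Longrightarrow>
      primitive_elements e \<inter> primitive_elements e' = ({} :: 'a alg_closure set)"
proof -
  \<comment> \<open>The degree is described by \<open>z\<close> alone, so two classes that share an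
    element coincide.\<close>
  have least: "e = (LEAST e. e > 0 \<and> z \<in> GF e)" if "z \<in> primitive_elements e" "e > 0"
    for z :: "'a alg_closure" and e
  proof -
    define l where "l = (LEAST e. e > 0 \<and> z \<in> GF e)"
    have ze: "z \<in> GF e" using that by (simp add: primitive_elements_def)
    hence l: "l > 0" "z \<in> GF l" "l \<le> e"
      using LeastI[of "\<lambda>e. e > 0 \<and> z \<in> GF e" e] Least_le[of "\<lambda>e. e > 0 \<and> z \<in> GF e" e] that(2)
      by (auto simp: l_def)
    have "e mod l = 0"
    proof (rule ccontr)
      assume "e mod l \<noteq> 0"
      hence "e mod l > 0 \<and> z \<in> GF (e mod l)" using GF_mod[OF l(2) ze] by simp
      hence "l \<le> e mod l" unfolding l_def by (rule Least_le)
      thus False using mod_less_divisor[OF l(1), of e] by linarith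
    qed
    hence "l dvd e" by auto
    hence "\<not> l < e" using that(1) l(2) unfolding primitive_elements_def by blast
    hence "l = e" using l(3) by simp
    thus ?thesis by (simp add: l_def)
  qed
  show "GF n = (\<Union>e\<in>{e. e dvd n}. primitive_elements e :: 'a alg_closure set)"
  proof (intro equalityI subsetI)
    fix z :: "'a alg_closure" assume z: "z \<in> GF n"
    \<comment> \<open>Minimality among the divisors of \<open>n\<close> suffices:
      \<open>primitive_elements l\<close> only tests divisors of \<open>l\<close>, and these divide
      \<open>n\<close>.\<close>
    define l where "l = (LEAST e. e dvd n \<and> z \<in> GF e)"
    have l: "l dvd n" "z \<in> GF l" using LeastI[of "\<lambda>e. e dvd n \<and> z \<in> GF e" n] z by (auto simp: l_def)
    have "z \<notin> GF k" if "k dvd l" "k < l" for k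
      using not_less_Least[of k "\<lambda>e. e dvd n \<and> z \<in> GF e", folded l_def, OF that(2)] dvd_trans[OF that(1) l(1)]
      by simp
    thus "z \<in> (\<Union>e\<in>{e. e dvd n}. primitive_elements e)" using l by (auto simp: primitive_elements_def)
  next
    fix z :: "'a alg_closure" assume "z \<in> (\<Union>e\<in>{e. e dvd n}. primitive_elements e)"
    then obtain e where "e dvd n" "z \<in> GF e" by (auto simp: primitive_elements_def)
    thus "z \<in> GF n" by (rule GF_mono)
  qed
  show "primitive_elements e \<inter> primitive_elements e' = ({} :: 'a alg_closure set)" if "e dvd n" "e' dvd n" "e \<noteq> e'"
    using least[of _ e] least[of _ e'] dvd_pos_nat[OF assms that(1)] dvd_pos_nat[OF assms that(2)] that(3)
    by blast
qed

lemma card_GF_filter: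
  assumes "n > 0"
  shows "card {z :: 'a alg_closure. z \<in> GF n \<and> P z} = (\<Sum>e | e dvd n. card {z \<in> primitive_elements e. P z})"
proof -
  have "{z :: 'a alg_closure. z \<in> GF n \<and> P z} = (\<Union>e\<in>{e. e dvd n}. {z \<in> primitive_elements e. P z})"
    unfolding GF_partition(1)[OF assms] by blast
  also have "card \<dots> = (\<Sum>e | e dvd n. card {z \<in> primitive_elements e. P z})"
  proof (rule card_UN_disjoint)
    show "finite {e. e dvd n}" using assms by simp
    have "primitive_elements e \<subseteq> (GF n :: 'a alg_closure set)" if "e dvd n" for e
      using that unfolding GF_partition(1)[OF assms] by blast
    hence "finite (primitive_elements e :: 'a alg_closure set)" if "e dvd n" for e
      using that by (intro finite_subset[OF _ finite_GF[OF assms]]) blast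
    thus "\<forall>e\<in>{e. e dvd n}. finite {z \<in> primitive_elements e. P z}" by simp
  qed (use GF_partition(2)[OF assms] in blast)
  finally show ?thesis .
qed

text \<open>Sorting \<open>GF m\<close> by degree writes \<open>q^m\<close> as a sum over the
  divisors of \<open>m\<close>, and inversion yields \<open>I_sum\<close>. This is where the
  summands of the correction term come from.\<close>

lemma card_primitive_elements: "n > 0 \<Longrightarrow> int (card (primitive_elements n :: 'a alg_closure set)) = I_sum CARD('a) n"
proof (rule sym, rule I_sum_inversion)
  fix m assume "n > 0" "m dvd n"
  hence "m > 0" by (auto intro: Nat.gr0I)
  thus "int CARD('a) ^ m = (\<Sum>e | e dvd m. int (card (primitive_elements e :: 'a alg_closure set)))"
    using card_GF_filter[of m "\<lambda>_. True"] card_GF[of m] by (simp flip: of_nat_sum of_nat_power)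
qed

section \<open>Traces in towers and the Artin-Schreier map\<close>

lemma field_trace_tower:
  assumes z: "z \<in> GF e"
  shows "field_trace (e * k) z = of_nat k * field_trace e (z :: 'a alg_closure)"
proof (induction k)
  case (Suc k)
  have "field_trace (e * Suc k) z = (\<Sum>i<e * k + e. z ^ (CARD('a) ^ i))" by (simp add: field_trace_def add.commute)
  also have "\<dots> = (\<Sum>i<e * k. z ^ (CARD('a) ^ i)) + (\<Sum>i<e. z ^ (CARD('a) ^ (e * k + i)))"
    by (rule sum_lessThan_add)
  \<comment> \<open>The conjugates of an element of \<open>GF e\<close> repeat with period
    \<open>e\<close>.\<close>
  also have "(\<Sum>i<e. z ^ (CARD('a) ^ (e * k + i))) = (\<Sum>i<e. z ^ (CARD('a) ^ i))"
    using GF_frob_mult[OF z] by (simp add: power_add power_mult)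
  finally show ?case using Suc by (simp add: field_trace_def algebra_simps)
qed (simp add: field_trace_def)

text \<open>Frobenius is additive, so the sum telescopes. A vanishing trace of
  \<open>y ^ q - y\<close> therefore says that \<open>y \<in> GF n\<close>.\<close>

lemma field_trace_artin_schreier: "field_trace n (y ^ CARD('a) - y) = y ^ (CARD('a) ^ n) - (y :: 'a alg_closure)"
proof -
  have "field_trace n (y ^ CARD('a) - y) = (\<Sum>i<n. y ^ (CARD('a) ^ Suc i) - y ^ (CARD('a) ^ i))"
    by (simp add: field_trace_def frob_diff flip: power_mult)
  also have "\<dots> = y ^ (CARD('a) ^ n) - y" by (subst sum_lessThan_telescope) simp
  finally show ?thesis .
qed

text \<open>Additive Hilbert 90 by counting: the \<open>q\<close> roots always exist in the closure,
  and by the telescoped trace either all or none of them lie in \<open>GF n\<close>.\<close>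

lemma card_artin_schreier_roots:
  "card {y \<in> GF n. y ^ CARD('a) - y = (z :: 'a alg_closure)} = (if field_trace n z = 0 then CARD('a) else 0)"
proof -
  have "y \<in> GF n \<longleftrightarrow> field_trace n z = 0" if "y ^ CARD('a) - y = z" for y
    using field_trace_artin_schreier[of n y] that by (simp add: GF_iff)
  hence "{y \<in> GF n. y ^ CARD('a) - y = z} = (if field_trace n z = 0 then {y. y ^ CARD('a) - y = z} else {})" by auto
  thus ?thesis using card_roots_frobenius[of 1 z] by simp
qed

section \<open>Trace-zero elements sorted by degree\<close>

lemma of_nat_ac_eq_0: "of_nat k = (0 :: 'a alg_closure) \<longleftrightarrow> p dvd k"
  using CHAR_a by (simp add: of_nat_eq_0_iff_char_dvd)

lemma card_trace_zero_elements:
  assumes t: "\<not> p dvd t"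
  shows "card (trace_zero_elements d (p ^ k * t) :: 'a alg_closure set) =
    (\<Sum>u | u dvd t. G_count (0 :: 'a) d (p ^ k * u) + (\<Sum>i<k. card (primitive_elements (p ^ i * u) :: 'a alg_closure set)))"
proof -
  define n where "n = p ^ k * t"
  have t0: "t > 0" using t by (auto intro: Nat.gr0I)
  have p0: "p > 0" using p prime_gt_0_nat by blast
  have n0: "n > 0" using t0 p0 by (simp add: n_def)
  define P where "P = (\<lambda>z :: 'a alg_closure. field_trace n z = 0 \<and> field_trace n (z powi d) = 0)"
  have "card (trace_zero_elements d n :: 'a alg_closure set) = card {z :: 'a alg_closure. z \<in> GF n \<and> P z}" by (simp add: trace_zero_elements_def P_def)
  also have "\<dots> = (\<Sum>e | e dvd n. card {z \<in> primitive_elements e. P z})" by (rule card_GF_filter[OF n0])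
  also have "\<dots> = (\<Sum>u | u dvd t. \<Sum>i\<le>k. card {z \<in> primitive_elements (p ^ i * u). P z})"
    unfolding n_def by (rule sum_divisors_prime_power_mult[OF p t])
  also have "\<dots> = (\<Sum>u | u dvd t. G_count (0 :: 'a) d (p ^ k * u) + (\<Sum>i<k. card (primitive_elements (p ^ i * u) :: 'a alg_closure set)))"
  proof (rule sum.cong)
    fix u assume "u \<in> {u. u dvd t}"
    \<comment> \<open>The class of degree \<open>p ^ i * u\<close> has codegree
      \<open>p ^ (k - i) * v\<close> in \<open>n\<close>, with \<open>v\<close> prime to
      \<open>p\<close>.\<close>
    then obtain v where v: "t = u * v" by auto
    have tr: "field_trace n z = of_nat (p ^ (k - i) * v) * field_trace (p ^ i * u) z"
      if "i \<le> k" "z \<in> GF (p ^ i * u)" for i and z :: "'a alg_closure"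
    proof -
      have "p ^ k = p ^ i * p ^ (k - i)" using that(1) by (simp flip: power_add)
      hence "n = (p ^ i * u) * (p ^ (k - i) * v)" by (simp add: n_def v)
      thus ?thesis using field_trace_tower[OF that(2)] by metis
    qed
    have 1: "{z \<in> primitive_elements (p ^ i * u). P z} = primitive_elements (p ^ i * u)" if "i < k" for i
    proof -
      have "p dvd p ^ (k - i) * v" using that by (intro dvd_mult2 dvd_power) auto
      hence "of_nat (p ^ (k - i) * v) = (0 :: 'a alg_closure)" using of_nat_ac_eq_0 by blast
      hence "field_trace n z = 0" if "z \<in> GF (p ^ i * u)" for z :: "'a alg_closure"
        using tr[OF _ that] \<open>i < k\<close> by simp
      \<comment> \<open>The degree of \<open>z powi d\<close> may be smaller than that of
        \<open>z\<close>, but the tower formula only asks that it lies in the same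
        \<open>GF\<close>.\<close>
      hence "P z" if "z \<in> primitive_elements (p ^ i * u)" for z
        unfolding P_def using that GF_powi[of z "p ^ i * u" d] by (simp add: primitive_elements_def)
      thus ?thesis by blast
    qed
    have "\<not> p dvd v" using t v by auto
    hence "of_nat v \<noteq> (0 :: 'a alg_closure)" using of_nat_ac_eq_0 by blast
    hence "field_trace n z = 0 \<longleftrightarrow> field_trace (p ^ k * u) z = 0" if "z \<in> GF (p ^ k * u)" for z :: "'a alg_closure"
      using tr[OF _ that] by simp
    hence "P z \<longleftrightarrow> field_trace (p ^ k * u) z = 0 \<and> field_trace (p ^ k * u) (z powi d) = 0"
      if "z \<in> GF (p ^ k * u)" for z
      unfolding P_def using that GF_powi[of z "p ^ k * u" d] by blast
    hence "{z \<in> primitive_elements (p ^ k * u). P z} = {z :: 'a alg_closure.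
       z \<in> GF (p ^ k * u) \<and> (\<forall>n. n dvd p ^ k * u \<and> n < p ^ k * u \<longrightarrow> z \<notin> GF n) \<and>
       field_trace (p ^ k * u) z = 0 \<and> field_trace (p ^ k * u) (z powi d) = to_ac 0}"
      by (auto simp: primitive_elements_def)
    thus "(\<Sum>i\<le>k. card {z \<in> primitive_elements (p ^ i * u). P z}) =
        G_count (0 :: 'a) d (p ^ k * u) + (\<Sum>i<k. card (primitive_elements (p ^ i * u) :: 'a alg_closure set))"
      using 1 by (simp add: G_count_def lessThan_Suc_atMost[symmetric])
  qed simp
  finally show ?thesis by (simp add: n_def)
qed

text \<open>The inversion concerns only the part prime to \<open>p\<close>, with \<open>k\<close>
  fixed. It is applied to \<open>G_count\<close> and the full degree classes together; at
  \<open>u = s\<close> the latter sum up to \<open>S_corr\<close>.\<close>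

theorem G_count_formula:
  assumes s: "\<not> p dvd s"
  shows "rat_of_nat (G_count (0 :: 'a) d (p ^ k * s)) =
    (\<Sum>t | t dvd s. rat_of_int (moebius_mu (s div t)) * of_nat (card (trace_zero_elements d (p ^ k * t) :: 'a alg_closure set)))
      - rat_of_int (S_corr CARD('a) p k s)"
proof -
  have s0: "s > 0" using s by (auto intro: Nat.gr0I)
  have p0: "p > 0" using p prime_gt_0_nat by blast
  have "(\<Sum>t | t dvd s. rat_of_int (moebius_mu (s div t)) * of_nat (card (trace_zero_elements d (p ^ k * t) :: 'a alg_closure set))) =
      of_nat (G_count (0 :: 'a) d (p ^ k * s) + (\<Sum>i<k. card (primitive_elements (p ^ i * s) :: 'a alg_closure set)))"
  proof (rule moebius_inversion[OF s0])
    fix t assume "t dvd s"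
    hence "\<not> p dvd t" using s dvd_trans by blast
    thus "rat_of_nat (card (trace_zero_elements d (p ^ k * t) :: 'a alg_closure set)) =
      (\<Sum>u | u dvd t. of_nat (G_count (0 :: 'a) d (p ^ k * u) + (\<Sum>i<k. card (primitive_elements (p ^ i * u) :: 'a alg_closure set))))"
      by (simp only: card_trace_zero_elements[of t] of_nat_sum not_False_eq_True)
  qed
  moreover have "S_corr CARD('a) p k s = int (\<Sum>i<k. card (primitive_elements (p ^ i * s) :: 'a alg_closure set))"
    using card_primitive_elements s0 p0 by (simp add: S_corr_def)
  ultimately show ?thesis by simp
qed

end

section \<open>Subrings and subfields of a field\<close>

abbreviation subring_type :: "'b::field set \<Rightarrow> bool" where
  "subring_type A \<equiv> subring A ring_of_type_algebra"

abbreviation subfield_type :: "'b::field set \<Rightarrow> bool" where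
  "subfield_type A \<equiv> subfield A ring_of_type_algebra"

lemma ring_of_type_algebra_simps [simp]:
  "carrier (ring_of_type_algebra :: 'b::field ring) = UNIV"
  "x \<otimes>\<^bsub>ring_of_type_algebra\<^esub> y = x * (y::'b)"
  "x \<oplus>\<^bsub>ring_of_type_algebra\<^esub> y = x + (y::'b)"
  "\<zero>\<^bsub>ring_of_type_algebra\<^esub> = (0::'b)"
  "\<one>\<^bsub>ring_of_type_algebra\<^esub> = (1::'b)"
  by (simp_all add: ring_of_type_algebra_def)

lemma a_inv_type [simp]: "\<ominus>\<^bsub>ring_of_type_algebra\<^esub> x = - (x::'b::field)"
proof -
  interpret field "ring_of_type_algebra :: 'b ring" by (rule field_from_type_algebra)
  show ?thesis using minus_equality[of "-x" x] by simp
qed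

lemma m_inv_type [simp]:
  "(x::'b::field) \<noteq> 0 \<Longrightarrow> inv\<^bsub>ring_of_type_algebra\<^esub> x = inverse x"
proof -
  interpret field "ring_of_type_algebra :: 'b ring" by (rule field_from_type_algebra)
  show "x \<noteq> 0 \<Longrightarrow> inv\<^bsub>ring_of_type_algebra\<^esub> x = inverse x"
    using comm_inv_char[of x "inverse x"] by simp
qed

context
  fixes A :: "'b::field set"
  assumes A: "subring_type A"
begin

lemma subring_type_0: "0 \<in> A" and subring_type_1: "1 \<in> A"
  using subringE(2,3)[OF A] by simp_all

lemma subring_type_uminus: "x \<in> A \<Longrightarrow> - x \<in> A"
  using subringE(5)[OF A, of x] by simp

lemma subring_type_add: "x \<in> A \<Longrightarrow> y \<in> A \<Longrightarrow> x + y \<in> A"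
  and subring_type_mult: "x \<in> A \<Longrightarrow> y \<in> A \<Longrightarrow> x * y \<in> A"
  using subringE(6,7)[OF A, of x y] by simp_all

lemma subring_type_diff: "x \<in> A \<Longrightarrow> y \<in> A \<Longrightarrow> x - y \<in> A"
  using subring_type_add[of x "-y"] subring_type_uminus[of y] by simp

lemma subring_type_power: "x \<in> A \<Longrightarrow> x ^ n \<in> A"
  by (induction n) (auto intro: subring_type_1 subring_type_mult)

lemma subring_type_sum: "(\<And>i. i \<in> I \<Longrightarrow> f i \<in> A) \<Longrightarrow> sum f I \<in> A"
  by (induction I rule: infinite_finite_induct) (auto intro: subring_type_0 subring_type_add)

lemmas subring_type_closed = subring_type_0 subring_type_1 subring_type_uminus subring_type_add
  subring_type_mult subring_type_diff subring_type_power

end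

lemma subring_typeI:
  assumes "1 \<in> A" "\<And>x y. x \<in> A \<Longrightarrow> y \<in> A \<Longrightarrow> x - y \<in> A"
    "\<And>x y. x \<in> A \<Longrightarrow> y \<in> A \<Longrightarrow> x * y \<in> A"
  shows "subring_type (A :: 'b::field set)"
proof -
  interpret field "ring_of_type_algebra :: 'b ring" by (rule field_from_type_algebra)
  have 0: "0 \<in> A" using assms(2)[OF assms(1) assms(1)] by simp
  have um: "x \<in> A \<Longrightarrow> - x \<in> A" for x using assms(2)[OF 0, of x] by simp
  have "x \<in> A \<Longrightarrow> y \<in> A \<Longrightarrow> x + y \<in> A" for x y using assms(2)[of x "-y"] um by simp
  thus ?thesis using assms um by (intro subringI) auto
qed

lemma subfield_typeI:
  assumes "subring_type A" "\<And>x. x \<in> A \<Longrightarrow> inverse x \<in> A"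
  shows "subfield_type (A :: 'b::field set)"
proof -
  interpret field "ring_of_type_algebra :: 'b ring" by (rule field_from_type_algebra)
  show ?thesis using assms by (intro subfieldI') auto
qed

lemma subfield_type_subring: "subfield_type A \<Longrightarrow> subring_type A"
  by (rule subfieldE(1))

lemma subfield_type_inverse:
  assumes "subfield_type (A :: 'b::field set)" "x \<in> A"
  shows "inverse x \<in> A"
proof (cases "x = 0")
  case False
  interpret field "ring_of_type_algebra :: 'b ring" by (rule field_from_type_algebra)
  show ?thesis using subfield_m_inv(1)[OF assms(1), of x] assms(2) False by simp
qed (use assms in simp)

lemma subfield_type_divide:
  "subfield_type (A :: 'b::field set) \<Longrightarrow> x \<in> A \<Longrightarrow> y \<in> A \<Longrightarrow> x / y \<in> A"
  using subring_type_mult[OF subfield_type_subring, of A x "inverse y"] subfield_type_inverse[of A y]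
  by (simp add: field_simps)

lemma subfield_type_powi:
  "subfield_type (A :: 'b::field set) \<Longrightarrow> x \<in> A \<Longrightarrow> x powi k \<in> A"
  by (auto simp: power_int_def intro!: subring_type_power subfield_type_inverse
      dest: subfield_type_subring)

lemma generate_field_type:
  fixes H :: "'b::field set"
  shows "subfield_type (generate_field ring_of_type_algebra H)"
    and "H \<subseteq> generate_field ring_of_type_algebra H"
    and "subfield_type M \<Longrightarrow> H \<subseteq> M \<Longrightarrow> generate_field ring_of_type_algebra H \<subseteq> M"
proof -
  interpret field "ring_of_type_algebra :: 'b ring" by (rule field_from_type_algebra)
  show "subfield_type (generate_field ring_of_type_algebra H)"
    by (rule generate_field_is_subfield) simp
  show "H \<subseteq> generate_field ring_of_type_algebra H" by (auto intro: generate_field.incl)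
  show "subfield_type M \<Longrightarrow> H \<subseteq> M \<Longrightarrow> generate_field ring_of_type_algebra H \<subseteq> M"
    by (rule generate_field_min_subfield1) auto
qed

section \<open>Polynomials over a subring\<close>

text \<open>Subrings are sets inside one ambient field, so polynomials over them are ambient
  polynomials with restricted coefficients. One polynomial type then serves all coefficient rings at
  once.\<close>

definition polys_over :: "'b::field set \<Rightarrow> 'b poly set" where
  "polys_over A = {f. \<forall>i. Polynomial.coeff f i \<in> A}"

text \<open>The ring \<open>A[z]\<close>. It is already a field when \<open>A\<close> is a field and
  \<open>z\<close> is algebraic over it, by \<open>adjoin_algebraic_subfield\<close>.\<close>

definition adjoin :: "'b::field set \<Rightarrow> 'b \<Rightarrow> 'b set" where
  "adjoin A z = (\<lambda>f. poly f z) ` polys_over A"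

lemma polys_overD: "f \<in> polys_over A \<Longrightarrow> Polynomial.coeff f i \<in> A"
  by (simp add: polys_over_def)

lemma polys_over_mono: "A \<subseteq> B \<Longrightarrow> polys_over A \<subseteq> polys_over B"
  by (auto simp: polys_over_def)

context
  fixes A :: "'b::field set"
  assumes A: "subring_type A"
begin

private lemmas A_closed = subring_type_closed[OF A]

lemma polys_over_0: "0 \<in> polys_over A" and polys_over_1: "1 \<in> polys_over A"
  by (auto simp: polys_over_def A_closed)

lemma polys_over_pCons_iff: "pCons a f \<in> polys_over A \<longleftrightarrow> a \<in> A \<and> f \<in> polys_over A"
  unfolding polys_over_def by (auto simp: coeff_pCons split: nat.splits)

lemma polys_over_uminus: "f \<in> polys_over A \<Longrightarrow> - f \<in> polys_over A"
  and polys_over_add: "f \<in> polys_over A \<Longrightarrow> g \<in> polys_over A \<Longrightarrow> f + g \<in> polys_over A"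
  and polys_over_diff: "f \<in> polys_over A \<Longrightarrow> g \<in> polys_over A \<Longrightarrow> f - g \<in> polys_over A"
  and polys_over_smult: "a \<in> A \<Longrightarrow> f \<in> polys_over A \<Longrightarrow> smult a f \<in> polys_over A"
  and polys_over_monom: "a \<in> A \<Longrightarrow> Polynomial.monom a n \<in> polys_over A"
  by (auto simp: polys_over_def A_closed)

lemma polys_over_mult: "f \<in> polys_over A \<Longrightarrow> g \<in> polys_over A \<Longrightarrow> f * g \<in> polys_over A"
  by (auto simp: polys_over_def coeff_mult intro!: subring_type_sum[OF A] A_closed)

lemma polys_over_power: "f \<in> polys_over A \<Longrightarrow> f ^ n \<in> polys_over A"
  by (induction n) (auto intro: polys_over_1 polys_over_mult)

lemma polys_over_pcompose: "f \<in> polys_over A \<Longrightarrow> g \<in> polys_over A \<Longrightarrow> pcompose f g \<in> polys_over A"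
proof (induction f)
  case (pCons a f)
  thus ?case
    by (auto simp: pcompose_pCons polys_over_pCons_iff polys_over_0 intro!: polys_over_add polys_over_mult)
qed (simp add: polys_over_0)

lemmas polys_over_closed = polys_over_0 polys_over_1 polys_over_uminus polys_over_add
  polys_over_diff polys_over_smult polys_over_monom polys_over_mult polys_over_power
  polys_over_pcompose

lemma poly_polys_over: "f \<in> polys_over A \<Longrightarrow> x \<in> A \<Longrightarrow> poly f x \<in> A"
  by (induction f) (auto simp: polys_over_pCons_iff A_closed)

lemma adjoinI: "f \<in> polys_over A \<Longrightarrow> z = poly f x \<Longrightarrow> z \<in> adjoin A x"
  by (auto simp: adjoin_def)

lemma adjoin_base: "a \<in> A \<Longrightarrow> a \<in> adjoin A x"
  by (rule adjoinI[of "[:a:]"]) (auto simp: polys_over_pCons_iff polys_over_0)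

lemma adjoin_self: "x \<in> adjoin A x"
  by (rule adjoinI[of "[:0,1:]"]) (auto simp: polys_over_pCons_iff polys_over_0 A_closed)

lemma adjoin_subring: "subring_type (adjoin A x)"
proof (rule subring_typeI)
  show "1 \<in> adjoin A x" by (intro adjoin_base A_closed)
  fix y z assume "y \<in> adjoin A x" "z \<in> adjoin A x"
  then obtain f g where fg: "f \<in> polys_over A" "g \<in> polys_over A" "y = poly f x" "z = poly g x"
    by (auto simp: adjoin_def)
  show "y - z \<in> adjoin A x" by (rule adjoinI[of "f - g"]) (use fg in \<open>auto intro: polys_over_diff\<close>)
  show "y * z \<in> adjoin A x" by (rule adjoinI[of "f * g"]) (use fg in \<open>auto intro: polys_over_mult\<close>)
qed

end

lemma adjoin_least: "subring_type B \<Longrightarrow> A \<subseteq> B \<Longrightarrow> x \<in> B \<Longrightarrow> adjoin A x \<subseteq> B"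
  using poly_polys_over[of B] polys_over_mono[of A B] by (auto simp: adjoin_def)

text \<open>Long division, one leading term at a time: the only division is that of two leading
  coefficients, so \<open>L\<close> is never left.\<close>

lemma polys_over_division:
  assumes L: "subfield_type L" and f: "f \<in> polys_over L" "f \<noteq> 0" and m: "m \<in> polys_over L"
  shows "\<exists>g\<in>polys_over L. \<exists>r\<in>polys_over L. m = f * g + r \<and>
    (r = 0 \<or> Polynomial.degree r < Polynomial.degree f)"
  using m
proof (induction "Polynomial.degree m" arbitrary: m rule: less_induct)
  case less
  note Ls = subfield_type_subring[OF L]
  show ?case
  proof (cases "m = 0 \<or> Polynomial.degree m < Polynomial.degree f")
    case True
    thus ?thesis using less.prems by (intro bexI[of _ 0] bexI[of _ m]) (auto intro: polys_over_0[OF Ls])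
  next
    case False
    define c where "c = lead_coeff m / lead_coeff f"
    define n where "n = Polynomial.degree m - Polynomial.degree f"
    define m' where "m' = m - Polynomial.monom c n * f"
    have c: "c \<in> L" unfolding c_def using less.prems f by (intro subfield_type_divide[OF L] polys_overD)
    hence mn: "Polynomial.monom c n \<in> polys_over L" by (rule polys_over_monom[OF Ls])
    have m': "m' \<in> polys_over L"
      unfolding m'_def using less.prems f mn by (intro polys_over_diff[OF Ls] polys_over_mult[OF Ls])
    have c0: "c \<noteq> 0" using False f by (simp add: c_def)
    have dc: "Polynomial.degree (Polynomial.monom c n * f) = Polynomial.degree m"
      using False f c0 by (simp add: degree_mult_eq degree_monom_eq n_def monom_eq_0_iff)
    have "Polynomial.coeff m' (Polynomial.degree m) = 0"
      unfolding m'_def using False f by (simp add: coeff_monom_mult n_def c_def)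
    moreover have "Polynomial.degree m' \<le> Polynomial.degree m"
      unfolding m'_def by (intro degree_diff_le) (auto simp: dc)
    ultimately have "m' = 0 \<or> Polynomial.degree m' < Polynomial.degree m"
      using le_neq_implies_less leading_coeff_0_iff by metis
    hence "\<exists>g\<in>polys_over L. \<exists>r\<in>polys_over L. m' = f * g + r \<and>
        (r = 0 \<or> Polynomial.degree r < Polynomial.degree f)"
    proof
      assume "m' = 0"
      thus ?thesis by (intro bexI[of _ 0]) (auto intro: polys_over_0[OF Ls])
    next
      assume "Polynomial.degree m' < Polynomial.degree m"
      thus ?thesis using less.hyps m' by blast
    qed
    then obtain g r where gr: "g \<in> polys_over L" "r \<in> polys_over L" "m' = f * g + r"
       "(r = 0 \<or> Polynomial.degree r < Polynomial.degree f)" by blast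
    have "m = f * (g + Polynomial.monom c n) + r"
      using gr(3) by (simp add: m'_def algebra_simps)
    thus ?thesis using gr mn by (intro bexI[of _ "g + Polynomial.monom c n"] bexI[of _ r])
      (auto intro: polys_over_add[OF Ls])
  qed
qed

text \<open>Inverses come from the Euclidean algorithm against an annihilating polynomial
  \<open>m\<close> of least degree \<open>d\<close>. A large \<open>f\<close> is reduced modulo
  \<open>m\<close>; for a small \<open>f\<close>, dividing \<open>m\<close> by \<open>f\<close>
  expresses the inverse of \<open>f(w)\<close> through that of a remainder of smaller
  degree.\<close>

lemma adjoin_algebraic_subfield:
  assumes L: "subfield_type L" and m: "m \<in> polys_over L" "m \<noteq> 0" "poly m w = 0"
  shows "subfield_type (adjoin L w)"
proof -
  note Ls = subfield_type_subring[OF L]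
  note Ms = adjoin_subring[OF Ls, of w]
  define d where "d = (LEAST d. \<exists>m\<in>polys_over L. m \<noteq> 0 \<and> poly m w = 0 \<and> Polynomial.degree m = d)"
  have "\<exists>m\<in>polys_over L. m \<noteq> 0 \<and> poly m w = 0 \<and> Polynomial.degree m = d"
    unfolding d_def by (rule LeastI_ex) (use m in blast)
  then obtain m where m: "m \<in> polys_over L" "m \<noteq> 0" "poly m w = 0" "Polynomial.degree m = d"
    by blast
  have min: "d \<le> Polynomial.degree f" if "f \<in> polys_over L" "f \<noteq> 0" "poly f w = 0" for f
    unfolding d_def by (rule Least_le) (use that in blast)
  have inv: "inverse (poly f w) \<in> adjoin L w" if "f \<in> polys_over L" "poly f w \<noteq> 0" for f
    using that
  proof (induction "Polynomial.degree f" arbitrary: f rule: less_induct)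
    case less
    have f0: "f \<noteq> 0" using less.prems by auto
    consider "d \<le> Polynomial.degree f" | "Polynomial.degree f < d" "Polynomial.degree f = 0"
      | "Polynomial.degree f < d" "Polynomial.degree f > 0" by linarith
    thus ?case
    proof cases
      case 1
      obtain g r where gr: "g \<in> polys_over L" "r \<in> polys_over L" "f = m * g + r"
        "r = 0 \<or> Polynomial.degree r < d"
        using polys_over_division[OF L m(1,2) less.prems(1)] m(4) by blast
      have "poly r w = poly f w" using gr(3) m(3) by simp
      moreover have "r \<noteq> 0" using calculation less.prems by auto
      ultimately show ?thesis using less.hyps[of r] gr 1 less.prems by auto
    next
      case 2
      then obtain a where a: "f = [:a:]" by (meson degree_eq_zeroE)
      hence "a \<in> L" using polys_overD[OF less.prems(1), of 0] by simp
      thus ?thesis using a by (simp add: adjoin_base[OF Ls] subfield_type_inverse[OF L])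
    next
      case 3
      obtain g r where gr: "g \<in> polys_over L" "r \<in> polys_over L" "m = f * g + r"
        "r = 0 \<or> Polynomial.degree r < Polynomial.degree f"
        using polys_over_division[OF L less.prems(1) f0 m(1)] by blast
      have rw: "poly r w = - (poly f w * poly g w)" using gr(3) m(3) by (simp add: eq_neg_iff_add_eq_0 add.commute)
      show ?thesis
      proof (cases "poly r w = 0")
        \<comment> \<open>Then \<open>g\<close> would annihilate \<open>w\<close>, although its
          degree is below the least degree \<open>d\<close>.\<close>
        case True
        hence gw: "poly g w = 0" using rw less.prems by simp
        have g0: "g \<noteq> 0"
        proof
          assume "g = 0"
          hence "m = r" using gr by simp
          thus False using gr(4) m 3 by auto
        qed
        have "Polynomial.degree r < d" using gr(4) 3 by auto
        moreover have "Polynomial.degree (f * g) = Polynomial.degree f + Polynomial.degree g"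
          using f0 g0 by (simp add: degree_mult_eq)
        moreover have "f * g = m - r" using gr(3) by simp
        moreover have "Polynomial.degree (m - r) \<le> d"
          by (rule degree_diff_le) (use calculation(1) m(4) in auto)
        ultimately have "Polynomial.degree g < d" using 3 by simp
        thus ?thesis using min[OF gr(1) g0 gw] by simp
      next
        case False
        hence "inverse (poly r w) \<in> adjoin L w" using less.hyps[of r] gr(2,4) by auto
        moreover have "inverse (poly f w) = - (poly g w * inverse (poly r w))"
          using False less.prems unfolding rw by (simp add: field_simps)
        moreover have "poly g w \<in> adjoin L w" using gr(1) by (rule adjoinI[OF Ls]) simp
        ultimately show ?thesis by (metis subring_type_closed(3,5)[OF Ms])
      qed
    qed
  qed
  show ?thesis
  proof (rule subfield_typeI[OF Ms])
    fix x assume "x \<in> adjoin L w"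
    then obtain f where "f \<in> polys_over L" "x = poly f w" by (auto simp: adjoin_def)
    thus "inverse x \<in> adjoin L w" using inv[of f] subring_type_closed(1)[OF Ms]
      by (cases "x = 0") auto
  qed
qed

section \<open>Valuation rings\<close>

text \<open>The maximal ideal, if \<open>V\<close> is a valuation ring. Zero is listed separately
  because \<open>inverse 0 = 0\<close> lies in \<open>V\<close>.\<close>

definition nonunits :: "'b::field set \<Rightarrow> 'b set" where
  "nonunits V = {z \<in> V. z = 0 \<or> inverse z \<notin> V}"

lemma union_chain_subring:
  assumes "C \<noteq> {}" "subset.chain {A. subring_type A} C"
  shows "subring_type (\<Union>C :: 'b::field set)"
proof (rule subring_typeI)
  have sr: "subring_type A" if "A \<in> C" for A using assms(2) that by (auto simp: subset.chain_def)
  have tot: "A \<subseteq> B \<or> B \<subseteq> A" if "A \<in> C" "B \<in> C" for A B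
    using assms(2) that by (auto simp: subset.chain_def)
  show "1 \<in> \<Union>C" using assms(1) sr subring_type_1 by blast
  fix x y assume "x \<in> \<Union>C" "y \<in> \<Union>C"
  then obtain A where A: "A \<in> C" "x \<in> A" "y \<in> A" using tot by blast
  show "x - y \<in> \<Union>C" "x * y \<in> \<Union>C"
    using A subring_type_diff[OF sr[OF A(1)]] subring_type_mult[OF sr[OF A(1)]] by blast+
qed

text \<open>
  If neither \<open>z\<close> nor \<open>1/z\<close> lies in \<open>V\<close>, then \<open>1/t\<close> lies in \<open>V[z]\<close> and in \<open>V[1/z]\<close>. Because
  \<open>1 - t * a\<close> is a unit for all \<open>a \<in> V\<close>, the relation of smaller degree lowers the degree of the other one.
\<close>

lemma maximal_subring_valuation:
  fixes V :: "'b::field set"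
  assumes V: "subring_type V" and t: "t \<in> V" "inverse t \<notin> V" and E: "subfield_type E" "V \<subseteq> E"
    and max: "\<And>A. subring_type A \<Longrightarrow> V \<subseteq> A \<Longrightarrow> A \<subseteq> E \<Longrightarrow> inverse t \<notin> A \<Longrightarrow> A = V"
    and z: "z \<in> E"
  shows "z \<in> V \<or> inverse z \<in> V"
proof (rule ccontr)
  note Vc = subring_type_closed[OF V]
  have t0: "t \<noteq> 0" using t Vc(1) by auto
  \<comment> \<open>\<open>V[y]\<close> is properly larger than \<open>V\<close>, so by maximality
    it contains \<open>1/t\<close>.\<close>
  have ex: "\<exists>f\<in>polys_over V. t * poly f y = 1" if y: "y \<in> E" "y \<notin> V" for y
  proof -
    have "V \<subseteq> adjoin V y" using adjoin_base[OF V] by blast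
    moreover have "adjoin V y \<noteq> V" using adjoin_self[OF V, of y] y(2) by auto
    moreover have "adjoin V y \<subseteq> E" by (rule adjoin_least[OF subfield_type_subring[OF E(1)] E(2) y(1)])
    ultimately have "inverse t \<in> adjoin V y" using max[OF adjoin_subring[OF V]] by blast
    then obtain f where f: "f \<in> polys_over V" "poly f y = inverse t" by (auto simp: adjoin_def)
    thus ?thesis using t0 by (intro bexI[of _ f]) auto
  qed
  \<comment> \<open>If the inverse \<open>u\<close> were missing, a relation
    \<open>t * f(u) = 1\<close> would exist. Clearing powers of \<open>1 - t * a\<close> turns it
    into \<open>t * (b + b') = 1\<close> with \<open>b\<close> and \<open>b'\<close> in
    \<open>V\<close>, so \<open>1/t\<close> would lie in \<open>V\<close>.\<close>
  have unit: "inverse (1 - t * a) \<in> V \<and> 1 - t * a \<noteq> 0" if a: "a \<in> V" for a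
  proof -
    have n0: "1 - t * a \<noteq> 0" using a t inverse_unique by fastforce
    have "inverse (1 - t * a) \<in> V"
    proof (rule ccontr)
      assume nV: "inverse (1 - t * a) \<notin> V"
      define u where "u = inverse (1 - t * a)"
      have key: "\<exists>n. \<exists>b\<in>V. poly f u * (1 - t * a) ^ n = b" if "f \<in> polys_over V" for f
        using that
      proof (induction f)
        case 0
        thus ?case using Vc(1) by auto
      next
        case (pCons c f)
        then obtain n b where nb: "b \<in> V" "poly f u * (1 - t * a) ^ n = b" and c: "c \<in> V"
          by (auto simp: polys_over_pCons_iff[OF V])
        have "poly (pCons c f) u * (1 - t * a) ^ Suc n = c * (1 - t * a) ^ Suc n + b"
          using n0 nb(2) by (simp add: u_def field_simps)
        moreover have "c * (1 - t * a) ^ Suc n + b \<in> V"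
          using c nb(1) a t by (intro Vc)
        ultimately show ?case by blast
      qed
      have pw: "\<exists>b\<in>V. (1 - t * a) ^ n = 1 - t * b" for n
      proof (induction n)
        case (Suc n)
        then obtain b where "b \<in> V" and b: "(1 - t * a) ^ n = 1 - t * b" by blast
        have "(1 - t * a) ^ Suc n = 1 - t * (a + b - t * a * b)" unfolding power_Suc b by (simp add: algebra_simps)
        moreover have "a + b - t * a * b \<in> V" using a t \<open>b \<in> V\<close> by (intro Vc)
        ultimately show ?case by blast
      qed (auto intro: bexI[of _ 0] Vc)
      have "u \<in> E"
        unfolding u_def using a t E by (intro subfield_type_inverse[OF E(1)]) (auto intro!: Vc)
      then obtain f where f: "f \<in> polys_over V" "t * poly f u = 1"
        using ex nV u_def by blast
      obtain n b where nb: "b \<in> V" "poly f u * (1 - t * a) ^ n = b" using key[OF f(1)] by blast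
      obtain b' where b': "b' \<in> V" "(1 - t * a) ^ n = 1 - t * b'" using pw by blast
      have "1 - t * b' = t * b" using f(2) nb(2) b'(2) by (metis mult.assoc mult_1)
      hence "t * (b + b') = 1" by (simp add: algebra_simps)
      hence "inverse t = b + b'" by (rule inverse_unique)
      thus False using t nb b' Vc by auto
    qed
    thus ?thesis using n0 by blast
  qed
  \<comment> \<open>Multiplying \<open>t * g(1/y) = 1\<close> by \<open>y^m\<close> gives
    \<open>(1 - t * g0) * y^m = t * R(y)\<close> with \<open>R\<close> of degree below
    \<open>m\<close>. As \<open>1 - t * g0\<close> is a unit, \<open>y^m = R'(y)\<close>, and this
    rewrites the leading term of \<open>f\<close>.\<close>
  have red: "\<exists>f'\<in>polys_over V. t * poly f' y = 1 \<and> Polynomial.degree f' < Polynomial.degree f"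
    if fg: "f \<in> polys_over V" "g \<in> polys_over V" "t * poly f y = 1" "t * poly g (inverse y) = 1"
      and le: "Polynomial.degree g \<le> Polynomial.degree f" and y: "y \<noteq> 0" for f g y
  proof -
    define n where "n = Polynomial.degree f"
    define m where "m = Polynomial.degree g"
    define g0 where "g0 = Polynomial.coeff g 0"
    define R where "R = reflect_poly g - Polynomial.monom g0 m"
    define v where "v = inverse (1 - t * g0)"
    define R' where "R' = smult (t * v) R"
    define f' where "f' = f - Polynomial.monom (lead_coeff f) n
        + smult (lead_coeff f) (Polynomial.monom 1 (n - m) * R')"
    have m0: "m > 0"
    proof (rule ccontr)
      assume "\<not> m > 0"
      then obtain a where a: "g = [:a:]" unfolding m_def by (meson degree_eq_zeroE neq0_conv)
      hence "inverse t = a" using fg(4) by (intro inverse_unique) simp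
      thus False using t(2) polys_overD[OF fg(2), of 0] a by simp
    qed
    have g0: "g0 \<in> V" unfolding g0_def by (rule polys_overD[OF fg(2)])
    note v = unit[OF g0, folded v_def]
    have refl: "reflect_poly g \<in> polys_over V"
      using fg(2) by (auto simp: polys_over_def coeff_reflect_poly Vc)
    have R: "R \<in> polys_over V"
      unfolding R_def using refl g0 by (intro polys_over_diff[OF V] polys_over_monom[OF V])
    have R': "R' \<in> polys_over V"
      unfolding R'_def using R v t by (intro polys_over_smult[OF V] Vc) auto
    have "Polynomial.degree R \<le> m" unfolding R_def m_def
      by (intro degree_diff_le degree_reflect_poly_le degree_monom_le)
    moreover have "Polynomial.coeff R m = 0" unfolding R_def by (simp add: coeff_reflect_poly m_def g0_def)
    ultimately have "R = 0 \<or> Polynomial.degree R < m" by (rule eq_zero_or_degree_less)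
    hence dR': "Polynomial.degree R' < m" using m0 by (auto simp: R'_def)
    have "t * poly R y = y ^ m * (1 - t * g0)"
      using fg(4) y by (simp add: R_def poly_reflect_poly_nz poly_monom m_def algebra_simps)
    hence pR': "poly R' y = y ^ m" using v by (simp add: R'_def v_def field_simps)
    have "f' \<in> polys_over V" unfolding f'_def using fg(1) R' polys_overD[OF fg(1)]
      by (intro polys_over_add[OF V] polys_over_diff[OF V] polys_over_smult[OF V] polys_over_mult[OF V]
          polys_over_monom[OF V] Vc)
    moreover have "poly f' y = poly f y"
      using le by (simp add: f'_def pR' poly_monom n_def m_def flip: power_add)
    moreover have "Polynomial.degree f' < n"
    proof -
      have n0: "n > 0" using m0 le by (simp add: n_def m_def)
      have "Polynomial.degree (f - Polynomial.monom (lead_coeff f) n) \<le> n"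
        unfolding n_def by (intro degree_diff_le degree_monom_le) auto
      moreover have "Polynomial.coeff (f - Polynomial.monom (lead_coeff f) n) n = 0"
        by (simp add: n_def)
      ultimately have "f - Polynomial.monom (lead_coeff f) n = 0 \<or>
          Polynomial.degree (f - Polynomial.monom (lead_coeff f) n) < n"
        by (rule eq_zero_or_degree_less)
      hence 1: "Polynomial.degree (f - Polynomial.monom (lead_coeff f) n) < n" using n0 by auto
      have "Polynomial.degree (Polynomial.monom 1 (n - m) * R') \<le> (n - m) + Polynomial.degree R'"
        by (rule order.trans[OF degree_mult_le]) (simp add: degree_monom_eq)
      also have "\<dots> < n" using dR' le by (simp add: n_def m_def)
      finally have 2: "Polynomial.degree (smult (lead_coeff f) (Polynomial.monom 1 (n - m) * R')) < n"
        using n0 by (auto simp: degree_smult_eq)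
      show ?thesis unfolding f'_def by (rule degree_add_less[OF 1 2])
    qed
    ultimately show ?thesis using fg(3) by (intro bexI[of _ f']) (auto simp: n_def)
  qed
  have desc: False if "f \<in> polys_over V" "g \<in> polys_over V" "t * poly f y = 1"
    "t * poly g (inverse y) = 1" "y \<noteq> 0" for f g y
    using that
  proof (induction "Polynomial.degree f + Polynomial.degree g" arbitrary: f g y rule: less_induct)
    case less
    show ?case
    proof (cases "Polynomial.degree g \<le> Polynomial.degree f")
      case True
      then obtain f' where "f' \<in> polys_over V" "t * poly f' y = 1" "Polynomial.degree f' < Polynomial.degree f"
        using red less.prems by blast
      thus False using less.hyps[of f' g y] less.prems by simp
    next
      case False
      then obtain g' where "g' \<in> polys_over V" "t * poly g' (inverse y) = 1"
          "Polynomial.degree g' < Polynomial.degree g"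
        using red[of g f "inverse y"] less.prems by auto
      thus False using less.hyps[of f g' y] less.prems by simp
    qed
  qed
  assume "\<not> (z \<in> V \<or> inverse z \<in> V)"
  hence z': "z \<notin> V" "inverse z \<notin> V" by auto
  have "z \<noteq> 0" using z' Vc(1) by auto
  thus False using ex[OF z z'(1)] ex[OF subfield_type_inverse[OF E(1) z] z'(2)] desc by blast
qed

text \<open>In contrast to \<open>is_valuation_ring\<close>, \<open>V = E\<close> is allowed and no
  constant field occurs; properness enters later through a \<open>t\<close> with
  \<open>inverse t \<notin> V\<close>.\<close>

locale valuation_ring =
  fixes V E :: "'b::field set"
  assumes E: "subfield_type E" and V: "subring_type V" and VE: "V \<subseteq> E"
    and total: "z \<in> E \<Longrightarrow> z \<in> V \<or> inverse z \<in> V"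

text \<open>Zorn's lemma for the subrings between \<open>A\<close> and \<open>E\<close> that omit
  \<open>inverse t\<close>: omitting one fixed element survives unions of chains. A maximal one is a
  valuation ring by \<open>maximal_subring_valuation\<close>.\<close>

lemma ex_valuation_ring:
  fixes A :: "'b::field set"
  assumes A: "subring_type A" "A \<subseteq> E" and E: "subfield_type E" and t: "t \<in> A" "inverse t \<notin> A"
  obtains V where "valuation_ring V E" "A \<subseteq> V" "inverse t \<notin> V"
proof -
  define S where "S = {B. subring_type B \<and> A \<subseteq> B \<and> B \<subseteq> E \<and> inverse t \<notin> B}"
  have "\<exists>M\<in>S. \<forall>B\<in>S. M \<subseteq> B \<longrightarrow> B = M"
  proof (rule subset_Zorn_nonempty)
    show "S \<noteq> {}" using A t by (auto simp: S_def)
    fix C assume C: "C \<noteq> {}" "subset.chain S C"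
    have "subset.chain {A. subring_type A} C" using C(2) by (auto simp: subset.chain_def S_def)
    moreover have "C \<subseteq> S" using C(2) by (auto simp: subset.chain_def)
    ultimately show "\<Union>C \<in> S" using union_chain_subring[OF C(1)] C(1) by (auto simp: S_def)
  qed
  then obtain V where V: "V \<in> S" "\<And>B. B \<in> S \<Longrightarrow> V \<subseteq> B \<Longrightarrow> B = V" by blast
  show thesis
  proof (rule that)
    show "valuation_ring V E"
    proof (rule valuation_ring.intro)
      fix z assume "z \<in> E"
      show "z \<in> V \<or> inverse z \<in> V"
        proof (rule maximal_subring_valuation[of V t E])
        show "B = V" if "subring_type B" "V \<subseteq> B" "B \<subseteq> E" "inverse t \<notin> B" for B
          using V(1) that by (intro V(2)) (auto simp: S_def)
      qed (use V(1) t E \<open>z \<in> E\<close> in \<open>auto simp: S_def\<close>)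
    qed (use V E in \<open>auto simp: S_def\<close>)
  qed (use V in \<open>auto simp: S_def\<close>)
qed

context valuation_ring
begin

lemmas Vc = subring_type_closed[OF V]

lemma nonunits_sub: "z \<in> nonunits V \<Longrightarrow> z \<in> V"
  by (simp add: nonunits_def)

lemma nonunits_0: "0 \<in> nonunits V"
  by (simp add: nonunits_def Vc)

lemma nonunits_not_1: "1 \<notin> nonunits V"
  by (simp add: nonunits_def Vc)

lemma nonunits_mult: "x \<in> nonunits V \<Longrightarrow> y \<in> V \<Longrightarrow> x * y \<in> nonunits V"
proof -
  assume x: "x \<in> nonunits V" and y: "y \<in> V"
  have "inverse x \<in> V" if "inverse (x * y) \<in> V" "x * y \<noteq> 0"
    using Vc(5)[OF y that(1)] that by (simp add: field_simps)
  thus ?thesis using x y by (auto simp: nonunits_def Vc)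
qed

lemma nonunits_mult': "x \<in> V \<Longrightarrow> y \<in> nonunits V \<Longrightarrow> x * y \<in> nonunits V"
  using nonunits_mult[of y x] by (simp add: mult.commute)

lemma nonunits_uminus: "x \<in> nonunits V \<Longrightarrow> - x \<in> nonunits V"
  using nonunits_mult'[of "-1" x] Vc by simp

text \<open>One of \<open>x / y\<close> and \<open>y / x\<close> lies in \<open>V\<close>, so the
  sum is a multiple of \<open>y\<close> or of \<open>x\<close> by an element of
  \<open>V\<close>.\<close>

lemma nonunits_add: 
  assumes "x \<in> nonunits V" "y \<in> nonunits V"
  shows "x + y \<in> nonunits V"
proof -
  have *: "x + y \<in> nonunits V" if "x \<in> nonunits V" "y \<in> nonunits V" "y \<noteq> 0" "x / y \<in> V" for x y
  proof -
    have "y * (x / y + 1) \<in> nonunits V" using that by (intro nonunits_mult Vc)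
    moreover have "y * (x / y + 1) = x + y" using that by (simp add: algebra_simps)
    ultimately show ?thesis by simp
  qed
  show ?thesis
  proof (cases "x = 0 \<or> y = 0")
    case False
    have "x / y \<in> E" using assms VE nonunits_sub by (intro subfield_type_divide[OF E]) auto
    hence "x / y \<in> V \<or> y / x \<in> V" using total by fastforce
    thus ?thesis using *[of x y] *[of y x] assms False by (auto simp: add.commute)
  qed (use assms in auto)
qed

lemma nonunits_diff: "x \<in> nonunits V \<Longrightarrow> y \<in> nonunits V \<Longrightarrow> x - y \<in> nonunits V"
  using nonunits_add[of x "-y"] nonunits_uminus[of y] by simp

lemma nonunits_sum: "(\<And>i. i \<in> I \<Longrightarrow> f i \<in> nonunits V) \<Longrightarrow> sum f I \<in> nonunits V"
  by (induction I rule: infinite_finite_induct) (auto intro: nonunits_0 nonunits_add)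

lemma nonunits_iff: "z \<in> V \<Longrightarrow> z \<notin> nonunits V \<longleftrightarrow> z \<noteq> 0 \<and> inverse z \<in> V"
  by (auto simp: nonunits_def)

lemma unit_plus_nonunit:
  assumes "v \<in> V" "v \<notin> nonunits V" "x \<in> nonunits V"
  shows "v + x \<in> V" "v + x \<notin> nonunits V"
  using nonunits_diff[of "v + x" x] assms nonunits_sub[of x] by (auto intro: Vc)

lemma unit_mult:
  "u \<in> V \<Longrightarrow> u \<notin> nonunits V \<Longrightarrow> v \<in> V \<Longrightarrow> v \<notin> nonunits V \<Longrightarrow> u * v \<in> V \<and> u * v \<notin> nonunits V"
  by (auto simp: nonunits_iff Vc)

lemma unit_mult_iff:
  assumes "u \<in> V" "u \<notin> nonunits V"
  shows "u * z \<in> V \<longleftrightarrow> z \<in> V" "u * z \<in> nonunits V \<longleftrightarrow> z \<in> nonunits V"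
proof -
  have u: "inverse u \<in> V" "u \<noteq> 0" using assms nonunits_iff by auto
  have z: "z = inverse u * (u * z)" using u by simp
  show "u * z \<in> V \<longleftrightarrow> z \<in> V" using Vc(5)[OF assms(1), of z] Vc(5)[OF u(1), of "u * z"] z by auto
  show "u * z \<in> nonunits V \<longleftrightarrow> z \<in> nonunits V"
    using nonunits_mult'[OF assms(1), of z] nonunits_mult'[OF u(1), of "u * z"] z by auto
qed

text \<open>Valuation rings are integrally closed, by
  \<open>z = z ^ n * inverse z ^ (n - 1)\<close>. An element whose valuation is a fraction of that
  of \<open>t\<close> can thus be tested through its \<open>q\<close>-th power.\<close>

lemma power_mem_iff:
  assumes "z \<in> E" "n > 0"
  shows "z ^ n \<in> V \<longleftrightarrow> z \<in> V" "z ^ n \<in> nonunits V \<longleftrightarrow> z \<in> nonunits V"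
proof -
  have 1: "z \<in> V" if "z ^ n \<in> V"
  proof (cases "z \<in> V")
    case False
    hence "z \<noteq> 0" "inverse z \<in> V" using Vc(1) total[OF assms(1)] by auto
    hence "z ^ n * inverse z ^ (n - 1) \<in> V" using that by (intro Vc(5) Vc(7)[of "inverse z"])
    also have "z ^ n * inverse z ^ (n - 1) = z"
      using assms(2) \<open>z \<noteq> 0\<close> by (cases n) (auto simp: field_simps)
    finally show ?thesis .
  qed simp
  show "z ^ n \<in> V \<longleftrightarrow> z \<in> V" using 1 Vc(7) by blast
  have "z ^ n = z * z ^ (n - 1)" using assms(2) by (cases n) auto
  hence 2: "z ^ n \<in> nonunits V" if "z \<in> nonunits V"
    using nonunits_mult[OF that, of "z ^ (n - 1)"] nonunits_sub[OF that] by (auto simp: Vc)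
  have 3: "z \<in> nonunits V" if "z ^ n \<in> nonunits V"
  proof (rule ccontr)
    assume "z \<notin> nonunits V"
    moreover have "z \<in> V" using 1 that nonunits_sub by blast
    ultimately have "z \<noteq> 0" "inverse z \<in> V" using nonunits_iff[of z] \<open>z \<notin> nonunits V\<close> by auto
    hence "inverse (z ^ n) \<in> V" "z ^ n \<noteq> 0" using Vc(7)[of "inverse z" n] by (auto simp: power_inverse)
    thus False using that by (auto simp: nonunits_def)
  qed
  show "z ^ n \<in> nonunits V \<longleftrightarrow> z \<in> nonunits V" using 2 3 by blast
qed

end

section \<open>Artin-Schreier extensions of a discrete valuation ring\<close>

text \<open>Degree one without a quotient ring: each residue class contains a constant.
  \<open>residue_field_dimension_1_iff\<close> identifies this with the dimension in
  \<open>has_place_degree\<close>.\<close>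

definition rational_valuation :: "'b::field set \<Rightarrow> 'b set \<Rightarrow> bool" where
  "rational_valuation K V \<longleftrightarrow> (\<forall>z\<in>V. \<exists>c\<in>K. z - c \<in> nonunits V)"

text \<open>\<open>R\<close> is a discrete valuation ring of \<open>L\<close> with uniformizer
  \<open>t\<close> and residue field \<open>K\<close>. Finite and infinite places of the rational
  function field are both instances, so the local analysis is done once.\<close>

locale dvr =
  fixes R L K :: "'b::field set" and t :: 'b
  assumes L: "subfield_type L" and K: "subfield_type K" and R: "subring_type R"
    and KR: "K \<subseteq> R" and RL: "R \<subseteq> L" and t: "t \<in> R" "inverse t \<notin> R"
    and factor: "z \<in> L \<Longrightarrow> z \<noteq> 0 \<Longrightarrow> \<exists>k::int. \<exists>u\<in>R. inverse u \<in> R \<and> u \<noteq> 0 \<and> z = t powi k * u"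
    and residue: "z \<in> R \<Longrightarrow> \<exists>c\<in>K. \<exists>y\<in>R. z = c + t * y"
begin

lemmas Rc = subring_type_closed[OF R]

lemma t_neq_0: "t \<noteq> 0"
  using t Rc(1) by auto

definition order_at :: "'b \<Rightarrow> int" where
  "order_at z = (SOME k. \<exists>u\<in>R. inverse u \<in> R \<and> u \<noteq> 0 \<and> z = t powi k * u)"

lemma order_at:
  assumes "z \<in> L" "z \<noteq> 0"
  obtains u where "u \<in> R" "inverse u \<in> R" "u \<noteq> 0" "z = t powi (order_at z) * u"
proof -
  have "\<exists>u\<in>R. inverse u \<in> R \<and> u \<noteq> 0 \<and> z = t powi (order_at z) * u"
    unfolding order_at_def by (rule someI_ex) (rule factor[OF assms])
  thus thesis using that by blast
qed

end

text \<open>\<open>V\<close> lies above \<open>R\<close>: since \<open>t\<close> is in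
  \<open>V\<close> but not invertible there, the maximal ideal of \<open>R\<close> is contained in
  that of \<open>V\<close>.\<close>

locale dvr_ext = dvr R L K t + valuation_ring V E for R L K :: "'b::field set" and t V E +
  assumes LE: "L \<subseteq> E" and RV: "R \<subseteq> V" and tV: "inverse t \<notin> V"
begin

lemma t_nonunit: "t \<in> nonunits V"
  using t RV tV by (auto simp: nonunits_def)

lemma t_E: "t \<in> E"
  using t RL LE by auto

lemma const_nonunit: "c \<in> K \<Longrightarrow> c \<in> nonunits V \<Longrightarrow> c = 0"
  using subfield_type_inverse[OF K, of c] KR RV by (auto simp: nonunits_def)

lemma R_unit: "u \<in> R \<Longrightarrow> inverse u \<in> R \<Longrightarrow> u \<noteq> 0 \<Longrightarrow> u \<in> V \<and> u \<notin> nonunits V"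
  using RV by (auto simp: nonunits_def)

lemma t_powi_unit:
  assumes v: "v \<in> V" "v \<notin> nonunits V"
  shows "t powi k * v \<in> V \<longleftrightarrow> k \<ge> 0" "t powi k * v \<in> nonunits V \<longleftrightarrow> k > 0"
proof -
  have pos: "t ^ n \<in> nonunits V" if "n > 0" for n
    using power_mem_iff(2)[OF t_E that] t_nonunit by simp
  have neg: "inverse (t ^ n) \<notin> V" if "n > 0" for n
    using pos[OF that] t_neq_0 by (simp add: nonunits_def)
  have c: "t powi k * v \<in> V \<longleftrightarrow> t powi k \<in> V" "t powi k * v \<in> nonunits V \<longleftrightarrow> t powi k \<in> nonunits V"
    using unit_mult_iff[OF v, of "t powi k"] by (simp_all add: mult.commute)
  consider "k > 0" | "k = 0" | "k < 0" by linarith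
  thus "t powi k * v \<in> V \<longleftrightarrow> k \<ge> 0" "t powi k * v \<in> nonunits V \<longleftrightarrow> k > 0"
    unfolding c using pos[of "nat k"] neg[of "nat (-k)"] nonunits_sub[of "t ^ nat k"]
      nonunits_sub[of "inverse (t ^ nat (- k))"] nonunits_not_1 Vc(2)
    by (cases; force simp: power_int_def power_inverse)+
qed

text \<open>An element of negative order is not in \<open>V\<close>; so \<open>V\<close> meets
  \<open>L\<close> exactly in \<open>R\<close>.\<close>

lemma L_V_R: "z \<in> L \<Longrightarrow> z \<in> V \<Longrightarrow> z \<in> R"
proof (cases "z = 0")
  case False
  assume z: "z \<in> L" "z \<in> V"
  obtain u where u: "u \<in> R" "inverse u \<in> R" "u \<noteq> 0" "z = t powi (order_at z) * u"
    using order_at[OF z(1) False] .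
  have "order_at z \<ge> 0" using t_powi_unit(1) R_unit u z by metis
  hence "z = t ^ nat (order_at z) * u" using u(4) by (simp add: power_int_def)
  thus "z \<in> R" using t u by (metis Rc(5,7))
qed (simp add: Rc)

end

section \<open>The totally ramified case\<close>

text \<open>If valuations are scaled so that \<open>t\<close> gets \<open>q\<close>, then
  \<open>w\<close> gets \<open>-e\<close>. As \<open>e\<close> is prime to \<open>q\<close>, the
  place is totally ramified.\<close>

locale artin_schreier_ram = dvr_ext R L K t V E for R L K :: "'b::field set" and t V E +
  fixes w u :: 'b and q e :: nat
  assumes w: "w \<in> E" "w ^ q - w = t powi (- int e) * u" and q: "q \<ge> 2" and e: "e > 0" "coprime e q"
    and u: "u \<in> R" "inverse u \<in> R" "u \<noteq> 0"
begin

lemma w_notin: "w \<notin> V"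
proof
  assume "w \<in> V"
  hence "w ^ q - w \<in> V" by (intro Vc)
  thus False using t_powi_unit(1)[of u] R_unit[OF u] w(2) e by simp
qed

lemma w_neq_0: "w \<noteq> 0"
  using w_notin Vc(1) by auto

text \<open>As \<open>w\<close> has a pole, \<open>w ^ q - w\<close> is \<open>w ^ q\<close> times a
  unit, namely \<open>1 - inverse w ^ (q - 1)\<close>.\<close>

lemma w_power_q: "\<exists>v. v \<in> V \<and> v \<notin> nonunits V \<and> w ^ q = t powi (- int e) * v"
proof -
  have iw: "inverse w \<in> nonunits V"
    using w_notin total[OF w(1)] by (auto simp: nonunits_def)
  define x where "x = 1 + (- (inverse w ^ (q - 1)))"
  have "inverse w ^ (q - 1) \<in> nonunits V"
    using power_mem_iff(2)[of "inverse w" "q - 1"] iw q subfield_type_inverse[OF E w(1)] by simp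
  hence x: "x \<in> V" "x \<notin> nonunits V"
    unfolding x_def by (intro unit_plus_nonunit[OF Vc(2) nonunits_not_1] nonunits_uminus; simp)+
  hence ix: "inverse x \<in> V" "x \<noteq> 0" using nonunits_iff by auto
  hence ix': "inverse x \<notin> nonunits V" using x by (auto simp: nonunits_def)
  have "w ^ q = w * w ^ (q - 1)" using q by (cases q) auto
  hence "w ^ q * x = w ^ q - w" using w_neq_0 by (simp add: x_def field_simps)
  hence "w ^ q = t powi (- int e) * (u * inverse x)" using w(2) ix(2) by (simp add: field_simps)
  moreover have "u * inverse x \<in> V \<and> u * inverse x \<notin> nonunits V"
    using R_unit[OF u] ix ix' by (intro unit_mult) auto
  ultimately show ?thesis by blast
qed

text \<open>Taking \<open>q\<close>-th powers makes valuations integral: \<open>w\<close> is not a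
  power of \<open>t\<close> times a unit, but \<open>w ^ q\<close> is.\<close>

lemma term_power_q:
  assumes "c \<in> L" "c \<noteq> 0"
  shows "\<exists>v. v \<in> V \<and> v \<notin> nonunits V \<and>
    (c * w ^ j) ^ q = t powi (int q * order_at c - int e * int j) * v"
proof -
  obtain v where v: "v \<in> V" "v \<notin> nonunits V" "w ^ q = t powi (- int e) * v" using w_power_q by blast
  obtain y where y: "y \<in> R" "inverse y \<in> R" "y \<noteq> 0" "c = t powi (order_at c) * y"
    using order_at[OF assms] .
  have pw: "x ^ n \<in> V \<and> x ^ n \<notin> nonunits V" if "x \<in> V" "x \<notin> nonunits V" for x n
    using that by (induction n) (auto simp: Vc nonunits_not_1 unit_mult)
  have "(c * w ^ j) ^ q = c ^ q * (w ^ q) ^ j"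
    by (simp add: power_mult_distrib flip: power_mult) (simp add: mult.commute)
  also have "\<dots> = (t powi (order_at c)) ^ q * (t powi (- int e)) ^ j * (y ^ q * v ^ j)"
    unfolding v(3) by (subst y(4)) (simp add: power_mult_distrib)
  also have "(t powi (order_at c)) ^ q * (t powi (- int e)) ^ j
      = t powi (int q * order_at c - int e * int j)"
    using t_neq_0 by (simp add: power_int_power' mult.commute flip: power_int_add)
  finally show ?thesis using pw[of y q] pw[of v j] R_unit[OF y(1-3)] v unit_mult[of "y ^ q" "v ^ j"] by blast
qed

text \<open>The valuation of the \<open>j\<close>-th term of \<open>f\<close> at \<open>w\<close>,
  scaled so that \<open>t\<close> has \<open>q\<close> and \<open>w\<close> has \<open>-e\<close>.
  It does not depend on \<open>V\<close>.\<close>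

definition term_order :: "'b poly \<Rightarrow> nat \<Rightarrow> int" where
  "term_order f j = int q * order_at (Polynomial.coeff f j) - int e * int j"

text \<open>Equal orders make \<open>q\<close> divide \<open>e * (i - j)\<close>, hence
  \<open>i - j\<close>.\<close>

lemma term_order_inj:
  assumes "term_order f i = term_order f j" "i < q" "j < q"
  shows "i = j"
proof -
  have "int e * (int i - int j) = int q * (order_at (Polynomial.coeff f i) - order_at (Polynomial.coeff f j))"
    using assms(1) by (simp add: term_order_def algebra_simps)
  hence "int q dvd int e * (int i - int j)" by simp
  moreover have "coprime (int q) (int e)" using e(2) by (simp add: coprime_commute)
  ultimately have "int q dvd int i - int j" by (simp add: coprime_dvd_mult_right_iff)
  thus ?thesis using assms(2,3) zdvd_not_zless[of "int i - int j" "int q"] zdvd_not_zless[of "int j - int i" "int q"]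
    by (cases i j rule: linorder_cases) (auto simp: dvd_diff_commute)
qed

lemma term_mem_iff:
  assumes "f \<in> polys_over L" "Polynomial.coeff f j \<noteq> 0"
  shows "Polynomial.coeff f j * w ^ j \<in> V \<longleftrightarrow> term_order f j \<ge> 0"
    "Polynomial.coeff f j * w ^ j \<in> nonunits V \<longleftrightarrow> term_order f j > 0"
proof -
  have c: "Polynomial.coeff f j \<in> L" using assms(1) by (rule polys_overD)
  obtain v where v: "v \<in> V" "v \<notin> nonunits V"
    "(Polynomial.coeff f j * w ^ j) ^ q = t powi (term_order f j) * v"
    using term_power_q[OF c assms(2)] unfolding term_order_def by blast
  have "Polynomial.coeff f j * w ^ j \<in> E" using c LE w(1) subfield_type_subring[OF E] 
    by (intro subring_type_mult subring_type_power) auto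
  thus "Polynomial.coeff f j * w ^ j \<in> V \<longleftrightarrow> term_order f j \<ge> 0"
    "Polynomial.coeff f j * w ^ j \<in> nonunits V \<longleftrightarrow> term_order f j > 0"
    using power_mem_iff[of "Polynomial.coeff f j * w ^ j" q] q t_powi_unit[OF v(1,2)] v(3) by auto
qed

text \<open>As \<open>e\<close> is prime to \<open>q\<close>, the terms \<open>c\<^sub>j * w ^ j\<close> with \<open>j < q\<close> have distinct valuations.\<close>

lemma dominant_term:
  assumes f: "f \<in> polys_over L" "Polynomial.degree f < q" "f \<noteq> 0"
  obtains j v where "Polynomial.coeff f j \<noteq> 0" "v \<in> V" "v \<notin> nonunits V"
    "poly f w = v * (Polynomial.coeff f j * w ^ j)"
    "\<And>i. Polynomial.coeff f i \<noteq> 0 \<Longrightarrow> term_order f j \<le> term_order f i"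
proof -
  define J where "J = {j. Polynomial.coeff f j \<noteq> 0}"
  have J: "J \<subseteq> {..Polynomial.degree f}" by (auto simp: J_def le_degree)
  have finJ: "finite J" by (rule finite_subset[OF J]) simp
  have "J \<noteq> {}" using f(3) by (auto simp: J_def poly_eq_iff)
  then obtain j where j: "j \<in> J" "\<And>i. i \<in> J \<Longrightarrow> term_order f j \<le> term_order f i"
    using arg_min_if_finite[OF finJ, of "term_order f"] by (metis not_le)
  define T where "T = (\<lambda>i. Polynomial.coeff f i * w ^ i)"
  have T0: "T i \<noteq> 0" if "i \<in> J" for i using that w_neq_0 by (auto simp: T_def J_def)
  have TE: "T i \<in> E" for i unfolding T_def
    using polys_overD[OF f(1)] LE w(1) subfield_type_subring[OF E]
    by (intro subring_type_mult subring_type_power) auto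
  have small: "T i / T j \<in> nonunits V" if i: "i \<in> J - {j}" for i
  proof -
    have "Polynomial.coeff f i \<in> L" "Polynomial.coeff f i \<noteq> 0" "Polynomial.coeff f j \<in> L" "Polynomial.coeff f j \<noteq> 0"
      using polys_overD[OF f(1)] i j by (auto simp: J_def)
    then obtain v1 v2 where v: "v1 \<in> V" "v1 \<notin> nonunits V" "T i ^ q = t powi (term_order f i) * v1"
       "v2 \<in> V" "v2 \<notin> nonunits V" "T j ^ q = t powi (term_order f j) * v2"
      using term_power_q unfolding T_def term_order_def by metis
    have "(T i / T j) ^ q = t powi (term_order f i - term_order f j) * (v1 * inverse v2)"
      using t_neq_0 v by (simp add: power_divide power_int_diff field_simps)
    moreover have "v1 * inverse v2 \<in> V \<and> v1 * inverse v2 \<notin> nonunits V"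
      using v(1,2,4,5) by (auto simp: nonunits_def Vc)
    moreover have "term_order f i > term_order f j"
    proof -
      have "i < q" "j < q" using i j J f(2) by auto
      hence "term_order f i \<noteq> term_order f j" using term_order_inj i by blast
      thus ?thesis using j(2)[of i] i by simp
    qed
    ultimately have "(T i / T j) ^ q \<in> nonunits V" using t_powi_unit(2) by simp
    thus ?thesis using power_mem_iff(2)[of "T i / T j" q] q TE subfield_type_divide[OF E] by auto
  qed
  define v where "v = 1 + (\<Sum>i\<in>J - {j}. T i / T j)"
  have v: "v \<in> V" "v \<notin> nonunits V"
    unfolding v_def by (intro unit_plus_nonunit nonunits_sum small Vc nonunits_not_1; simp)+
  have "poly f w = (\<Sum>i\<le>Polynomial.degree f. T i)" by (simp add: poly_altdef T_def)
  also have "\<dots> = (\<Sum>i\<in>J. T i)" by (rule sum.mono_neutral_right) (use J in \<open>auto simp: T_def J_def\<close>)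
  also have "\<dots> = T j + (\<Sum>i\<in>J - {j}. T i)" using finJ j(1) by (simp add: sum.remove)
  also have "\<dots> = v * T j" using T0[OF j(1)] by (simp add: v_def algebra_simps flip: sum_divide_distrib)
  finally show thesis using v j by (intro that[of j v]) (auto simp: J_def T_def)
qed

text \<open>A unit times a nonzero term cannot vanish. Together with \<open>reduce_degree\<close>
  this says that the extension has degree \<open>q\<close>; the unramified places import it from
  here.\<close>

lemma independent:
  assumes "f \<in> polys_over L" "Polynomial.degree f < q" "poly f w = 0"
  shows "f = 0"
proof (rule ccontr)
  assume "f \<noteq> 0"
  then obtain j v where "Polynomial.coeff f j \<noteq> 0" "v \<in> V" "v \<notin> nonunits V"
    "poly f w = v * (Polynomial.coeff f j * w ^ j)"
    using dominant_term[OF assms(1,2)] by metis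
  thus False using assms(3) w_neq_0 nonunits_0 by auto
qed

text \<open>The right-hand side does not involve \<open>V\<close>, which yields uniqueness of the
  valuation ring above \<open>R\<close>.\<close>

lemma mem_V_iff:
  assumes f: "f \<in> polys_over L" "Polynomial.degree f < q"
  shows "poly f w \<in> V \<longleftrightarrow> (\<forall>j. Polynomial.coeff f j \<noteq> 0 \<longrightarrow> term_order f j \<ge> 0)"
proof (cases "f = 0")
  case False
  then obtain j v where j: "Polynomial.coeff f j \<noteq> 0" "v \<in> V" "v \<notin> nonunits V"
    "poly f w = v * (Polynomial.coeff f j * w ^ j)"
    "\<And>i. Polynomial.coeff f i \<noteq> 0 \<Longrightarrow> term_order f j \<le> term_order f i"
    using dominant_term[OF f] by metis
  have "poly f w \<in> V \<longleftrightarrow> term_order f j \<ge> 0"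
    unfolding j(4) using unit_mult_iff(1)[OF j(2,3)] term_mem_iff(1)[OF f(1) j(1)] by simp
  thus ?thesis using j(1,5) by (meson order.trans)
qed (simp add: Vc)

lemma rational:
  assumes gen: "\<And>z. z \<in> E \<Longrightarrow> \<exists>f\<in>polys_over L. Polynomial.degree f < q \<and> z = poly f w"
  shows "rational_valuation K V"
  unfolding rational_valuation_def
proof
  fix z assume z: "z \<in> V"
  then obtain f where f: "f \<in> polys_over L" "Polynomial.degree f < q" "z = poly f w"
    using gen VE by blast
  have ge: "term_order f j \<ge> 0" if "Polynomial.coeff f j \<noteq> 0" for j
    using mem_V_iff[OF f(1,2)] z f(3) that by simp
  have small: "Polynomial.coeff f j * w ^ j \<in> nonunits V" if j: "j \<in> {1..Polynomial.degree f}" for j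
  proof (cases "Polynomial.coeff f j = 0")
    case False
    \<comment> \<open>Order zero would make \<open>q\<close> divide \<open>e * j\<close>, hence
      \<open>j\<close>, but \<open>0 < j < q\<close>. So only the constant coefficient contributes
      to the residue.\<close>
    have "term_order f j \<noteq> 0"
    proof
      assume "term_order f j = 0"
      hence "int e * int j = int q * order_at (Polynomial.coeff f j)" by (simp add: term_order_def)
      hence "int q dvd int e * int j" by simp
      hence "q dvd e * j" by (simp flip: of_nat_mult)
      hence "q dvd j" using e(2) by (simp add: coprime_commute coprime_dvd_mult_right_iff)
      thus False using j f(2) by (auto dest: dvd_imp_le)
    qed
    thus ?thesis using term_mem_iff(2)[OF f(1) False] ge[OF False] by simp
  qed (simp add: nonunits_0)
  have c0: "Polynomial.coeff f 0 \<in> R"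
  proof (cases "Polynomial.coeff f 0 = 0")
    case False
    hence "Polynomial.coeff f 0 * w ^ 0 \<in> V" using term_mem_iff(1)[OF f(1) False] ge[OF False] by blast
    thus ?thesis using L_V_R[OF polys_overD[OF f(1)]] by simp
  qed (simp add: Rc)
  obtain c y where cy: "c \<in> K" "y \<in> R" "Polynomial.coeff f 0 = c + t * y" using residue[OF c0] by blast
  have "z = (\<Sum>i\<le>Polynomial.degree f. Polynomial.coeff f i * w ^ i)" using f(3) by (simp add: poly_altdef)
  also have "{..Polynomial.degree f} = insert 0 {1..Polynomial.degree f}" by auto
  finally have "z - c = t * y + (\<Sum>i\<in>{1..Polynomial.degree f}. Polynomial.coeff f i * w ^ i)"
    by (simp add: cy(3))
  also have "\<dots> \<in> nonunits V"
    using cy(2) RV by (intro nonunits_add nonunits_sum small nonunits_mult t_nonunit) auto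
  finally show "\<exists>c\<in>K. z - c \<in> nonunits V" using cy(1) by blast
qed

end

text \<open>Multiplication by \<open>w\<close>, followed by replacing \<open>w ^ q\<close> with
  \<open>w + h\<close>. Coefficient 0 is recorded because \<open>inverse_s_notin\<close> compares it
  with 1.\<close>

lemma reduce_step:
  fixes A :: "'b::field set"
  assumes A: "subring_type A" and w: "w ^ q - w = h" "h \<in> A" and q: "q \<ge> 2"
    and g: "g \<in> polys_over A" "Polynomial.degree g < q" and a: "a \<in> A"
  obtains g' where "g' \<in> polys_over A" "Polynomial.degree g' < q" "poly g' w = a + w * poly g w"
    "Polynomial.coeff g' 0 = a + Polynomial.coeff g (q - 1) * h"
proof -
  define c where "c = Polynomial.coeff g (q - 1)"
  define g' where "g' = pCons a g - smult c (Polynomial.monom 1 q - [:h, 1:])"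
  note Ac = subring_type_closed[OF A]
  have c: "c \<in> A" using g by (simp add: c_def polys_overD)
  have "g' \<in> polys_over A" unfolding g'_def using c g a w(2)
    by (intro polys_over_diff[OF A] polys_over_smult[OF A] polys_over_monom[OF A])
      (auto simp: polys_over_pCons_iff[OF A] polys_over_0[OF A] Ac)
  moreover have "Polynomial.coeff g' i = 0" if "i \<ge> q" for i
  proof (cases "i = q")
    case True
    thus ?thesis using q by (auto simp: g'_def c_def coeff_pCons split: nat.splits)
  next
    case False
    hence "Polynomial.coeff g (i - 1) = 0" using that g(2) by (intro coeff_eq_0) auto
    thus ?thesis using q that False by (auto simp: g'_def coeff_pCons split: nat.splits)
  qed
  hence "Polynomial.degree g' < q" using q by (intro degree_lessI) auto
  moreover have "poly g' w = a + w * poly g w"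
    using w(1) by (simp add: g'_def poly_monom algebra_simps)
  moreover have "Polynomial.coeff g' 0 = a + c * h" using q by (simp add: g'_def)
  ultimately show thesis using that c_def by blast
qed

lemma reduce_degree:
  fixes A :: "'b::field set"
  assumes A: "subring_type A" and w: "w ^ q - w = h" "h \<in> A" and q: "q \<ge> 2"
    and f: "f \<in> polys_over A"
  shows "\<exists>g\<in>polys_over A. Polynomial.degree g < q \<and> poly g w = poly f w"
  using f
proof (induction f)
  case 0
  thus ?case using q by (intro bexI[of _ 0]) auto
next
  case (pCons a f)
  then obtain g where g: "g \<in> polys_over A" "Polynomial.degree g < q" "poly g w = poly f w"
    and a: "a \<in> A" by (auto simp: polys_over_pCons_iff[OF A])
  obtain g' where "g' \<in> polys_over A" "Polynomial.degree g' < q" "poly g' w = a + w * poly g w"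
    using reduce_step[OF A w q g(1,2) a] .
  thus ?case using g(3) by (intro bexI[of _ g']) auto
qed

lemma artin_schreier_poly_neq_0: "q \<ge> 2 \<Longrightarrow> Polynomial.monom 1 q - [:h, 1:] \<noteq> (0 :: 'b::field poly)"
proof
  assume q: "q \<ge> 2" and "Polynomial.monom 1 q - [:h, 1:] = (0 :: 'b poly)"
  hence "Polynomial.coeff (Polynomial.monom 1 q - [:h, 1:]) q = (0 :: 'b)" by simp
  moreover have "Polynomial.coeff [:h, 1:] q = 0" using q by (intro coeff_eq_0) auto
  ultimately show False by simp
qed

lemma artin_schreier_adjoin_subfield:
  assumes L: "subfield_type L" and w: "w ^ q - w = h" "h \<in> L" and q: "q \<ge> 2"
  shows "subfield_type (adjoin L (w :: 'b::field))"
proof -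
  note Ls = subfield_type_subring[OF L]
  show ?thesis
  proof (rule adjoin_algebraic_subfield[OF L])
    show "Polynomial.monom 1 q - [:h, 1:] \<in> polys_over L"
      using w(2) by (intro polys_over_diff[OF Ls] polys_over_monom[OF Ls])
        (auto simp: polys_over_pCons_iff[OF Ls] polys_over_0[OF Ls] subring_type_closed[OF Ls])
    show "poly (Polynomial.monom 1 q - [:h, 1:]) w = 0"
      using w(1) by (simp add: poly_monom algebra_simps)
  qed (rule artin_schreier_poly_neq_0[OF q])
qed

definition valuations_above :: "'b::field set \<Rightarrow> 'b set \<Rightarrow> 'b \<Rightarrow> 'b set \<Rightarrow> 'b set set" where
  "valuations_above K R t E =
     {V. valuation_ring V E \<and> R \<subseteq> V \<and> inverse t \<notin> V \<and> rational_valuation K V}"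

context dvr
begin

lemma dvr_extI:
  assumes "valuation_ring V E" "L \<subseteq> E" "R \<subseteq> V" "inverse t \<notin> V"
  shows "dvr_ext R L K t V E"
  using assms dvr_axioms by (simp add: dvr_ext_def dvr_ext_axioms_def)

text \<open>Zorn's lemma gives a ring above \<open>R\<close>, and any two agree because
  \<open>mem_V_iff\<close> is the same criterion for both. The second conclusion no longer refers to
  a place above, so it can be used at every other place.\<close>

lemma ramified:
  assumes w: "w ^ q - w = t powi (- int e) * u" and q: "q \<ge> 2" and e: "e > 0" "coprime e q"
    and u: "u \<in> R" "inverse u \<in> R" "u \<noteq> 0"
  shows "\<exists>V. valuations_above K R t (adjoin L w) = {V}"
    and "f \<in> polys_over L \<Longrightarrow> Polynomial.degree f < q \<Longrightarrow> poly f w = 0 \<Longrightarrow> f = 0"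
proof -
  define E where "E = adjoin L w"
  note Ls = subfield_type_subring[OF L]
  have h: "t powi (- int e) * u \<in> L"
    using RL t(1) u by (intro subring_type_mult[OF Ls] subfield_type_powi[OF L]) auto
  have E: "subfield_type E" unfolding E_def by (rule artin_schreier_adjoin_subfield[OF L w h q])
  have LE: "L \<subseteq> E" and wE: "w \<in> E"
    using adjoin_base[OF Ls] adjoin_self[OF Ls] by (auto simp: E_def)
  have gen: "\<exists>f\<in>polys_over L. Polynomial.degree f < q \<and> z = poly f w" if "z \<in> E" for z
    using reduce_degree[OF Ls w h q] that unfolding E_def adjoin_def by fastforce
  have loc: "artin_schreier_ram R L K t V E w u q e" if "valuation_ring V E" "R \<subseteq> V" "inverse t \<notin> V" for V
    unfolding artin_schreier_ram_def artin_schreier_ram_axioms_def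
    using dvr_extI[OF that(1) LE that(2,3)] wE w q e u by blast
  obtain V where V: "valuation_ring V E" "R \<subseteq> V" "inverse t \<notin> V"
    using ex_valuation_ring[OF R _ E t] RL LE by blast
  interpret V: artin_schreier_ram R L K t V E w u q e using loc[OF V] .
  show "f \<in> polys_over L \<Longrightarrow> Polynomial.degree f < q \<Longrightarrow> poly f w = 0 \<Longrightarrow> f = 0"
    using V.independent .
  have "W = V" if W: "valuation_ring W E" "R \<subseteq> W" "inverse t \<notin> W" for W
  proof -
    interpret W: artin_schreier_ram R L K t W E w u q e using loc[OF W] .
    have "z \<in> W \<longleftrightarrow> z \<in> V" if z: "z \<in> E" for z
      using gen[OF z] V.mem_V_iff W.mem_V_iff by blast
    thus ?thesis using V.VE W.VE by blast
  qed
  thus "\<exists>V. valuations_above K R t (adjoin L w) = {V}"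
    using V V.rational[OF gen] unfolding valuations_above_def E_def[symmetric] by blast
qed

lemma R_factor:
  assumes "z \<in> R" "z \<noteq> 0"
  shows "\<exists>n. \<exists>u\<in>R. inverse u \<in> R \<and> u \<noteq> 0 \<and> z = t ^ n * u"
proof -
  obtain k u where ku: "u \<in> R" "inverse u \<in> R" "u \<noteq> 0" "z = t powi k * u"
    using factor[of z] assms RL by blast
  have "k \<ge> 0"
  proof (rule ccontr)
    assume k: "\<not> k \<ge> 0"
    define n where "n = nat (- k)"
    have n: "n > 0" "k = - int n" using k by (auto simp: n_def)
    have "t * (t ^ (n - 1) * z * inverse u) = t ^ n * z * inverse u"
      using n(1) by (cases n) (auto simp: mult_ac)
    also have "\<dots> = 1" using ku(3) t_neq_0 unfolding ku(4) n(2) by (simp add: power_int_minus field_simps)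
    finally have "inverse t = t ^ (n - 1) * z * inverse u" by (rule inverse_unique)
    thus False using t assms(1) ku(2) by (simp add: Rc)
  qed
  hence "z = t ^ nat k * u" using ku(4) by (simp add: power_int_def)
  thus ?thesis using ku by blast
qed

lemma clear_denominator: "z \<in> L \<Longrightarrow> \<exists>n. t ^ n * z \<in> R"
proof (cases "z = 0")
  case False
  assume "z \<in> L"
  then obtain k u where ku: "u \<in> R" "z = t powi k * u" using factor[of z] False by blast
  show ?thesis
  proof (cases "k \<ge> 0")
    case True
    hence "z = t ^ nat k * u" using ku(2) by (simp add: power_int_def)
    hence "t ^ 0 * z \<in> R" using ku(1) t(1) by (simp add: Rc)
    thus ?thesis by blast
  next
    case False
    hence "t ^ nat (- k) * z = u" using t_neq_0 ku(2) by (simp add: power_int_def power_inverse)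
    thus ?thesis using ku(1) by metis
  qed
qed (auto simp: Rc)

end

section \<open>The unramified case\<close>

text \<open>\<open>s\<close> stands for \<open>w - \<beta>\<close> with a solution
  \<open>\<beta>\<close> of the equation modulo \<open>t\<close>, which makes
  \<open>s ^ q - s\<close> divisible by \<open>t\<close>. Independence is assumed here and supplied
  by a totally ramified place elsewhere.\<close>

locale artin_schreier_unram = dvr R L K t for R L K :: "'b::field set" and t +
  fixes s y\<^sub>0 :: 'b and q :: nat
  assumes s: "s ^ q - s = t * y\<^sub>0" and y0: "y\<^sub>0 \<in> R" and q: "q \<ge> 2"
    and indep: "f \<in> polys_over L \<Longrightarrow> Polynomial.degree f < q \<Longrightarrow> poly f s = 0 \<Longrightarrow> f = 0"
begin

lemma h_in_R: "t * y\<^sub>0 \<in> R"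
  using t y0 by (simp add: Rc)

lemma h_in_L: "t * y\<^sub>0 \<in> L"
  using h_in_R RL by blast

lemma E: "subfield_type (adjoin L s)"
  by (rule artin_schreier_adjoin_subfield[OF L s h_in_L q])

lemmas Ls = subfield_type_subring[OF L]
lemmas adjoin_R_subring = adjoin_subring[OF R, of s]
lemmas adj_closed = subring_type_closed[OF adjoin_R_subring]
lemmas R_adj = adjoin_base[OF R, of _ s]
lemmas s_adj = adjoin_self[OF R, of s]

lemma adjoin_R_L: "adjoin R s \<subseteq> adjoin L s"
  unfolding adjoin_def using polys_over_mono[OF RL] by blast

lemma s_neq_0: "s \<noteq> 0"
proof
  assume "s = 0"
  hence "poly [:0, 1:] s = 0" by simp
  hence "[:0, 1 :: 'b:] = 0"
    using q by (intro indep) (auto simp: polys_over_pCons_iff[OF Ls] polys_over_0[OF Ls] subring_type_closed[OF Ls])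
  thus False by simp
qed

text \<open>If \<open>s * g(s) = 1\<close> with \<open>g\<close> of degree below \<open>q\<close>,
  then the reduced product has a multiple of \<open>t\<close> as constant coefficient, while
  independence forces it to be 1. So \<open>t\<close> would be invertible in
  \<open>R\<close>.\<close>

lemma inverse_s_notin: "inverse s \<notin> adjoin R s"
proof
  assume "inverse s \<in> adjoin R s"
  then obtain f where f: "f \<in> polys_over R" "poly f s = inverse s" by (auto simp: adjoin_def)
  obtain g where g: "g \<in> polys_over R" "Polynomial.degree g < q" "poly g s = inverse s"
    using reduce_degree[OF R s h_in_R q f(1)] f(2) by auto
  obtain g' where g': "g' \<in> polys_over R" "Polynomial.degree g' < q" "poly g' s = 0 + s * poly g s"
    "Polynomial.coeff g' 0 = 0 + Polynomial.coeff g (q - 1) * (t * y\<^sub>0)"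
    using reduce_step[OF R s h_in_R q g(1,2) Rc(1)] .
  have "g' - 1 = 0"
  proof (rule indep)
    show "g' - 1 \<in> polys_over L" using g'(1) polys_over_mono[OF RL]
      by (intro polys_over_diff[OF Ls] polys_over_1[OF Ls]) auto
    show "Polynomial.degree (g' - 1) < q" by (rule degree_diff_less) (use g' q in auto)
    show "poly (g' - 1) s = 0" using g'(3) g(3) s_neq_0 by simp
  qed
  hence "Polynomial.coeff g' 0 = 1" by simp
  hence "t * (Polynomial.coeff g (q - 1) * y\<^sub>0) = 1" using g'(4) by (simp add: mult_ac)
  hence "inverse t = Polynomial.coeff g (q - 1) * y\<^sub>0" by (rule inverse_unique)
  thus False using t(2) y0 polys_overD[OF g(1)] by (simp add: Rc)
qed

text \<open>Zorn's lemma is applied to \<open>s\<close> instead of \<open>t\<close>: this selects,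
  among the rings above \<open>R\<close>, one where \<open>w\<close> has the prescribed
  residue.\<close>

lemma ex_above: "\<exists>V. dvr_ext R L K t V (adjoin L s) \<and> s \<in> nonunits V"
proof -
  obtain V where V: "valuation_ring V (adjoin L s)" "adjoin R s \<subseteq> V" "inverse s \<notin> V"
    using ex_valuation_ring[OF adjoin_R_subring adjoin_R_L E s_adj inverse_s_notin] .
  interpret V: valuation_ring V "adjoin L s" by (rule V(1))
  have sV: "s \<in> nonunits V" using V s_adj by (auto simp: nonunits_def)
  have "s ^ q = s * s ^ (q - 1)" using q by (cases q) auto
  hence "s ^ q - s \<in> nonunits V" using sV V.Vc(7)[OF V.nonunits_sub[OF sV]]
    by (intro V.nonunits_diff) (auto intro: V.nonunits_mult)
  hence h: "t * y\<^sub>0 \<in> nonunits V" using s by simp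
  \<comment> \<open>Otherwise \<open>s ^ (q - 1) = 1\<close>, and \<open>s ^ (q - 2)\<close> would
    invert \<open>s\<close> in \<open>R[s]\<close>.\<close>
  have h0: "t * y\<^sub>0 \<noteq> 0"
  proof
    assume "t * y\<^sub>0 = 0"
    hence "s ^ q = s" using s by (metis eq_iff_diff_eq_0)
    moreover have "s ^ q = s * (s * s ^ (q - 2))" using q by (simp flip: power_Suc add: Suc_diff_Suc numeral_2_eq_2)
    ultimately have "s * s ^ (q - 2) = 1" using s_neq_0 by simp
    hence "inverse s = s ^ (q - 2)" by (rule inverse_unique)
    thus False using inverse_s_notin adj_closed(7)[OF s_adj] by simp
  qed
  have "inverse t \<notin> V"
  proof
    assume it: "inverse t \<in> V"
    \<comment> \<open>\<open>t * y\<^sub>0\<close> is a power of \<open>t\<close> times a unit of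
      \<open>R\<close>; with \<open>1/t\<close> in \<open>V\<close> it would be invertible there,
      although it is a nonunit.\<close>
    obtain n u where nu: "u \<in> R" "inverse u \<in> R" "u \<noteq> 0" "t * y\<^sub>0 = t ^ n * u"
      using R_factor[OF h_in_R h0] by blast
    have "inverse u * inverse t ^ n \<in> V" using nu V(2) R_adj it by (intro V.Vc(5) V.Vc(7)) auto
    moreover have "inverse (t * y\<^sub>0) = inverse u * inverse t ^ n"
      unfolding nu(4) by (simp add: power_inverse)
    ultimately show False using h h0 by (simp add: nonunits_def)
  qed
  moreover have "R \<subseteq> V" "L \<subseteq> adjoin L s" using V(2) R_adj adjoin_base[OF Ls] by auto
  ultimately show ?thesis using dvr_extI[OF V(1)] sV by blast
qed

text \<open>The elements of \<open>R[s]\<close> with a nonzero constant residue modulo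
  \<open>(t, s)\<close>. They are units in each valuation ring above \<open>R\<close> in which
  \<open>s\<close> is a nonunit, but the set is described without such a ring.\<close>

definition units_at :: "'b set" where
  "units_at = {a. \<exists>c\<in>K. \<exists>x\<in>adjoin R s. \<exists>y\<in>adjoin R s. c \<noteq> 0 \<and> a = c + t * x + s * y}"

lemma adjoin_R_cases:
  assumes "a \<in> adjoin R s"
  shows "\<exists>c\<in>K. \<exists>x\<in>adjoin R s. \<exists>y\<in>adjoin R s. a = c + t * x + s * y"
proof -
  obtain f where f: "f \<in> polys_over R" "a = poly f s" using assms by (auto simp: adjoin_def)
  obtain a0 g where g: "f = pCons a0 g" by (cases f)
  obtain c x where "c \<in> K" "x \<in> R" "a0 = c + t * x"
    using f(1) residue[of a0] by (auto simp: g polys_over_pCons_iff[OF R])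
  thus ?thesis using f g R_adj adjoinI[OF R, of g "poly g s" s]
    by (intro bexI[of _ c] bexI[of _ x] bexI[of _ "poly g s"]) (auto simp: polys_over_pCons_iff[OF R])
qed

lemma units_at_mult:
  assumes "a \<in> units_at" "b \<in> units_at"
  shows "a * b \<in> units_at"
proof -
  obtain c x y where 1: "c \<in> K" "x \<in> adjoin R s" "y \<in> adjoin R s" "c \<noteq> 0" "a = c + t * x + s * y"
    using assms(1) unfolding units_at_def by blast
  obtain c' x' y' where 2: "c' \<in> K" "x' \<in> adjoin R s" "y' \<in> adjoin R s" "c' \<noteq> 0" "b = c' + t * x' + s * y'"
    using assms(2) unfolding units_at_def by blast
  have K': "c \<in> adjoin R s" "c' \<in> adjoin R s" "t \<in> adjoin R s" using 1 2 KR t R_adj by auto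
  have "a * b = c * c' + t * (x * (c' + t * x' + s * y') + c * x') + s * (y * (c' + t * x' + s * y') + c * y')"
    unfolding 1(5) 2(5) by (simp add: algebra_simps)
  moreover have "x * (c' + t * x' + s * y') + c * x' \<in> adjoin R s"
    by (intro adj_closed(4,5) 1 2 K' s_adj)
  moreover have "y * (c' + t * x' + s * y') + c * y' \<in> adjoin R s"
    by (intro adj_closed(4,5) 1 2 K' s_adj)
  moreover have "c * c' \<in> K" "c * c' \<noteq> 0"
    using 1(1,4) 2(1,4) subring_type_mult[OF subfield_type_subring[OF K]] by auto
  ultimately show ?thesis unfolding units_at_def by blast
qed

lemma units_at_1: "1 \<in> units_at"
  unfolding units_at_def using adj_closed(1) subring_type_1[OF subfield_type_subring[OF K]]
  by (intro CollectI bexI[of _ 1] bexI[of _ 0]) auto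

lemma units_at_power: "a \<in> units_at \<Longrightarrow> a ^ n \<in> units_at"
  by (induction n) (auto intro: units_at_1 units_at_mult)

text \<open>The factor of \<open>s ^ q - s\<close> complementary to \<open>s\<close>; it is -1
  modulo \<open>s\<close> because \<open>q \<ge> 2\<close>.\<close>

definition cofactor :: 'b where
  "cofactor = s ^ (q - 1) - 1"

lemma s_cofactor: "s * cofactor = t * y\<^sub>0"
  unfolding cofactor_def using s q by (cases q) (auto simp: algebra_simps)

lemma cofactor_unit: "cofactor \<in> units_at"
proof -
  have "cofactor = - 1 + t * 0 + s * s ^ (q - 2)"
    using q by (simp add: cofactor_def flip: power_Suc add: Suc_diff_Suc numeral_2_eq_2)
  thus ?thesis unfolding units_at_def
    using adj_closed(1) adj_closed(7)[OF s_adj] subring_type_1[OF subfield_type_subring[OF K]]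
      subring_type_uminus[OF subfield_type_subring[OF K]]
    by (intro CollectI bexI[of _ "-1"] bexI[of _ 0] bexI[of _ "s ^ (q - 2)"]) auto
qed

lemma units_at_subset: "units_at \<subseteq> adjoin R s"
  unfolding units_at_def using KR t R_adj s_adj by (auto intro!: adj_closed(4,5))

text \<open>
  The maximal ideal is generated by \<open>t\<close> and \<open>s\<close>, and up to the unit \<open>cofactor\<close> the element \<open>s\<close> is a
  multiple of \<open>t\<close>. Hence every nonunit is divisible by \<open>t\<close> once it is multiplied by \<open>cofactor\<close>.
\<close>

lemma extract_t:
  assumes "z \<in> adjoin R s"
  shows "(\<exists>i. \<exists>a\<in>units_at. z * cofactor ^ i = t ^ i * a) \<or> (\<exists>x\<in>adjoin R s. z * cofactor ^ k = t ^ k * x)"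
proof (induction k)
  case 0
  show ?case using assms by (intro disjI2 bexI[of _ z]) auto
next
  case (Suc k)
  then show ?case
  proof
    assume "\<exists>x\<in>adjoin R s. z * cofactor ^ k = t ^ k * x"
    then obtain x where x: "x \<in> adjoin R s" "z * cofactor ^ k = t ^ k * x" by blast
    obtain c a b where cab: "c \<in> K" "a \<in> adjoin R s" "b \<in> adjoin R s" "x = c + t * a + s * b"
      using adjoin_R_cases[OF x(1)] by blast
    show ?thesis
    proof (cases "c = 0")
      case False
      hence "x \<in> units_at" using cab unfolding units_at_def by blast
      thus ?thesis using x(2) by blast
    next
      case True
      have "z * cofactor ^ Suc k = t ^ k * (x * cofactor)" using x(2) by (simp add: mult_ac)
      also have "x * cofactor = t * (cofactor * a + y\<^sub>0 * b)"
        using s_cofactor True cab(4) by (simp add: algebra_simps)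
      finally have "z * cofactor ^ Suc k = t ^ Suc k * (cofactor * a + y\<^sub>0 * b)" by simp
      moreover have "cofactor * a + y\<^sub>0 * b \<in> adjoin R s"
        using cab cofactor_unit units_at_subset y0 R_adj by (intro adj_closed(4,5)) auto
      ultimately show ?thesis by blast
    qed
  qed blast
qed

lemma clear_denominators: "z \<in> adjoin L s \<Longrightarrow> \<exists>n. t ^ n * z \<in> adjoin R s"
proof -
  assume "z \<in> adjoin L s"
  then obtain f where f: "f \<in> polys_over L" "z = poly f s" by (auto simp: adjoin_def)
  have "\<exists>n. t ^ n * poly f s \<in> adjoin R s" using f(1)
  proof (induction f)
    case 0
    thus ?case by (auto simp: adj_closed)
  next
    case (pCons a f)
    then obtain n m where nm: "t ^ n * poly f s \<in> adjoin R s" "t ^ m * a \<in> R"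
      using clear_denominator[of a] by (auto simp: polys_over_pCons_iff[OF Ls])
    have "t ^ (m + n) * poly (pCons a f) s = t ^ n * (t ^ m * a) + t ^ m * (s * (t ^ n * poly f s))"
      by (simp add: algebra_simps power_add)
    also have "\<dots> \<in> adjoin R s"
      by (intro adj_closed(4,5) nm(1) s_adj R_adj[OF nm(2)] adj_closed(7)[OF R_adj[OF t(1)]])
    finally show ?case by blast
  qed
  thus ?thesis using f(2) by simp
qed

lemma above_unit:
  assumes V: "dvr_ext R L K t V (adjoin L s)" "s \<in> nonunits V"
  shows "adjoin R s \<subseteq> V"
    and "x \<in> adjoin R s \<Longrightarrow> y \<in> adjoin R s \<Longrightarrow> t * x + s * y \<in> nonunits V"
    and "a \<in> units_at \<Longrightarrow> a \<in> V \<and> a \<notin> nonunits V"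
proof -
  interpret V: dvr_ext R L K t V "adjoin L s" by (rule V(1))
  show sub: "adjoin R s \<subseteq> V" using V.RV V.nonunits_sub[OF V(2)] V.V by (intro adjoin_least)
  show *: "x \<in> adjoin R s \<Longrightarrow> y \<in> adjoin R s \<Longrightarrow> t * x + s * y \<in> nonunits V" for x y
    using sub V.t_nonunit V(2) by (intro V.nonunits_add V.nonunits_mult) auto
  show "a \<in> units_at \<Longrightarrow> a \<in> V \<and> a \<notin> nonunits V"
  proof -
    assume "a \<in> units_at"
    then obtain c x y where c: "c \<in> K" "c \<noteq> 0" "x \<in> adjoin R s" "y \<in> adjoin R s" "a = c + (t * x + s * y)"
      unfolding units_at_def by (auto simp: add.assoc)
    have "c \<in> V" "c \<notin> nonunits V" using V.const_nonunit c KR V.RV by auto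
    thus ?thesis unfolding c(5) using V.unit_plus_nonunit *[OF c(3,4)] by blast
  qed
qed

text \<open>\<open>R[s]\<close> localised at \<open>(t, s)\<close> is discrete with uniformizer
  \<open>t\<close>. The representation mentions no valuation ring, so it decides membership in all
  of them alike.\<close>

lemma unit_representation:
  assumes z: "z \<in> adjoin L s" "z \<noteq> 0"
  shows "\<exists>k::int. \<exists>a\<in>units_at. \<exists>b\<in>units_at. b * z = t powi k * a"
proof -
  obtain V where V: "dvr_ext R L K t V (adjoin L s)" "s \<in> nonunits V" using ex_above by blast
  interpret V: dvr_ext R L K t V "adjoin L s" by (rule V(1))
  obtain n where n: "t ^ n * z \<in> adjoin R s" using clear_denominators[OF z(1)] by blast
  define z' where "z' = t ^ n * z"
  have z': "z' \<in> adjoin L s" "z' \<noteq> 0" using n adjoin_R_L z(2) t_neq_0 by (auto simp: z'_def)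
  obtain m where m: "t ^ m * inverse z' \<in> adjoin R s"
    using clear_denominators[OF subfield_type_inverse[OF E z'(1)]] by blast
  \<comment> \<open>Termination bound: \<open>t ^ m / z'\<close> lies in \<open>R[s]\<close>, so
    extracting \<open>t\<close> from \<open>z'\<close> more than \<open>m\<close> times would make a
    power of \<open>cofactor\<close> divisible by \<open>t\<close> in \<open>V\<close>.\<close>
  have "\<not> (\<exists>x\<in>adjoin R s. z' * cofactor ^ Suc m = t ^ Suc m * x)"
  proof
    assume "\<exists>x\<in>adjoin R s. z' * cofactor ^ Suc m = t ^ Suc m * x"
    then obtain x where x: "x \<in> adjoin R s" "z' * cofactor ^ Suc m = t ^ Suc m * x" by blast
    have "cofactor ^ Suc m = t * (t ^ m * inverse z' * x)"
      using x(2) z'(2) by (simp add: field_simps)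
    also have "\<dots> \<in> nonunits V"
      using adj_closed(5)[OF m x(1)] above_unit(1)[OF V] by (intro V.nonunits_mult V.t_nonunit) auto
    finally show False using above_unit(3)[OF V units_at_power[OF cofactor_unit]] by blast
  qed
  then obtain i a where ia: "a \<in> units_at" "z' * cofactor ^ i = t ^ i * a"
    using extract_t[of z' "Suc m"] n by (auto simp: z'_def)
  have "cofactor ^ i * z = t powi (int i - int n) * a"
    using ia(2) t_neq_0 by (simp add: z'_def power_int_diff field_simps)
  thus ?thesis using ia(1) units_at_power[OF cofactor_unit] by blast
qed

lemma unique_above:
  assumes V: "dvr_ext R L K t V (adjoin L s)" "s \<in> nonunits V"
    and W: "dvr_ext R L K t W (adjoin L s)" "s \<in> nonunits W"
  shows "V = W"
proof -
  interpret V: dvr_ext R L K t V "adjoin L s" by (rule V(1))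
  interpret W: dvr_ext R L K t W "adjoin L s" by (rule W(1))
  have "z \<in> V \<longleftrightarrow> z \<in> W" if z: "z \<in> adjoin L s" "z \<noteq> 0" for z
  proof -
    obtain k a b where ab: "a \<in> units_at" "b \<in> units_at" "b * z = t powi k * a"
      using unit_representation[OF z] by blast
    have "z \<in> V \<longleftrightarrow> k \<ge> 0"
      using V.unit_mult_iff(1)[of b z] V.t_powi_unit(1)[of a k] above_unit(3)[OF V] ab by auto
    moreover have "z \<in> W \<longleftrightarrow> k \<ge> 0"
      using W.unit_mult_iff(1)[of b z] W.t_powi_unit(1)[of a k] above_unit(3)[OF W] ab by auto
    ultimately show ?thesis by simp
  qed
  thus ?thesis using V.VE W.VE V.Vc(1) W.Vc(1) by blast
qed

lemma rational_above:
  assumes V: "dvr_ext R L K t V (adjoin L s)" "s \<in> nonunits V"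
  shows "rational_valuation K V"
  unfolding rational_valuation_def
proof
  interpret V: dvr_ext R L K t V "adjoin L s" by (rule V(1))
  note Ks = subfield_type_subring[OF K]
  fix z assume zV: "z \<in> V"
  show "\<exists>c\<in>K. z - c \<in> nonunits V"
  proof (cases "z \<in> nonunits V")
    case True
    thus ?thesis using subring_type_0[OF Ks] by (intro bexI[of _ 0]) auto
  next
    case False
    hence z: "z \<in> adjoin L s" "z \<noteq> 0" using zV V.VE V.nonunits_0 by auto
    obtain k a b where ab: "a \<in> units_at" "b \<in> units_at" "b * z = t powi k * a"
      using unit_representation[OF z] by blast
    have "k \<ge> 0" "\<not> k > 0"
      using V.unit_mult_iff[of b z] V.t_powi_unit[of a k] above_unit(3)[OF V] ab zV False by auto
    hence bz: "b * z = a" using ab(3) by simp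
    obtain c x y where c: "c \<in> K" "c \<noteq> 0" "x \<in> adjoin R s" "y \<in> adjoin R s" "a = c + (t * x + s * y)"
      using ab(1) unfolding units_at_def by (auto simp: add.assoc)
    obtain d x' y' where d: "d \<in> K" "d \<noteq> 0" "x' \<in> adjoin R s" "y' \<in> adjoin R s" "b = d + (t * x' + s * y')"
      using ab(2) unfolding units_at_def by (auto simp: add.assoc)
    \<comment> \<open>As \<open>b * z = a\<close>, where \<open>a\<close> and \<open>b\<close> have
      residues \<open>c\<close> and \<open>d\<close>, the residue of \<open>z\<close> must be
      \<open>c / d\<close>.\<close>
    have cd: "c / d \<in> K" using c d subfield_type_divide[OF K] by blast
    have "b * (z - c / d) = (t * x + s * y) - (t * x' + s * y') * (c / d)"
      using bz c(5) d(2,5) by (simp add: algebra_simps)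
    also have "\<dots> \<in> nonunits V"
      using above_unit(2)[OF V] c d cd KR V.RV by (intro V.nonunits_diff V.nonunits_mult) auto
    finally have "z - c / d \<in> nonunits V"
      using V.unit_mult_iff(2) above_unit(3)[OF V ab(2)] by blast
    thus ?thesis using cd by blast
  qed
qed

end

lemma adjoin_shift:
  assumes L: "subring_type L" and c: "c \<in> L"
  shows "adjoin L (w - c) = adjoin L (w :: 'b::field)"
proof
  note M = subring_type_closed[OF adjoin_subring[OF L]]
  show "adjoin L (w - c) \<subseteq> adjoin L w"
    by (intro adjoin_least adjoin_subring[OF L] subsetI adjoin_base[OF L] M adjoin_self[OF L] c)
  have "(w - c) + c \<in> adjoin L (w - c)"
    by (intro M(4) adjoin_self[OF L] adjoin_base[OF L] c)
  thus "adjoin L w \<subseteq> adjoin L (w - c)"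
    using adjoin_base[OF L] by (intro adjoin_least adjoin_subring[OF L]) auto
qed

text \<open>The residue \<open>\<beta>\<close> of \<open>w\<close> solves
  \<open>\<beta> ^ q - \<beta> = \<rho>\<close> and determines the ring; conversely each solution is
  the residue for exactly one ring, by \<open>ex_above\<close> and \<open>unique_above\<close> for
  \<open>w - \<beta>\<close>.\<close>

lemma (in dvr) unramified:
  assumes w: "w ^ q - w = h" "h \<in> R" and q: "q \<ge> 2"
    and frob: "\<And>x y :: 'b. (x - y) ^ q = x ^ q - y ^ q"
    and indep: "\<And>f. f \<in> polys_over L \<Longrightarrow> Polynomial.degree f < q \<Longrightarrow> poly f w = 0 \<Longrightarrow> f = 0"
    and \<rho>: "\<rho> \<in> K" "y \<in> R" "h = \<rho> + t * y"
    and fin: "finite K"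
  shows "finite (valuations_above K R t (adjoin L w))"
    and "card (valuations_above K R t (adjoin L w)) = card {\<beta>\<in>K. \<beta> ^ q - \<beta> = \<rho>}"
proof -
  define B where "B = {\<beta>\<in>K. \<beta> ^ q - \<beta> = \<rho>}"
  define S where "S = valuations_above K R t (adjoin L w)"
  define f where "f = (\<lambda>V. THE \<beta>. \<beta> \<in> K \<and> w - \<beta> \<in> nonunits V)"
  note Ls = subfield_type_subring[OF L] and Ks = subfield_type_subring[OF K]
  have LE: "L \<subseteq> adjoin L w" using adjoin_base[OF Ls] by blast
  have wE: "w \<in> adjoin L w" by (rule adjoin_self[OF Ls])
  have un: "artin_schreier_unram R L K t (w - \<beta>) y q" if "\<beta> \<in> B" for \<beta>
    unfolding artin_schreier_unram_def artin_schreier_unram_axioms_def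
  proof (intro conjI allI impI)
    have \<beta>: "\<beta> \<in> K" "\<beta> ^ q - \<beta> = \<rho>" using that by (auto simp: B_def)
    show "(w - \<beta>) ^ q - (w - \<beta>) = t * y" using w(1) \<beta>(2) \<rho>(3) by (simp add: frob algebra_simps)
    fix g assume g: "g \<in> polys_over L" "Polynomial.degree g < q" "poly g (w - \<beta>) = 0"
    \<comment> \<open>Substituting \<open>X - \<beta>\<close> preserves the degree, so independence
      passes from \<open>w\<close> to \<open>w - \<beta>\<close>.\<close>
    have "pcompose g [:- \<beta>, 1:] = 0"
    proof (rule indep)
      show "pcompose g [:- \<beta>, 1:] \<in> polys_over L"
        using g(1) \<beta>(1) KR RL by (intro polys_over_pcompose[OF Ls])
          (auto simp: polys_over_pCons_iff[OF Ls] polys_over_0[OF Ls] subring_type_closed[OF Ls])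
    qed (use g in \<open>auto simp: degree_pcompose poly_pcompose\<close>)
    thus "g = 0" by (rule pcompose_eq_0) simp
  qed (use q \<rho> dvr_axioms in auto)
  have sh: "adjoin L (w - \<beta>) = adjoin L w" if "\<beta> \<in> K" for \<beta>
    using that KR RL by (intro adjoin_shift[OF Ls]) auto
  have S: "dvr_ext R L K t V (adjoin L w)" "rational_valuation K V" if "V \<in> S" for V
    using that dvr_extI LE by (auto simp: S_def valuations_above_def)
  have uniq: "\<beta> = \<gamma>" if "V \<in> S" "\<beta> \<in> K" "\<gamma> \<in> K" "w - \<beta> \<in> nonunits V" "w - \<gamma> \<in> nonunits V" for V \<beta> \<gamma>
  proof -
    interpret V: dvr_ext R L K t V "adjoin L w" by (rule S(1)[OF that(1)])
    have "\<gamma> - \<beta> \<in> nonunits V" using V.nonunits_diff[OF that(4,5)] by simp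
    hence "\<gamma> - \<beta> = 0" using that by (intro V.const_nonunit subring_type_diff[OF Ks]) auto
    thus ?thesis by simp
  qed
  have ex: "\<exists>\<beta>\<in>B. w - \<beta> \<in> nonunits V" if "V \<in> S" for V
  proof -
    interpret V: dvr_ext R L K t V "adjoin L w" by (rule S(1)[OF that(1)])
    have rV: "rational_valuation K V" by (rule S(2)[OF that])
    have hV: "h \<in> V" using w V.RV by auto
    have "w \<in> V"
    proof (rule ccontr)
      assume wV: "w \<notin> V"
      have w0: "w \<noteq> 0" using wV V.Vc by auto
      have iw: "inverse w \<in> nonunits V" using wV V.total[OF wE] by (auto simp: nonunits_def)
      obtain n where n: "q = Suc (Suc n)" using q by (metis Suc_le_D numeral_2_eq_2 Suc_le_mono)
      \<comment> \<open>This is \<open>w ^ q = w + h\<close> divided by \<open>w ^ q\<close>: if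
        \<open>w\<close> had a pole, 1 would be a nonunit.\<close>
      have "1 = inverse w * (h * inverse w ^ (q - 1) + inverse w ^ (q - 2))"
        unfolding w(1)[symmetric] using w0 by (simp add: n field_simps)
      also have "\<dots> \<in> nonunits V"
        using V.nonunits_sub[OF iw] hV by (intro V.nonunits_mult iw V.Vc(4,5) V.Vc(7)[of "inverse w"]) auto
      finally show False using V.nonunits_not_1 by blast
    qed
    then obtain \<beta> where \<beta>: "\<beta> \<in> K" "w - \<beta> \<in> nonunits V"
      using rV unfolding rational_valuation_def by blast
    have "(w - \<beta>) ^ q = (w - \<beta>) * (w - \<beta>) ^ (q - 1)" using q by (cases q) auto
    moreover have "(w - \<beta>) ^ (q - 1) \<in> V" using V.nonunits_sub[OF \<beta>(2)] by (rule V.Vc(7))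
    ultimately have "(w - \<beta>) ^ q \<in> nonunits V" using V.nonunits_mult[OF \<beta>(2)] by simp
    hence "(w - \<beta>) ^ q - (w - \<beta>) \<in> nonunits V" by (rule V.nonunits_diff[OF _ \<beta>(2)])
    moreover have "(w - \<beta>) ^ q - (w - \<beta>) = (\<rho> - (\<beta> ^ q - \<beta>)) + t * y"
      using w(1) \<rho>(3) by (simp add: frob algebra_simps)
    moreover have "t * y \<in> nonunits V" using \<rho>(2) V.RV by (intro V.nonunits_mult V.t_nonunit) auto
    ultimately have "\<rho> - (\<beta> ^ q - \<beta>) \<in> nonunits V" using V.nonunits_diff by fastforce
    moreover have "\<rho> - (\<beta> ^ q - \<beta>) \<in> K" using \<beta>(1) \<rho>(1) by (intro subring_type_closed(6,7)[OF Ks])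
    ultimately have "\<rho> - (\<beta> ^ q - \<beta>) = 0" by (rule V.const_nonunit[rotated])
    hence "\<beta> \<in> B" using \<beta>(1) by (simp add: B_def)
    thus ?thesis using \<beta>(2) by blast
  qed
  have f: "f V \<in> B \<and> w - f V \<in> nonunits V" if V: "V \<in> S" for V
  proof -
    obtain \<beta> where \<beta>: "\<beta> \<in> B" "w - \<beta> \<in> nonunits V" using ex[OF V] by blast
    hence "f V = \<beta>" unfolding f_def using uniq[OF V] by (intro the_equality) (auto simp: B_def)
    thus ?thesis using \<beta> by simp
  qed
  have "inj_on f S"
  proof (rule inj_onI)
    fix V W assume VW: "V \<in> S" "W \<in> S" "f V = f W"
    interpret artin_schreier_unram R L K t "w - f V" y q using un f[OF VW(1)] by blast
    show "V = W" using unique_above[of V W] S(1)[OF VW(1)] S(1)[OF VW(2)] f[OF VW(1)] f[OF VW(2)] VW(3)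
        sh[of "f V"] by (auto simp: B_def)
  qed
  moreover have "B \<subseteq> f ` S"
  proof
    fix \<beta> assume \<beta>: "\<beta> \<in> B"
    interpret artin_schreier_unram R L K t "w - \<beta>" y q using un \<beta> by blast
    have K\<beta>: "\<beta> \<in> K" using \<beta> by (simp add: B_def)
    obtain V where V: "dvr_ext R L K t V (adjoin L (w - \<beta>))" "w - \<beta> \<in> nonunits V" using ex_above by blast
    hence "V \<in> S" using rational_above[OF V] sh[OF K\<beta>]
      unfolding S_def valuations_above_def dvr_ext_def dvr_ext_axioms_def by auto
    moreover have "f V = \<beta>" using uniq[OF calculation _ K\<beta> _ V(2)] f[OF calculation] by (auto simp: B_def)
    ultimately show "\<beta> \<in> f ` S" by blast
  qed
  ultimately have "bij_betw f S B" using f by (auto simp: bij_betw_def)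
  moreover have "finite B" using fin by (auto simp: B_def)
  ultimately show "finite S" "card S = card B"
    using bij_betw_finite bij_betw_same_card by blast+
qed

section \<open>The rational function field\<close>

definition transcendental_over :: "'b::field set \<Rightarrow> 'b \<Rightarrow> bool" where
  "transcendental_over K t \<longleftrightarrow> (\<forall>f\<in>polys_over K. poly f t = 0 \<longrightarrow> f = 0)"

definition rational_functions :: "'b::field set \<Rightarrow> 'b \<Rightarrow> 'b set" where
  "rational_functions K t = {poly f t / poly g t | f g. f \<in> polys_over K \<and> g \<in> polys_over K \<and> poly g t \<noteq> 0}"

text \<open>The local ring of \<open>K(t)\<close> at \<open>t = 0\<close>. Taking
  \<open>t = x - \<alpha>\<close> or \<open>t = inverse x\<close> covers the degree one places of
  \<open>K(x)\<close>, finite and infinite.\<close>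

definition local_ring :: "'b::field set \<Rightarrow> 'b \<Rightarrow> 'b set" where
  "local_ring K t = {poly f t / poly g t | f g. f \<in> polys_over K \<and> g \<in> polys_over K \<and> Polynomial.coeff g 0 \<noteq> 0}"

lemma rational_functionsI:
  "f \<in> polys_over K \<Longrightarrow> g \<in> polys_over K \<Longrightarrow> poly g t \<noteq> 0 \<Longrightarrow> z = poly f t / poly g t \<Longrightarrow>
    z \<in> rational_functions K t"
  unfolding rational_functions_def by blast

lemma local_ringI:
  "f \<in> polys_over K \<Longrightarrow> g \<in> polys_over K \<Longrightarrow> Polynomial.coeff g 0 \<noteq> 0 \<Longrightarrow> z = poly f t / poly g t \<Longrightarrow>
    z \<in> local_ring K t"
  unfolding local_ring_def by blast

lemma transcendental_shift:
  assumes K: "subfield_type K" and t: "transcendental_over K t" and c: "c \<in> K"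
  shows "transcendental_over K (t - c)"
  unfolding transcendental_over_def
proof (intro ballI impI)
  note Ks = subfield_type_subring[OF K]
  fix f assume f: "f \<in> polys_over K" "poly f (t - c) = 0"
  have "pcompose f [:-c, 1:] \<in> polys_over K" using f(1) c
    by (intro polys_over_pcompose[OF Ks])
      (auto simp: polys_over_pCons_iff[OF Ks] polys_over_0[OF Ks] subring_type_closed[OF Ks])
  moreover have "poly (pcompose f [:-c, 1:]) t = 0" using f(2) by (simp add: poly_pcompose)
  ultimately have "pcompose f [:-c, 1:] = 0" using t by (auto simp: transcendental_over_def)
  thus "f = 0" by (rule pcompose_eq_0) simp
qed

lemma transcendental_notin:
  assumes "subfield_type K" "transcendental_over K t"
  shows "t \<notin> K"
proof
  assume "t \<in> K"
  note Ks = subfield_type_subring[OF assms(1)]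
  have "[:-t, 1:] \<in> polys_over K" using \<open>t \<in> K\<close>
    by (auto simp: polys_over_pCons_iff[OF Ks] polys_over_0[OF Ks] subring_type_closed[OF Ks])
  moreover have "poly [:-t, 1:] t = 0" by simp
  ultimately have "[:-t, 1:] = 0" using assms(2) unfolding transcendental_over_def by blast
  thus False by simp
qed

lemma transcendental_inverse:
  assumes K: "subfield_type K" and t: "transcendental_over K t"
  shows "transcendental_over K (inverse t)"
  unfolding transcendental_over_def
proof (intro ballI impI)
  note Ks = subfield_type_subring[OF K]
  have t0: "t \<noteq> 0" using transcendental_notin[OF assms] subring_type_closed(1)[OF Ks] by auto
  fix f assume f: "f \<in> polys_over K" "poly f (inverse t) = 0"
  have "reflect_poly f \<in> polys_over K"
    using f(1) by (auto simp: polys_over_def coeff_reflect_poly subring_type_closed[OF Ks])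
  moreover have "poly (reflect_poly f) t = 0" using f(2) t0 by (simp add: poly_reflect_poly_nz)
  ultimately have "reflect_poly f = 0" using t by (auto simp: transcendental_over_def)
  thus "f = 0" by simp
qed

context
  fixes K :: "'b::field set"
  assumes K: "subfield_type K"
begin

private lemmas Ks = subfield_type_subring[OF K]
private lemmas Kc = subring_type_closed[OF Ks]
private lemmas pc = polys_over_closed[OF Ks]

lemma rational_functions_subfield: "subfield_type (rational_functions K t)"
proof (rule subfield_typeI)
  show "subring_type (rational_functions K t)"
  proof (rule subring_typeI)
    show "1 \<in> rational_functions K t" by (rule rational_functionsI[of 1 _ 1]) (auto intro: pc)
    fix x y assume "x \<in> rational_functions K t" "y \<in> rational_functions K t"
    then obtain f g f' g' where fg: "f \<in> polys_over K" "g \<in> polys_over K" "poly g t \<noteq> 0" "x = poly f t / poly g t"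
      "f' \<in> polys_over K" "g' \<in> polys_over K" "poly g' t \<noteq> 0" "y = poly f' t / poly g' t"
      unfolding rational_functions_def by blast
    show "x - y \<in> rational_functions K t"
      by (rule rational_functionsI[of "f * g' - f' * g" _ "g * g'"])
        (use fg in \<open>auto intro!: polys_over_mult[OF Ks] polys_over_diff[OF Ks] simp: diff_frac_eq\<close>)
    show "x * y \<in> rational_functions K t"
      by (rule rational_functionsI[of "f * f'" _ "g * g'"]) (use fg in \<open>auto intro!: polys_over_mult[OF Ks]\<close>)
  qed
  fix x assume "x \<in> rational_functions K t"
  then obtain f g where fg: "f \<in> polys_over K" "g \<in> polys_over K" "poly g t \<noteq> 0" "x = poly f t / poly g t"
      unfolding rational_functions_def by blast
  show "inverse x \<in> rational_functions K t"
  proof (cases "poly f t = 0")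
    case True
    thus ?thesis using fg by (intro rational_functionsI[of 0 _ 1]) (auto intro: pc)
  next
    case False
    thus ?thesis using fg by (intro rational_functionsI[of g _ f]) auto
  qed
qed

lemma rational_functions_base: "K \<subseteq> rational_functions K t" and rational_functions_self: "t \<in> rational_functions K t"
proof -
  show "t \<in> rational_functions K t" by (rule rational_functionsI[of "[:0, 1:]" _ 1])
    (auto simp: polys_over_pCons_iff[OF Ks] Kc pc)
  show "K \<subseteq> rational_functions K t"
  proof
    fix c assume "c \<in> K"
    thus "c \<in> rational_functions K t" by (intro rational_functionsI[of "[:c:]" _ 1])
      (auto simp: polys_over_pCons_iff[OF Ks] Kc pc)
  qed
qed

lemma rational_functions_least:
  assumes "subfield_type M" "K \<subseteq> M" "t \<in> M"
  shows "rational_functions K t \<subseteq> M"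
proof
  fix z assume "z \<in> rational_functions K t"
  then obtain f g where "f \<in> polys_over M" "g \<in> polys_over M" "z = poly f t / poly g t"
    using polys_over_mono[OF assms(2)] unfolding rational_functions_def by blast
  thus "z \<in> M"
    using poly_polys_over[OF subfield_type_subring[OF assms(1)] _ assms(3)] subfield_type_divide[OF assms(1)] by simp
qed

lemma rational_functions_shift:
  assumes "c \<in> K"
  shows "rational_functions K (t - c) = rational_functions K t"
proof
  note M = subring_type_closed[OF subfield_type_subring[OF rational_functions_subfield]]
  show "rational_functions K (t - c) \<subseteq> rational_functions K t"
    using assms rational_functions_base rational_functions_self
    by (intro rational_functions_least rational_functions_subfield M) auto
  have "(t - c) + c \<in> rational_functions K (t - c)"
    using assms rational_functions_base rational_functions_self by (intro M(4)) auto
  thus "rational_functions K t \<subseteq> rational_functions K (t - c)"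
    using rational_functions_base by (intro rational_functions_least rational_functions_subfield) auto
qed

lemma rational_functions_inverse: "rational_functions K (inverse t) = rational_functions K t"
proof
  note inv = subfield_type_inverse[OF rational_functions_subfield]
  show "rational_functions K (inverse t) \<subseteq> rational_functions K t"
    by (intro rational_functions_least rational_functions_subfield inv rational_functions_base rational_functions_self)
  have "inverse (inverse t) \<in> rational_functions K (inverse t)" by (intro inv rational_functions_self)
  thus "rational_functions K t \<subseteq> rational_functions K (inverse t)"
    by (intro rational_functions_least rational_functions_subfield rational_functions_base) simp_all
qed

lemma local_ring_poly: "f \<in> polys_over K \<Longrightarrow> poly f t \<in> local_ring K t"
  by (rule local_ringI[of f _ 1]) (auto intro: pc)

context
  fixes t :: 'b
  assumes t: "transcendental_over K t"
begin

lemma poly_transcendental_eq_0: "f \<in> polys_over K \<Longrightarrow> poly f t = 0 \<longleftrightarrow> f = 0"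
  using t by (auto simp: transcendental_over_def)

lemma local_ring_unit:
  assumes "f \<in> polys_over K" "Polynomial.coeff f 0 \<noteq> 0"
  shows "poly f t \<in> local_ring K t" "inverse (poly f t) \<in> local_ring K t" "poly f t \<noteq> 0"
  using assms local_ring_poly local_ringI[of 1 K f "inverse (poly f t)" t]
  by (auto simp: pc field_simps poly_transcendental_eq_0)

lemma local_ring_subring: "subring_type (local_ring K t)"
proof (rule subring_typeI)
  show "1 \<in> local_ring K t" by (rule local_ringI[of 1 _ 1]) (auto intro: pc)
  fix x y assume "x \<in> local_ring K t" "y \<in> local_ring K t"
  then obtain f g f' g' where fg: "f \<in> polys_over K" "g \<in> polys_over K" "Polynomial.coeff g 0 \<noteq> 0" "x = poly f t / poly g t"
    "f' \<in> polys_over K" "g' \<in> polys_over K" "Polynomial.coeff g' 0 \<noteq> 0" "y = poly f' t / poly g' t"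
    unfolding local_ring_def by blast
  have n0: "poly g t \<noteq> 0" "poly g' t \<noteq> 0" using fg local_ring_unit(3) by auto
  show "x - y \<in> local_ring K t"
    by (rule local_ringI[of "f * g' - f' * g" _ "g * g'"])
      (use fg n0 in \<open>auto intro!: polys_over_mult[OF Ks] polys_over_diff[OF Ks] simp: diff_frac_eq coeff_mult\<close>)
  show "x * y \<in> local_ring K t"
    by (rule local_ringI[of "f * f'" _ "g * g'"]) (use fg in \<open>auto intro!: polys_over_mult[OF Ks] simp: coeff_mult\<close>)
qed

lemma polys_over_factor_t:
  assumes "f \<in> polys_over K" "f \<noteq> 0"
  shows "\<exists>n. \<exists>g\<in>polys_over K. Polynomial.coeff g 0 \<noteq> 0 \<and> poly f t = t ^ n * poly g t"
  using assms
proof (induction f)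
  case (pCons a f)
  show ?case
  proof (cases "a = 0")
    case True
    hence "f \<noteq> 0" using pCons.hyps by auto
    then obtain n g where "g \<in> polys_over K" "Polynomial.coeff g 0 \<noteq> 0" "poly f t = t ^ n * poly g t"
      using pCons by (auto simp: polys_over_pCons_iff[OF Ks])
    thus ?thesis using True by (intro exI[of _ "Suc n"] bexI[of _ g]) auto
  next
    case False
    thus ?thesis using pCons.prems by (intro exI[of _ 0] bexI[of _ "pCons a f"]) auto
  qed
qed simp

lemma dvr_local_ring: "dvr (local_ring K t) (rational_functions K t) K t"
proof (rule dvr.intro)
  have t0: "t \<noteq> 0" using transcendental_notin[OF K t] Kc(1) by auto
  show "subfield_type (rational_functions K t)" by (rule rational_functions_subfield)
  show "subfield_type K" by (rule K)
  show Rs: "subring_type (local_ring K t)" by (rule local_ring_subring)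
  show "K \<subseteq> local_ring K t"
  proof
    fix c assume "c \<in> K"
    thus "c \<in> local_ring K t" using local_ring_poly[of "[:c:]" t] by (auto simp: polys_over_pCons_iff[OF Ks] pc)
  qed
  show "local_ring K t \<subseteq> rational_functions K t"
    using local_ring_unit(3) unfolding local_ring_def rational_functions_def by blast
  show "t \<in> local_ring K t" using local_ring_poly[of "[:0,1:]" t] by (auto simp: polys_over_pCons_iff[OF Ks] pc Kc)
  show "inverse t \<notin> local_ring K t"
  proof
    assume "inverse t \<in> local_ring K t"
    then obtain f g where fg: "f \<in> polys_over K" "g \<in> polys_over K" "Polynomial.coeff g 0 \<noteq> 0"
      "inverse t = poly f t / poly g t" unfolding local_ring_def by blast
    have "poly g t \<noteq> 0" using fg local_ring_unit(3) by auto
    hence "poly (g - pCons 0 f) t = 0" using fg(4) t0 by (simp add: field_simps)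
    moreover have "g - pCons 0 f \<in> polys_over K" using fg
      by (intro polys_over_diff[OF Ks]) (auto simp: polys_over_pCons_iff[OF Ks] Kc)
    ultimately have "g = pCons 0 f" using poly_transcendental_eq_0 by force
    thus False using fg(3) by simp
  qed
  show "\<exists>k::int. \<exists>u\<in>local_ring K t. inverse u \<in> local_ring K t \<and> u \<noteq> 0 \<and> z = t powi k * u"
    if z: "z \<in> rational_functions K t" "z \<noteq> 0" for z
  proof -
    obtain f g where fg: "f \<in> polys_over K" "g \<in> polys_over K" "poly g t \<noteq> 0" "z = poly f t / poly g t"
      using z(1) unfolding rational_functions_def by blast
    have "f \<noteq> 0" "g \<noteq> 0" using fg z(2) by auto
    then obtain n f' m g' where *: "f' \<in> polys_over K" "Polynomial.coeff f' 0 \<noteq> 0" "poly f t = t ^ n * poly f' t"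
      "g' \<in> polys_over K" "Polynomial.coeff g' 0 \<noteq> 0" "poly g t = t ^ m * poly g' t"
      using polys_over_factor_t fg(1,2) by metis
    have "z = t powi (int n - int m) * (poly f' t * inverse (poly g' t))"
      unfolding fg(4) *(3,6) using t0 by (simp add: power_int_diff field_simps)
    moreover have "poly f' t * inverse (poly g' t) \<in> local_ring K t"
      "inverse (poly f' t * inverse (poly g' t)) \<in> local_ring K t" "poly f' t * inverse (poly g' t) \<noteq> 0"
      using local_ring_unit[OF *(1,2)] local_ring_unit[OF *(4,5)] subring_type_closed(5)[OF Rs] by auto
    ultimately show ?thesis by blast
  qed
  show "\<exists>c\<in>K. \<exists>y\<in>local_ring K t. z = c + t * y" if z: "z \<in> local_ring K t" for z
  proof -
    obtain f g where fg: "f \<in> polys_over K" "g \<in> polys_over K" "Polynomial.coeff g 0 \<noteq> 0"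
      "z = poly f t / poly g t" using z unfolding local_ring_def by blast
    \<comment> \<open>The residue of \<open>z\<close> is its value at \<open>t = 0\<close>.\<close>
    define c where "c = Polynomial.coeff f 0 / Polynomial.coeff g 0"
    have c: "c \<in> K" unfolding c_def using fg by (intro subfield_type_divide[OF K] polys_overD)
    obtain a k where k: "f - smult c g = pCons a k" by (cases "f - smult c g")
    have "Polynomial.coeff (f - smult c g) 0 = 0" using fg(3) by (simp add: c_def)
    hence a: "a = 0" unfolding k by simp
    have "f - smult c g \<in> polys_over K" using fg c by (intro polys_over_diff[OF Ks] polys_over_smult[OF Ks])
    hence kK: "k \<in> polys_over K" unfolding k by (simp add: polys_over_pCons_iff[OF Ks])
    have "poly f t - c * poly g t = t * poly k t" using arg_cong[OF k, of "\<lambda>f. poly f t"] a by simp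
    moreover have "poly g t \<noteq> 0" using fg local_ring_unit(3) by auto
    ultimately have "z = c + t * (poly k t / poly g t)" using fg(4) by (simp add: field_simps)
    moreover have "poly k t / poly g t \<in> local_ring K t" using kK fg by (auto intro: local_ringI)
    ultimately show ?thesis using c by blast
  qed
qed

end

text \<open>A denominator is a nonzero constant plus a multiple of \<open>t\<close>, hence a unit of
  \<open>V\<close>.\<close>

lemma local_ring_subset_valuation:
  assumes V: "valuation_ring V E" and KV: "K \<subseteq> V" and t: "t \<in> nonunits V"
  shows "local_ring K t \<subseteq> V"
proof
  interpret valuation_ring V E by (rule V)
  fix z assume "z \<in> local_ring K t"
  then obtain f g where fg: "f \<in> polys_over K" "g \<in> polys_over K" "Polynomial.coeff g 0 \<noteq> 0"
      "z = poly f t / poly g t" unfolding local_ring_def by blast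
  have pV: "poly f t \<in> V" if "f \<in> polys_over K" for f
    using that polys_over_mono[OF KV] nonunits_sub[OF t] poly_polys_over[OF V] by blast
  obtain c g' where g: "g = pCons c g'" by (cases g)
  have c: "c \<in> K" "c \<noteq> 0" and g': "g' \<in> polys_over K" using fg g by (auto simp: polys_over_pCons_iff[OF Ks])
  have "c \<in> V" "c \<notin> nonunits V" using c KV subfield_type_inverse[OF K] by (auto simp: nonunits_def)
  hence "poly g t \<in> V" "poly g t \<notin> nonunits V" unfolding g
    using unit_plus_nonunit[of c "t * poly g' t"] nonunits_mult[OF t pV[OF g']] by auto
  hence "inverse (poly g t) \<in> V" using nonunits_iff by blast
  thus "z \<in> V" unfolding fg(4) divide_inverse using pV[OF fg(1)] by (intro Vc)
qed

end

section \<open>Counting the rational places\<close>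

definition rational_valuations :: "'b::field set \<Rightarrow> 'b set \<Rightarrow> 'b set set" where
  "rational_valuations K E = {V. valuation_ring V E \<and> K \<subset> V \<and> V \<subset> E \<and> rational_valuation K V}"

text \<open>At a rational place \<open>x\<close> either is congruent to a constant
  \<open>\<alpha>\<close>, and then \<open>x - \<alpha>\<close> is a nonunit, or has a pole, and
  then \<open>1/x\<close> is one.\<close>

lemma rational_valuations_decompose:
  assumes K: "subfield_type K" and x: "transcendental_over K x" and E: "K \<subseteq> E" "x \<in> E"
  shows "rational_valuations K E = (\<Union>\<alpha>\<in>K. valuations_above K (local_ring K (x - \<alpha>)) (x - \<alpha>) E)
    \<union> valuations_above K (local_ring K (inverse x)) (inverse x) E" (is "_ = ?U")
proof
  note Ks = subfield_type_subring[OF K]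
  have above: "V \<in> rational_valuations K E"
    if "V \<in> valuations_above K (local_ring K t) t E" "transcendental_over K t" "t \<in> E" for V t
  proof -
    interpret R: dvr "local_ring K t" "rational_functions K t" K t by (rule dvr_local_ring[OF K that(2)])
    have V: "valuation_ring V E" "local_ring K t \<subseteq> V" "inverse t \<notin> V" "rational_valuation K V"
      using that by (auto simp: valuations_above_def)
    interpret V: valuation_ring V E by (rule V(1))
    have "t \<in> V" "t \<notin> K" using V(2) R.t transcendental_notin[OF K that(2)] by auto
    moreover have "inverse t \<in> E" by (rule subfield_type_inverse[OF V.E that(3)])
    ultimately show ?thesis using V V.VE R.KR by (auto simp: rational_valuations_def)
  qed
  show "?U \<subseteq> rational_valuations K E"
  proof
    fix V assume V: "V \<in> ?U"
    then obtain t where t: "V \<in> valuations_above K (local_ring K t) t E" 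
      "t = inverse x \<or> (\<exists>\<alpha>\<in>K. t = x - \<alpha>)" by blast
    interpret V: valuation_ring V E using t(1) by (auto simp: valuations_above_def)
    have "t \<in> E" using t(2) E subfield_type_inverse[OF V.E] subring_type_closed(6)[OF subfield_type_subring[OF V.E]] by auto
    moreover have "transcendental_over K t"
      using t(2) transcendental_inverse[OF K x] transcendental_shift[OF K x] by auto
    ultimately show "V \<in> rational_valuations K E" using above[OF t(1)] by blast
  qed
  show "rational_valuations K E \<subseteq> ?U"
  proof
    fix V assume "V \<in> rational_valuations K E"
    hence V: "valuation_ring V E" "K \<subseteq> V" "rational_valuation K V" by (auto simp: rational_valuations_def)
    interpret V: valuation_ring V E by (rule V(1))
    show "V \<in> ?U"
    proof (cases "x \<in> V")
      case True
      then obtain \<alpha> where \<alpha>: "\<alpha> \<in> K" "x - \<alpha> \<in> nonunits V" using V(3) by (auto simp: rational_valuation_def)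
      have "x - \<alpha> \<noteq> 0" using transcendental_notin[OF K x] \<alpha>(1) by auto
      hence "inverse (x - \<alpha>) \<notin> V" using \<alpha>(2) by (auto simp: nonunits_def)
      thus ?thesis using V local_ring_subset_valuation[OF K V(1,2) \<alpha>(2)] \<alpha>(1) by (auto simp: valuations_above_def)
    next
      case False
      hence "inverse x \<in> nonunits V" using V.total[OF E(2)] by (auto simp: nonunits_def)
      thus ?thesis using V local_ring_subset_valuation[OF K V(1,2)] False by (auto simp: valuations_above_def)
    qed
  qed
qed

lemma card_rational_valuations:
  assumes K: "subfield_type K" "finite K" and x: "transcendental_over K x" and E: "K \<subseteq> E" "x \<in> E"
    and fin: "\<And>\<alpha>. \<alpha> \<in> K \<Longrightarrow> finite (valuations_above K (local_ring K (x - \<alpha>)) (x - \<alpha>) E)"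
      "finite (valuations_above K (local_ring K (inverse x)) (inverse x) E)"
  shows "card (rational_valuations K E) =
    (\<Sum>\<alpha>\<in>K. card (valuations_above K (local_ring K (x - \<alpha>)) (x - \<alpha>) E))
      + card (valuations_above K (local_ring K (inverse x)) (inverse x) E)"
proof -
  note Ks = subfield_type_subring[OF K(1)]
  let ?S = "\<lambda>\<alpha>. valuations_above K (local_ring K (x - \<alpha>)) (x - \<alpha>) E"
  let ?T = "valuations_above K (local_ring K (inverse x)) (inverse x) E"
  have mem: "x - \<alpha> \<in> nonunits V" "valuation_ring V E" "K \<subseteq> V" if "V \<in> ?S \<alpha>" "\<alpha> \<in> K" for V \<alpha>
  proof -
    interpret R: dvr "local_ring K (x - \<alpha>)" "rational_functions K (x - \<alpha>)" K "x - \<alpha>"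
      by (rule dvr_local_ring[OF K(1) transcendental_shift[OF K(1) x that(2)]])
    show "x - \<alpha> \<in> nonunits V" "valuation_ring V E" "K \<subseteq> V" 
      using that R.KR R.t by (auto simp: valuations_above_def nonunits_def)
  qed
  have disj: "\<alpha> = \<beta>" if "V \<in> ?S \<alpha>" "V \<in> ?S \<beta>" "\<alpha> \<in> K" "\<beta> \<in> K" for V \<alpha> \<beta>
  proof (rule ccontr)
    assume ne: "\<alpha> \<noteq> \<beta>"
    interpret valuation_ring V E by (rule mem[OF that(1,3)])
    have "\<beta> - \<alpha> \<in> nonunits V" using nonunits_diff[OF mem(1)[OF that(1,3)] mem(1)[OF that(2,4)]] by simp
    moreover have "inverse (\<beta> - \<alpha>) \<in> V"
      using that(3,4) mem(3)[OF that(1,3)] subfield_type_inverse[OF K(1)] subring_type_closed(6)[OF Ks] by blast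
    ultimately show False using ne by (auto simp: nonunits_def)
  qed
  have disj': "?S \<alpha> \<inter> ?T = {}" if "\<alpha> \<in> K" for \<alpha>
  proof (rule ccontr)
    assume "?S \<alpha> \<inter> ?T \<noteq> {}"
    then obtain V where V: "V \<in> ?S \<alpha>" "V \<in> ?T" by blast
    interpret V: valuation_ring V E by (rule mem[OF V(1) that])
    have "(x - \<alpha>) + \<alpha> \<in> V" using mem[OF V(1) that] that V.nonunits_sub by (intro V.Vc(4)) auto
    thus False using V(2) by (simp add: valuations_above_def)
  qed
  have "card (rational_valuations K E) = card (\<Union>\<alpha>\<in>K. ?S \<alpha>) + card ?T"
    unfolding rational_valuations_decompose[OF K(1) x E]
    by (rule card_Un_disjoint) (use fin K(2) disj' in auto)
  also have "card (\<Union>\<alpha>\<in>K. ?S \<alpha>) = (\<Sum>\<alpha>\<in>K. card (?S \<alpha>))"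
    by (rule card_UN_disjoint) (use fin K(2) disj in auto)
  finally show ?thesis .
qed

lemma card_pairs: "finite A \<Longrightarrow> finite B \<Longrightarrow> card {(a, b). a \<in> A \<and> b \<in> B \<and> P a b} = (\<Sum>a\<in>A. card {b\<in>B. P a b})"
proof -
  assume "finite A" "finite B"
  moreover have "{(a, b). a \<in> A \<and> b \<in> B \<and> P a b} = Sigma A (\<lambda>a. {b\<in>B. P a b})" by auto
  ultimately show ?thesis by (simp add: card_SigmaI)
qed

locale artin_schreier_rational =
  fixes K :: "'b::field set" and x w :: 'b and q :: nat
  assumes K: "subfield_type K" "finite K" and x: "transcendental_over K x" and q: "q \<ge> 2"
    and frob: "\<And>x y :: 'b. (x - y) ^ q = x ^ q - y ^ q"
begin

abbreviation "F \<equiv> rational_functions K x"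

lemmas Ks = subfield_type_subring[OF K(1)]
lemmas Kc = subring_type_closed[OF Ks]
lemmas pc = polys_over_closed[OF Ks]

lemma dvr_finite: "\<alpha> \<in> K \<Longrightarrow> dvr (local_ring K (x - \<alpha>)) F K (x - \<alpha>)"
  using dvr_local_ring[OF K(1) transcendental_shift[OF K(1) x]] rational_functions_shift[OF K(1), of \<alpha> x] by metis

lemma dvr_infinite: "dvr (local_ring K (inverse x)) F K (inverse x)"
  using dvr_local_ring[OF K(1) transcendental_inverse[OF K(1) x]] rational_functions_inverse[OF K(1), of x] by simp

lemma x_neq_0: "x \<noteq> 0"
  using transcendental_notin[OF K(1) x] Kc(1) by auto

lemma K_subset_extension: "K \<subseteq> adjoin F w" and x_in_extension: "x \<in> adjoin F w"
  using adjoin_base[OF subfield_type_subring[OF rational_functions_subfield[OF K(1)]], where x = w]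
    rational_functions_base[OF K(1), of x] rational_functions_self[OF K(1), of x] by blast+

text \<open>Infinity is the only pole and totally ramified. It accounts for the summand 1 and also
  provides the independence that the finite places require.\<close>

lemma card_polynomial_case:
  assumes H: "H \<in> polys_over K" "coprime (Polynomial.degree H) q" "Polynomial.degree H > 0"
    and w: "w ^ q - w = poly H x"
  shows "card (rational_valuations K (adjoin F w)) =
    1 + card {(\<alpha>, \<beta>). \<alpha> \<in> K \<and> \<beta> \<in> K \<and> \<beta> ^ q - \<beta> = poly H \<alpha>}"
proof -
  have H0: "H \<noteq> 0" using H by auto
  interpret I: dvr "local_ring K (inverse x)" F K "inverse x" by (rule dvr_infinite)
  \<comment> \<open>\<open>H(x)\<close> is \<open>x ^ degree H\<close> times the reversed polynomial
    at \<open>1/x\<close>, whose constant coefficient is the leading one of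
    \<open>H\<close>.\<close>
  define u where "u = poly (reflect_poly H) (inverse x)"
  have refl: "reflect_poly H \<in> polys_over K"
    using H(1) by (auto simp: polys_over_def coeff_reflect_poly Kc)
  have u: "u \<in> local_ring K (inverse x)" "inverse u \<in> local_ring K (inverse x)" "u \<noteq> 0"
    unfolding u_def by (rule local_ring_unit[OF K(1) transcendental_inverse[OF K(1) x] refl]; use H0 in simp)+
  have w': "w ^ q - w = inverse x powi (- int (Polynomial.degree H)) * u"
    unfolding w u_def using x_neq_0 by (simp add: poly_reflect_poly_nz power_int_minus power_inverse)
  note ram = I.ramified[OF w' q H(3) H(2) u]
  obtain V where V: "valuations_above K (local_ring K (inverse x)) (inverse x) (adjoin F w) = {V}"
    using ram(1) by blast
  have fin: "finite (valuations_above K (local_ring K (x - \<alpha>)) (x - \<alpha>) (adjoin F w)) \<and>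
      card (valuations_above K (local_ring K (x - \<alpha>)) (x - \<alpha>) (adjoin F w)) = card {\<beta>\<in>K. \<beta> ^ q - \<beta> = poly H \<alpha>}"
    if \<alpha>: "\<alpha> \<in> K" for \<alpha>
  proof -
    interpret R: dvr "local_ring K (x - \<alpha>)" F K "x - \<alpha>" by (rule dvr_finite[OF \<alpha>])
    \<comment> \<open>Taylor shift: \<open>G\<close> is \<open>H\<close> expanded at
      \<open>\<alpha>\<close>, so its constant coefficient is the residue
      \<open>H(\<alpha>)\<close>.\<close>
    define G where "G = pcompose H [:\<alpha>, 1:]"
    have G: "G \<in> polys_over K" unfolding G_def using H(1) \<alpha>
      by (intro pc) (auto simp: polys_over_pCons_iff[OF Ks] pc Kc)
    obtain a g where ag: "G = pCons a g" by (cases G)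
    have a: "a = poly H \<alpha>" using arg_cong[OF ag, of "\<lambda>p. poly p 0"] by (simp add: G_def poly_pcompose)
    have g: "g \<in> polys_over K" using G ag by (simp add: polys_over_pCons_iff[OF Ks])
    have h: "poly H x = poly G (x - \<alpha>)" by (simp add: G_def poly_pcompose)
    have hR: "poly H x \<in> local_ring K (x - \<alpha>)" unfolding h by (rule local_ring_poly[OF K(1) G])
    have \<rho>: "poly H \<alpha> \<in> K" by (rule poly_polys_over[OF Ks H(1) \<alpha>])
    have e: "poly H x = poly H \<alpha> + (x - \<alpha>) * poly g (x - \<alpha>)" unfolding h ag using a by simp
    show ?thesis
      using R.unramified[OF w hR q frob ram(2) \<rho> local_ring_poly[OF K(1) g] e K(2)] by blast
  qed
  have "card (rational_valuations K (adjoin F w)) =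
      (\<Sum>\<alpha>\<in>K. card {\<beta>\<in>K. \<beta> ^ q - \<beta> = poly H \<alpha>}) + 1"
    using card_rational_valuations[OF K x K_subset_extension x_in_extension] fin V by simp
  thus ?thesis using card_pairs[OF K(2) K(2), of "\<lambda>\<alpha> \<beta>. \<beta> ^ q - \<beta> = poly H \<alpha>"] by simp
qed

text \<open>The factor 2 has two sources: one ramified place over each \<open>\<alpha>\<close> with
  \<open>\<alpha> ^ q = \<alpha>\<close>, and over infinity, where the right-hand side vanishes, one
  place for each solution of \<open>\<beta> ^ q = \<beta>\<close>.\<close>

lemma card_reciprocal_case:
  assumes w: "w ^ q - w = inverse (x ^ q - x)"
  shows "card (rational_valuations K (adjoin F w)) = 2 * card {\<alpha>\<in>K. \<alpha> ^ q = \<alpha>} +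
    card {(\<alpha>, \<beta>). \<alpha> \<in> K \<and> \<beta> \<in> K \<and> \<alpha> ^ q \<noteq> \<alpha> \<and> \<beta> ^ q - \<beta> = inverse (\<alpha> ^ q - \<alpha>)}"
proof -
  \<comment> \<open>\<open>t ^ q - t = t * Q(t)\<close> with \<open>Q(0) = -1\<close>. By additivity
    this describes \<open>x ^ q - x\<close> near every \<open>\<alpha>\<close>, and in the form
    \<open>(x^q - x) * t^q = - Q(t)\<close> also at \<open>t = 1/x\<close>.\<close>
  define Q :: "'b poly" where "Q = Polynomial.monom 1 (q - 1) - 1"
  have Q: "Q \<in> polys_over K" unfolding Q_def by (intro polys_over_diff[OF Ks] polys_over_monom[OF Ks] pc Kc)
  have Q0: "Polynomial.coeff Q 0 \<noteq> 0" using q by (simp add: Q_def)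
  have tQ: "t ^ q - t = t * poly Q t" for t
    using q by (cases q) (simp_all add: Q_def poly_monom algebra_simps)
  have ram: "valuations_above K (local_ring K (x - \<alpha>)) (x - \<alpha>) (adjoin F w) \<in> range (\<lambda>V. {V})
       \<and> (\<forall>f\<in>polys_over F. Polynomial.degree f < q \<longrightarrow> poly f w = 0 \<longrightarrow> f = 0)"
    if \<alpha>: "\<alpha> \<in> K" "\<alpha> ^ q = \<alpha>" for \<alpha>
  proof -
    interpret R: dvr "local_ring K (x - \<alpha>)" F K "x - \<alpha>" by (rule dvr_finite[OF \<alpha>(1)])
    note u = local_ring_unit[OF K(1) transcendental_shift[OF K(1) x \<alpha>(1)] Q Q0]
    have "x ^ q - x = (x - \<alpha>) ^ q - (x - \<alpha>)" using \<alpha> by (simp add: frob)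
    hence w': "w ^ q - w = (x - \<alpha>) powi (- int 1) * inverse (poly Q (x - \<alpha>))"
      unfolding w using tQ[of "x - \<alpha>"] by (simp add: power_int_minus)
    show ?thesis
      using R.ramified[OF w' q, of] u by fastforce
  qed
  \<comment> \<open>\<open>\<alpha> = 0\<close> is the ramified place from which independence is
    taken.\<close>
  have "(0 :: 'b) ^ q = 0" using q by simp
  with ram[OF Kc(1)] have indep: "f = 0" if "f \<in> polys_over F" "Polynomial.degree f < q" "poly f w = 0" for f
    using that by blast
  let ?N = "\<lambda>t. valuations_above K (local_ring K t) t (adjoin F w)"
  have unram: "finite (?N (x - \<alpha>)) \<and> card (?N (x - \<alpha>)) = card {\<beta>\<in>K. \<beta> ^ q - \<beta> = inverse (\<alpha> ^ q - \<alpha>)}"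
    if \<alpha>: "\<alpha> \<in> K" "\<alpha> ^ q \<noteq> \<alpha>" for \<alpha>
  proof -
    interpret R: dvr "local_ring K (x - \<alpha>)" F K "x - \<alpha>" by (rule dvr_finite[OF \<alpha>(1)])
    define \<delta> where "\<delta> = \<alpha> ^ q - \<alpha>"
    define t where "t = x - \<alpha>"
    have \<delta>: "\<delta> \<in> K" "\<delta> \<noteq> 0" using \<alpha> by (auto simp: \<delta>_def Kc)
    define D where "D = pCons \<delta> Q"
    have D: "D \<in> polys_over K" "Polynomial.coeff D 0 \<noteq> 0" using \<delta> Q by (auto simp: D_def polys_over_pCons_iff[OF Ks])
    have pD: "x ^ q - x = poly D t"
      using tQ[of t] by (simp add: D_def t_def \<delta>_def frob algebra_simps)
    note u = local_ring_unit[OF K(1) transcendental_shift[OF K(1) x \<alpha>(1)] D, folded t_def]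
    have y: "- poly Q t * inverse (poly D t) * inverse \<delta> \<in> local_ring K t"
      using subring_type_closed[OF R.R] u local_ring_poly[OF K(1) Q] R.KR subfield_type_inverse[OF K(1) \<delta>(1)]
      unfolding t_def by (intro subring_type_closed(3,5)[OF R.R]) auto
    \<comment> \<open>With \<open>D = \<delta> + t * Q\<close> this reads
      \<open>1/D = 1/\<delta> - t * Q / (D * \<delta>)\<close>, so the residue at
      \<open>\<alpha>\<close> is \<open>1/\<delta>\<close>.\<close>
    have e: "inverse (x ^ q - x) = inverse \<delta> + t * (- poly Q t * inverse (poly D t) * inverse \<delta>)"
      unfolding pD using u(3) \<delta>(2) by (simp add: field_simps) (simp add: D_def algebra_simps)
    have h: "inverse (x ^ q - x) \<in> local_ring K (x - \<alpha>)" using u(2) pD by (simp add: t_def)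
    show ?thesis
      using R.unramified[OF w h q frob indep subfield_type_inverse[OF K(1) \<delta>(1)] y[unfolded t_def] e[unfolded t_def] K(2)]
      unfolding \<delta>_def by blast
  qed
  have infin: "finite (?N (inverse x)) \<and> card (?N (inverse x)) = card {\<beta>\<in>K. \<beta> ^ q - \<beta> = 0}"
  proof -
    interpret R: dvr "local_ring K (inverse x)" F K "inverse x" by (rule dvr_infinite)
    define t where "t = inverse x"
    have t0: "t \<noteq> 0" using x_neq_0 by (simp add: t_def)
    have "x ^ q = inverse (t ^ q)" "x = inverse t" by (simp_all add: t_def power_inverse)
    have "(x ^ q - x) * t ^ q = - poly Q t" 
      using t0 q by (cases q) (auto simp: Q_def poly_monom t_def field_simps)
    hence "x ^ q - x = - poly Q t * inverse (t ^ q)" using t0 by (simp add: field_simps)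
    hence e: "inverse (x ^ q - x) = - (t ^ q * inverse (poly Q t))" by simp
    have "t ^ q = t * t ^ (q - 1)" using q by (cases q) auto
    hence e': "inverse (x ^ q - x) = 0 + t * (- (t ^ (q - 1) * inverse (poly Q t)))" unfolding e by simp
    have y: "- (t ^ (q - 1) * inverse (poly Q t)) \<in> local_ring K t"
      using local_ring_unit[OF K(1) transcendental_inverse[OF K(1) x] Q Q0] R.t
      unfolding t_def by (intro subring_type_closed(3,5)[OF R.R] subring_type_closed(7)[OF R.R, of "inverse x"]) auto
    have h: "inverse (x ^ q - x) \<in> local_ring K (inverse x)"
      unfolding e' add_0 using y R.t unfolding t_def by (intro subring_type_closed(5)[OF R.R])
    show ?thesis
      using R.unramified[OF w h q frob indep Kc(1) y[unfolded t_def] e'[unfolded t_def] K(2)] by blast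
  qed
  have fin: "finite (?N (x - \<alpha>))" if "\<alpha> \<in> K" for \<alpha> using ram unram that by (cases "\<alpha> ^ q = \<alpha>") fastforce+
  have "card (rational_valuations K (adjoin F w)) = (\<Sum>\<alpha>\<in>K. card (?N (x - \<alpha>))) + card (?N (inverse x))"
    using card_rational_valuations[OF K x K_subset_extension x_in_extension] fin infin by simp
  also have "(\<Sum>\<alpha>\<in>K. card (?N (x - \<alpha>))) =
      (\<Sum>\<alpha>\<in>K. (if \<alpha> ^ q = \<alpha> then 1 else 0) + card {\<beta>\<in>K. \<alpha> ^ q \<noteq> \<alpha> \<and> \<beta> ^ q - \<beta> = inverse (\<alpha> ^ q - \<alpha>)})"
  proof (rule sum.cong)
    fix \<alpha> assume \<alpha>: "\<alpha> \<in> K"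
    show "card (?N (x - \<alpha>)) = (if \<alpha> ^ q = \<alpha> then 1 else 0) +
        card {\<beta>\<in>K. \<alpha> ^ q \<noteq> \<alpha> \<and> \<beta> ^ q - \<beta> = inverse (\<alpha> ^ q - \<alpha>)}"
    proof (cases "\<alpha> ^ q = \<alpha>")
      case True
      then obtain V where "?N (x - \<alpha>) = {V}" using ram[OF \<alpha>] by blast
      thus ?thesis using True by simp
    qed (use unram[OF \<alpha>] in simp)
  qed simp
  also have "\<dots> = card {\<alpha>\<in>K. \<alpha> ^ q = \<alpha>} +
      card {(\<alpha>, \<beta>). \<alpha> \<in> K \<and> \<beta> \<in> K \<and> \<alpha> ^ q \<noteq> \<alpha> \<and> \<beta> ^ q - \<beta> = inverse (\<alpha> ^ q - \<alpha>)}"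
    using card_pairs[OF K(2) K(2), of "\<lambda>\<alpha> \<beta>. \<alpha> ^ q \<noteq> \<alpha> \<and> \<beta> ^ q - \<beta> = inverse (\<alpha> ^ q - \<alpha>)"] K(2)
    by (simp add: sum.distrib flip: sum.inter_filter)
  finally show ?thesis using infin by simp
qed

end

section \<open>Rational places and their valuation rings\<close>

context valuation_ring
begin

lemma ring_on_ring: "ring (ring_on V)"
  using ring.subring_is_ring[OF ring_from_type_algebra V] .

lemma ring_on_a_inv: "x \<in> V \<Longrightarrow> \<ominus>\<^bsub>ring_on V\<^esub> x = - x"
proof -
  interpret ring "ring_on V" by (rule ring_on_ring)
  show "x \<in> V \<Longrightarrow> \<ominus>\<^bsub>ring_on V\<^esub> x = - x"
    using minus_equality[of "-x" x] Vc(3) by simp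
qed

lemma ideal_nonunits: "ideal (nonunits V) (ring_on V)"
proof (rule idealI[OF ring_on_ring])
  interpret ring "ring_on V" by (rule ring_on_ring)
  show "subgroup (nonunits V) (add_monoid (ring_on V))"
  proof
    show "inv\<^bsub>add_monoid (ring_on V)\<^esub> x \<in> nonunits V" if "x \<in> nonunits V" for x
      using ring_on_a_inv[of x] nonunits_sub[OF that] nonunits_uminus[OF that] by (simp add: a_inv_def)
  qed (auto intro: nonunits_sub nonunits_add nonunits_0)
qed (auto intro: nonunits_mult nonunits_mult')

lemma ideal_sub_nonunits:
  assumes "ideal P (ring_on V)" "P \<noteq> V"
  shows "P \<subseteq> nonunits V"
proof
  interpret ideal P "ring_on V" by (rule assms(1))
  fix x assume x: "x \<in> P"
  show "x \<in> nonunits V"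
  proof (rule ccontr)
    have xV: "x \<in> V" using Icarr[OF x] by simp
    assume "x \<notin> nonunits V"
    hence "x \<noteq> 0" "inverse x \<in> V" using xV nonunits_iff by auto
    hence "1 \<in> P" using I_l_closed[OF x, of "inverse x"] by simp
    hence "P = V" using one_imp_carrier by simp
    thus False using assms(2) by simp
  qed
qed

text \<open>The nonunits form an ideal that contains every proper ideal, so \<open>V\<close> is a
  local ring.\<close>

lemma maximalideal_iff: "maximalideal P (ring_on V) \<longleftrightarrow> P = nonunits V"
proof -
  have ne: "nonunits V \<noteq> V" using nonunits_not_1 Vc(2) by blast
  show ?thesis
  proof
    assume "maximalideal P (ring_on V)"
    then interpret maximalideal P "ring_on V" .
    have "P \<noteq> V" using I_notcarr by auto
    hence "P \<subseteq> nonunits V" using ideal_sub_nonunits is_ideal by blast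
    thus "P = nonunits V" using I_maximal[OF ideal_nonunits] ne nonunits_sub by auto
  next
    assume P: "P = nonunits V"
    show "maximalideal P (ring_on V)"
    proof (rule maximalidealI)
      show "ideal P (ring_on V)" unfolding P by (rule ideal_nonunits)
      show "carrier (ring_on V) \<noteq> P" using ne P by simp
      show "J = P \<or> J = carrier (ring_on V)"
        if "ideal J (ring_on V)" "P \<subseteq> J" "J \<subseteq> carrier (ring_on V)" for J
        using ideal_sub_nonunits[OF that(1)] that(2) P by auto
    qed
  qed
qed

lemma residue_field_dimension_1_iff:
  assumes K: "subfield_type K" "K \<subseteq> V"
  shows "ring.dimension (ring_on V Quot nonunits V) 1
      ((\<lambda>c. nonunits V +>\<^bsub>ring_on V\<^esub> c) ` K) (carrier (ring_on V Quot nonunits V)) \<longleftrightarrow>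
    rational_valuation K V"
proof -
  let ?R = "ring_on V" let ?P = "nonunits V" let ?Q = "ring_on V Quot nonunits V"
  define \<pi> where "\<pi> = (\<lambda>x. ?P +>\<^bsub>?R\<^esub> x)"
  interpret P: ideal ?P ?R by (rule ideal_nonunits)
  interpret Q: ring ?Q by (rule P.quotient_is_ring)
  interpret h: ring_hom_ring ?R ?Q \<pi> unfolding \<pi>_def by (rule P.rcos_ring_hom_ring)
  have carr: "carrier ?Q = \<pi> ` V"
    by (auto simp: FactRing_def A_RCOSETS_def' \<pi>_def)
  have eq: "\<pi> x = \<pi> y \<longleftrightarrow> x - y \<in> ?P" if "x \<in> V" "y \<in> V" for x y
  proof -
    have "\<pi> x = \<pi> y \<longleftrightarrow> x \<ominus>\<^bsub>?R\<^esub> y \<in> ?P"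
      unfolding \<pi>_def using P.quotient_eq_iff_same_a_r_cos[OF ideal_nonunits, of x y] that by simp
    also have "x \<ominus>\<^bsub>?R\<^esub> y = x - y" using that ring_on_a_inv[of y] by (simp add: a_minus_def)
    finally show ?thesis .
  qed
  have zero: "\<zero>\<^bsub>?Q\<^esub> = \<pi> 0" and one: "\<one>\<^bsub>?Q\<^esub> = \<pi> 1" using h.hom_zero h.hom_one by simp_all
  have mult: "\<pi> x \<otimes>\<^bsub>?Q\<^esub> \<pi> y = \<pi> (x * y)" if "x \<in> V" "y \<in> V" for x y
    using h.hom_mult[of x y] that by simp
  have line: "Q.line_extension (\<pi> ` K) (\<pi> v) {\<zero>\<^bsub>?Q\<^esub>} = (\<lambda>c. \<pi> (c * v)) ` K" if v: "v \<in> V" for v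
  proof -
    have "\<pi> c \<otimes>\<^bsub>?Q\<^esub> \<pi> v \<oplus>\<^bsub>?Q\<^esub> \<zero>\<^bsub>?Q\<^esub> = \<pi> (c * v)" if "c \<in> K" for c
      using that v K(2) mult[of c v] carr Vc(5)[of c v] by auto
    thus ?thesis unfolding Q.line_extension_def set_add_def' r_coset_def by force
  qed
  have n10: "\<pi> 1 \<noteq> \<pi> 0" using eq[of 1 0] Vc nonunits_not_1 by simp
  show ?thesis unfolding \<pi>_def[symmetric]
  proof
    assume "Q.dimension 1 (\<pi> ` K) (carrier ?Q)"
    then obtain v E where v: "v \<in> carrier ?Q" "Q.dimension 0 (\<pi> ` K) E"
      "carrier ?Q = Q.line_extension (\<pi> ` K) v E"
      by (cases rule: Q.dimension.cases) auto
    have "E = {\<zero>\<^bsub>?Q\<^esub>}" using v(2) by (cases rule: Q.dimension.cases) auto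
    moreover obtain v0 where v0: "v0 \<in> V" "v = \<pi> v0" using v(1) carr by auto
    ultimately have sur: "\<pi> ` V = (\<lambda>c. \<pi> (c * v0)) ` K" using v(3) line[OF v0(1)] carr by simp
    have rep: "\<exists>c\<in>K. z - c * v0 \<in> ?P" if "z \<in> V" for z
    proof -
      have "\<pi> z \<in> (\<lambda>c. \<pi> (c * v0)) ` K" using that sur by blast
      then obtain c where "c \<in> K" "\<pi> z = \<pi> (c * v0)" by blast
      thus ?thesis using eq[OF that, of "c * v0"] v0(1) K(2) Vc(5) by blast
    qed
    \<comment> \<open>The basis vector \<open>v0\<close> is arbitrary; a constant \<open>c\<close>
      with \<open>c * v0\<close> congruent to 1 turns multiples of \<open>v0\<close> into
      constants.\<close>
    obtain c where c: "c \<in> K" "1 - c * v0 \<in> ?P" using rep[OF Vc(2)] by blast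
    have c0: "c \<noteq> 0" using c(2) nonunits_not_1 by auto
    show "rational_valuation K V"
      unfolding rational_valuation_def
    proof
      fix z assume "z \<in> V"
      then obtain d where d: "d \<in> K" "z - d * v0 \<in> ?P" using rep by blast
      have dc: "d / c \<in> K" using subfield_type_divide[OF K(1) d(1) c(1)] .
      have "z - d / c = (z - d * v0) - d / c * (1 - c * v0)" using c0 by (simp add: field_simps)
      also have "\<dots> \<in> ?P" using dc K(2) by (intro nonunits_diff d nonunits_mult' c) auto
      finally show "\<exists>c\<in>K. z - c \<in> ?P" using dc by blast
    qed
  next
    assume rat: "rational_valuation K V"
    have "\<pi> ` V = \<pi> ` K"
    proof
      show "\<pi> ` V \<subseteq> \<pi> ` K"
      proof
        fix y assume "y \<in> \<pi> ` V"
        then obtain z where z: "z \<in> V" "y = \<pi> z" by blast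
        then obtain c where "c \<in> K" "z - c \<in> ?P" using rat by (auto simp: rational_valuation_def)
        thus "y \<in> \<pi> ` K" using eq[OF z(1)] K(2) z(2) by blast
      qed
    qed (use K(2) in blast)
    moreover have "Q.line_extension (\<pi> ` K) (\<pi> 1) {\<zero>\<^bsub>?Q\<^esub>} = \<pi> ` K" using line[OF Vc(2)] by simp
    moreover have "Q.dimension (Suc 0) (\<pi> ` K) (Q.line_extension (\<pi> ` K) (\<pi> 1) {\<zero>\<^bsub>?Q\<^esub>})"
    proof (rule Q.Suc_dim[OF _ _ Q.zero_dim])
      show "\<pi> 1 \<in> carrier ?Q" using carr Vc(2) by blast
      show "\<pi> 1 \<notin> {\<zero>\<^bsub>?Q\<^esub>}" using n10 zero by simp
    qed
    ultimately show "Q.dimension 1 (\<pi> ` K) (carrier ?Q)" using carr by simp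
  qed
qed

end

lemma is_valuation_ring_iff:
  assumes "subfield_type E"
  shows "is_valuation_ring K E V \<longleftrightarrow> valuation_ring V E \<and> K \<subset> V \<and> V \<subset> E"
  using assms by (auto simp: is_valuation_ring_def valuation_ring_def)

lemma card_rational_places:
  assumes K: "subfield_type K" and E: "subfield_type E"
  shows "card (rational_places K E) = card (rational_valuations K E)"
proof -
  have "rational_places K E = nonunits ` rational_valuations K E"
  proof (intro equalityI subsetI)
    fix P assume "P \<in> rational_places K E"
    then obtain V where V: "valuation_ring V E" "K \<subset> V" "V \<subset> E" "maximalideal P (ring_on V)"
      "ring.dimension (ring_on V Quot P) 1 ((\<lambda>c. P +>\<^bsub>ring_on V\<^esub> c) ` K) (carrier (ring_on V Quot P))"
      unfolding rational_places_def has_place_degree_def is_valuation_ring_iff[OF E] by blast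
    interpret v: valuation_ring V E by (rule V(1))
    have P: "P = nonunits V" using V(4) v.maximalideal_iff by blast
    hence "rational_valuation K V" using V(5) v.residue_field_dimension_1_iff[OF K] V(2) by blast
    thus "P \<in> nonunits ` rational_valuations K E" using V P by (auto simp: rational_valuations_def)
  next
    fix P assume "P \<in> nonunits ` rational_valuations K E"
    then obtain V where V: "valuation_ring V E" "K \<subset> V" "V \<subset> E" "rational_valuation K V" "P = nonunits V"
      by (auto simp: rational_valuations_def)
    interpret v: valuation_ring V E by (rule V(1))
    show "P \<in> rational_places K E"
      unfolding rational_places_def has_place_degree_def is_valuation_ring_iff[OF E]
      using V v.maximalideal_iff v.residue_field_dimension_1_iff[OF K] by blast
  qed
  moreover have "inj_on nonunits (rational_valuations K E)"
  proof (rule inj_onI)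
    \<comment> \<open>At a rational place \<open>V = K + P\<close>, so the maximal ideal together
      with the constants recovers the ring.\<close>
    have sub: "V \<subseteq> W" if "V \<in> rational_valuations K E" "W \<in> rational_valuations K E" "nonunits V = nonunits W" for V W
    proof
      interpret V: valuation_ring V E using that(1) by (simp add: rational_valuations_def)
      interpret W: valuation_ring W E using that(2) by (simp add: rational_valuations_def)
      fix z assume z: "z \<in> V"
      have "rational_valuation K V" using that(1) by (simp add: rational_valuations_def)
      then obtain c where "c \<in> K" "z - c \<in> nonunits V"
        using z by (auto simp: rational_valuation_def)
      hence "c \<in> W" "z - c \<in> W" using that W.nonunits_sub by (auto simp: rational_valuations_def)
      hence "(z - c) + c \<in> W" by (rule W.Vc(4)[rotated])
      thus "z \<in> W" by simp
    qed
    fix V W assume "V \<in> rational_valuations K E" "W \<in> rational_valuations K E" "nonunits V = nonunits W"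
    thus "V = W" using sub[of V W] sub[of W V] by simp
  qed
  ultimately show ?thesis by (simp add: card_image)
qed

section \<open>The function field\<close>

lemma ff_const_simps [simp]:
  "ff_const 0 = 0" "ff_const 1 = 1" "ff_const (x + y) = ff_const x + ff_const y"
  "ff_const (x - y) = ff_const x - ff_const y" "ff_const (x * y) = ff_const x * ff_const y"
  "ff_const x = ff_const y \<longleftrightarrow> x = y"
  by (simp_all add: ff_const_def eq_fract flip: to_ac_add to_ac_diff to_ac_mult One_fract_def Zero_fract_def one_pCons)

lemma ff_const_eq_0_iff [simp]: "ff_const x = 0 \<longleftrightarrow> x = 0"
  using ff_const_simps(6)[of x 0] by simp

lemma ff_const_power [simp]: "ff_const (x ^ n) = ff_const x ^ n"
  by (induction n) simp_all

lemma ff_const_inverse [simp]: "ff_const (inverse x) = inverse (ff_const x)"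
proof (cases "x = 0")
  case False
  have "ff_const x * ff_const (inverse x) = 1" using False by (simp flip: ff_const_simps(5))
  thus ?thesis by (simp add: inverse_unique)
qed simp

lemma ff_const_of_nat [simp]: "ff_const (of_nat n) = of_nat n"
  by (induction n) simp_all

lemma ff_x_notin: "ff_x \<notin> range ff_const"
  by (auto simp: ff_x_def ff_const_def eq_fract)

lemma CHAR_ff_closure: "CHAR('a::{field,finite} ff_closure) = CHAR('a)"
proof (rule CHAR_eqI)
  show "of_nat CHAR('a) = (0 :: 'a ff_closure)"
    using ff_const_of_nat[of "CHAR('a)", where 'a='a] CHAR_alg_closure[where 'a='a]
    by (metis of_nat_CHAR ff_const_simps(1))
  show "CHAR('a) dvd n" if "of_nat n = (0 :: 'a ff_closure)" for n
    using that ff_const_of_nat[of n, where 'a='a] CHAR_alg_closure[where 'a='a]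
    by (metis ff_const_eq_0_iff of_nat_eq_0_iff_char_dvd)
qed

text \<open>The constant field is algebraically closed, so every non-constant element is transcendental over it.\<close>

lemma root_in_ff_const:
  assumes "f \<noteq> 0" "poly (map_poly ff_const f) z = 0"
  shows "z \<in> range ff_const"
  using assms
proof (induction "Polynomial.degree f" arbitrary: f)
  case 0
  then obtain c where "f = [:c:]" by (metis degree_eq_zeroE)
  thus ?case using 0 by (simp add: map_poly_pCons)
next
  case (Suc n)
  have hom: "map_poly ff_const (p * r) = map_poly ff_const p * map_poly ff_const r" for p r
    by (induction p) (simp_all add: map_poly_pCons map_poly_smult poly_eq_iff coeff_map_poly algebra_simps coeff_pCons split: nat.splits)
  obtain a where "poly f a = 0" using alg_closed_imp_poly_has_root[of f] Suc.hyps(2) by auto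
  then obtain g where g: "f = [:-a, 1:] * g" by (metis dvdE poly_eq_0_iff_dvd)
  have g0: "g \<noteq> 0" using Suc.prems g by auto
  have "Polynomial.degree f = Suc (Polynomial.degree g)" unfolding g using g0 by (subst degree_mult_eq) auto
  hence dg: "n = Polynomial.degree g" using Suc.hyps(2) by simp
  have "(z - ff_const a) * poly (map_poly ff_const g) z = 0"
    using Suc.prems(2) ff_const_simps(4)[of 0 a] unfolding g hom by (simp add: map_poly_pCons algebra_simps)
  thus ?case using Suc.hyps(1)[OF dg g0] by auto
qed

lemma transcendental_over_ff_const:
  fixes z :: "'a::field ff_closure"
  assumes "z \<notin> range ff_const" "K \<subseteq> range ff_const"
  shows "transcendental_over K z"
  unfolding transcendental_over_def
proof (intro ballI impI)
  fix f assume f: "f \<in> polys_over K" "poly f z = 0"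
  define g where "g = map_poly (inv_into UNIV ff_const) f"
  \<comment> \<open>\<open>map_poly\<close> can be computed coefficientwise once the map sends 0 to
    0.\<close>
  have "inv_into UNIV ff_const 0 = (0 :: 'a alg_closure)"
    by (rule inv_into_f_eq) (simp_all add: inj_def)
  moreover have "ff_const (inv_into UNIV ff_const (Polynomial.coeff f i)) = Polynomial.coeff f i" for i
    using polys_overD[OF f(1), of i] assms(2) by (intro f_inv_into_f) blast
  ultimately have g: "map_poly ff_const g = f"
    by (intro poly_eqI) (simp add: g_def coeff_map_poly)
  hence "g = 0" using root_in_ff_const[of g z] f(2) assms(1) by auto
  thus "f = 0" using g by simp
qed

context
  fixes p r :: nat and n :: nat
  assumes p: "prime p" and card_eq: "CARD('a::{field,finite}) = p ^ r" and n: "n > 0"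
begin

abbreviation (input) "K \<equiv> ff_const ` (GF n :: 'a alg_closure set)"

lemma subfield_GF: "subfield_type (GF n :: 'a alg_closure set)"
proof (rule subfield_typeI[OF subring_typeI])
  fix x y :: "'a alg_closure" assume "x \<in> GF n" "y \<in> GF n"
  thus "x - y \<in> GF n" "x * y \<in> GF n"
    by (simp_all add: GF_iff[OF p card_eq] frob_diff[OF p card_eq] power_mult_distrib)
qed (auto simp: GF_iff[OF p card_eq] power_inverse)

lemma subfield_constants: "subfield_type K"
proof (rule subfield_typeI[OF subring_typeI])
  note G = subfield_type_subring[OF subfield_GF]
  show "1 \<in> K" by (rule image_eqI[of _ _ 1]) (simp_all add: subring_type_1[OF G])
  fix x y assume "x \<in> K" "y \<in> K"
  then obtain u v where uv: "u \<in> GF n" "v \<in> GF n" "x = ff_const u" "y = ff_const v" by blast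
  show "x - y \<in> K" using uv subring_type_diff[OF G] by (intro image_eqI[of _ _ "u - v"]) auto
  show "x * y \<in> K" using uv subring_type_mult[OF G] by (intro image_eqI[of _ _ "u * v"]) auto
next
  fix x assume "x \<in> K"
  then obtain u where u: "u \<in> GF n" "x = ff_const u" by blast
  show "inverse x \<in> K" using u subfield_type_inverse[OF subfield_GF] by (intro image_eqI[of _ _ "inverse u"]) auto
qed

lemma CHAR_ff: "CHAR('a ff_closure) = p"
  unfolding CHAR_ff_closure by (rule CHAR_CARD_prime_power[OF p card_eq])

lemma frob_ff: "(x - y :: 'a ff_closure) ^ CARD('a) = x ^ CARD('a) - y ^ CARD('a)"
  by (rule frobenius_diff[where r = r]) (simp_all only: CHAR_ff p card_eq)

lemma frob_ff_add: "(x + y :: 'a ff_closure) ^ CARD('a) = x ^ CARD('a) + y ^ CARD('a)"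
  by (rule freshmans_dream'[where n = r]) (simp_all only: CHAR_ff p card_eq)

lemma const_power_CARD: "ff_const (to_ac c) ^ CARD('a) = ff_const (to_ac (c :: 'a))"
  by (simp add: power_CARD_same flip: ff_const_power to_ac_power)

lemma card_pairs_constants:
  "card {(\<alpha>, \<beta>). \<alpha> \<in> K \<and> \<beta> \<in> K \<and> P \<alpha> \<beta>} = (\<Sum>\<alpha>\<in>GF n. card {\<beta>\<in>GF n. P (ff_const \<alpha>) (ff_const \<beta>)})"
proof -
  have inj: "inj_on ff_const A" for A :: "'a alg_closure set" by (simp add: inj_on_def)
  have fin: "finite K" using finite_GF[OF p card_eq n] by simp
  have "{\<beta>\<in>K. P \<alpha> \<beta>} = ff_const ` {\<beta>\<in>GF n. P \<alpha> (ff_const \<beta>)}" for \<alpha> by blast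
  hence "card {\<beta>\<in>K. P \<alpha> \<beta>} = card {\<beta>\<in>GF n. P \<alpha> (ff_const \<beta>)}" for \<alpha>
    using card_image[OF inj] by metis
  thus ?thesis by (simp add: card_pairs[OF fin fin] sum.reindex[OF inj])
qed

text \<open>The map \<open>\<alpha> \<mapsto> \<alpha>\<^sup>q - \<alpha>\<close> is \<open>q\<close>-to-one onto the elements of trace zero.\<close>

lemma sum_artin_schreier_image:
  fixes g :: "'a alg_closure \<Rightarrow> nat"
  shows "(\<Sum>\<alpha>\<in>GF n. g (\<alpha> ^ CARD('a) - \<alpha>)) = CARD('a) * (\<Sum>z | z \<in> GF n \<and> field_trace n z = 0. g z)"
proof -
  let ?f = "\<lambda>\<alpha> :: 'a alg_closure. \<alpha> ^ CARD('a) - \<alpha>" and ?Z = "{z :: 'a alg_closure. z \<in> GF n \<and> field_trace n z = 0}"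
  have fin: "finite (GF n :: 'a alg_closure set)" by (rule finite_GF[OF p card_eq n])
  have sub: "?f ` GF n \<subseteq> ?Z"
  proof clarify
    fix \<alpha> :: "'a alg_closure" assume \<alpha>: "\<alpha> \<in> GF n"
    have "?f \<alpha> \<in> GF n" using \<alpha> GF_power[OF p card_eq] subring_type_diff[OF subfield_type_subring[OF subfield_GF]] by blast
    moreover have "field_trace n (?f \<alpha>) = 0"
      using \<alpha> field_trace_artin_schreier[OF p card_eq, of n \<alpha>] by (simp add: GF_iff[OF p card_eq])
    ultimately show "?f \<alpha> \<in> GF n \<and> field_trace n (?f \<alpha>) = 0" by blast
  qed
  have "(\<Sum>\<alpha>\<in>GF n. g (?f \<alpha>)) = (\<Sum>z\<in>?Z. \<Sum>\<alpha> | \<alpha> \<in> GF n \<and> ?f \<alpha> = z. g (?f \<alpha>))"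
    using sum.group[OF fin _ sub, of "\<lambda>\<alpha>. g (?f \<alpha>)"] fin by simp
  also have "\<dots> = (\<Sum>z\<in>?Z. CARD('a) * g z)"
  proof (rule sum.cong)
    fix z assume z: "z \<in> ?Z"
    have "(\<Sum>\<alpha> | \<alpha> \<in> GF n \<and> ?f \<alpha> = z. g (?f \<alpha>)) = card {\<alpha> \<in> GF n. ?f \<alpha> = z} * g z" by simp
    thus "(\<Sum>\<alpha> | \<alpha> \<in> GF n \<and> ?f \<alpha> = z. g (?f \<alpha>)) = CARD('a) * g z"
      using z card_artin_schreier_roots[OF p card_eq, of n z] by simp
  qed simp
  finally show ?thesis by (simp add: sum_distrib_left)
qed

text \<open>
  Take \<open>w\<^sub>1 = (y\<^sub>a - y\<^sub>b) / (a - b)\<close> and \<open>w\<^sub>0 = y\<^sub>a - a * w\<^sub>1\<close>. The shift \<open>c\<close> makes room for the change of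
  generator by \<open>w\<^sub>0 ^ 3\<close> that is needed for \<open>d = 3\<close>.
\<close>

lemma function_field_generators:
  fixes a b :: 'a
  assumes "a \<noteq> b"
  obtains w\<^sub>0 w\<^sub>1 :: "'a ff_closure" where
    "w\<^sub>0 ^ CARD('a) - w\<^sub>0 = ff_x" "w\<^sub>1 ^ CARD('a) - w\<^sub>1 = ff_x powi d"
    "\<And>c. c \<in> rational_functions K w\<^sub>0 \<Longrightarrow> (w\<^sub>1 + c) ^ CARD('a) - (w\<^sub>1 + c) \<in> rational_functions K w\<^sub>0 \<Longrightarrow>
      function_field n d a b 0 = adjoin (rational_functions K w\<^sub>0) (w\<^sub>1 + c)"
proof -
  define A where "A = ff_const (to_ac a)"
  define B where "B = ff_const (to_ac b)"
  define ya where "ya = ff_y d 0 a"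
  define yb where "yb = ff_y d 0 b"
  define w\<^sub>1 where "w\<^sub>1 = (ya - yb) / (A - B)"
  define w\<^sub>0 where "w\<^sub>0 = ya - A * w\<^sub>1"
  have ya: "ya ^ CARD('a) - ya = ff_x + A * ff_x powi d" and yb: "yb ^ CARD('a) - yb = ff_x + B * ff_x powi d"
    using ff_y_equation[of d 0 a] ff_y_equation[of d 0 b] by (simp_all add: ya_def yb_def A_def B_def)
  have AB: "A - B \<noteq> 0" using assms by (simp add: A_def B_def)
  \<comment> \<open>Elements of the ground field are fixed by the \<open>q\<close>-th power, so
    \<open>y \<mapsto> y ^ q - y\<close> is linear over them, and the two defining equations can be
    solved for \<open>x\<close> and \<open>x powi d\<close>.\<close>
  have Aq: "A ^ CARD('a) = A" and Bq: "B ^ CARD('a) = B" by (simp_all add: A_def B_def const_power_CARD)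
  have w1: "w\<^sub>1 ^ CARD('a) - w\<^sub>1 = ff_x powi d"
  proof -
    have "w\<^sub>1 ^ CARD('a) - w\<^sub>1 = ((ya ^ CARD('a) - ya) - (yb ^ CARD('a) - yb)) / (A - B)"
      by (simp add: w\<^sub>1_def power_divide frob_ff Aq Bq diff_divide_distrib[symmetric] algebra_simps)
    also have "\<dots> = ff_x powi d" unfolding ya yb using AB by (simp add: field_simps)
    finally show ?thesis .
  qed
  have w0: "w\<^sub>0 ^ CARD('a) - w\<^sub>0 = ff_x"
  proof -
    have "w\<^sub>0 ^ CARD('a) - w\<^sub>0 = (ya ^ CARD('a) - ya) - A * (w\<^sub>1 ^ CARD('a) - w\<^sub>1)"
      by (simp add: w\<^sub>0_def frob_ff power_mult_distrib Aq algebra_simps)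
    thus ?thesis unfolding ya w1 by simp
  qed
  have yaw: "ya = w\<^sub>0 + A * w\<^sub>1" by (simp add: w\<^sub>0_def)
  have ybw: "yb = w\<^sub>0 + B * w\<^sub>1"
  proof -
    have "(A - B) * w\<^sub>1 = ya - yb" using AB by (simp add: w\<^sub>1_def)
    thus ?thesis by (simp add: w\<^sub>0_def algebra_simps)
  qed
  have AK: "A \<in> K" "B \<in> K" using to_ac_GF[OF p card_eq] by (auto simp: A_def B_def)
  show thesis
  proof (rule that[OF w0 w1])
    fix c assume c: "c \<in> rational_functions K w\<^sub>0"
      and h: "(w\<^sub>1 + c) ^ CARD('a) - (w\<^sub>1 + c) \<in> rational_functions K w\<^sub>0"
    let ?F = "rational_functions K w\<^sub>0" and ?H = "K \<union> {ff_x, ya, yb}"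
    let ?E = "generate_field ring_of_type_algebra ?H" and ?M = "adjoin ?F (w\<^sub>1 + c)"
    note F = rational_functions_subfield[OF subfield_constants, of w\<^sub>0]
    note Fs = subfield_type_subring[OF F]
    have M: "subfield_type ?M"
      by (rule artin_schreier_adjoin_subfield[OF F refl h CARD_ge_2])
    note Mc = subring_type_closed[OF subfield_type_subring[OF M]]
    have KM: "K \<subseteq> ?M" and w0M: "w\<^sub>0 \<in> ?M" and cM: "c \<in> ?M"
      using adjoin_base[OF Fs, of _ "w\<^sub>1 + c"] rational_functions_base[OF subfield_constants, of w\<^sub>0]
        rational_functions_self[OF subfield_constants, of w\<^sub>0] c by blast+
    have w1M: "w\<^sub>1 \<in> ?M" using Mc(6)[OF adjoin_self[OF Fs] cM] by simp
    have "ff_x \<in> ?M" unfolding w0[symmetric] by (intro Mc(6) Mc(7)[OF w0M] w0M)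
    moreover have "ya \<in> ?M" "yb \<in> ?M" unfolding yaw ybw using AK KM w0M w1M by (auto intro!: Mc(4,5))
    ultimately have "?E \<subseteq> ?M" using KM by (intro generate_field_type(3)[OF M]) blast
    moreover have "?M \<subseteq> ?E"
    proof -
      note E = generate_field_type(1)[of ?H]
      note Ec = subring_type_closed[OF subfield_type_subring[OF E]]
      have HE: "K \<subseteq> ?E" "ya \<in> ?E" "yb \<in> ?E" using generate_field_type(2)[of ?H] by blast+
      have "w\<^sub>1 \<in> ?E" unfolding w\<^sub>1_def using HE AK by (intro subfield_type_divide[OF E] Ec(6)) blast+
      moreover have "w\<^sub>0 \<in> ?E" unfolding w\<^sub>0_def using HE AK calculation by (intro Ec(5,6)) blast+
      hence FE: "?F \<subseteq> ?E" by (rule rational_functions_least[OF subfield_constants E HE(1)])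
      ultimately have "w\<^sub>1 + c \<in> ?E" using c by (intro Ec(4)) blast+
      thus ?thesis by (rule adjoin_least[OF subfield_type_subring[OF E] FE])
    qed
    ultimately show "function_field n d a b 0 = ?M"
      unfolding function_field_def ya_def yb_def by blast
  qed
qed

section \<open>The number of rational places for \<open>d = 3\<close> and
  \<open>d = -1\<close>\<close>

lemma K_finite: "finite K"
  using finite_GF[OF p card_eq n] by simp

text \<open>A constant \<open>w\<close> would make \<open>x\<close> constant.\<close>

lemma transcendental_generator:
  assumes "w ^ CARD('a) - w = (ff_x :: 'a ff_closure)"
  shows "transcendental_over K w"
proof (rule transcendental_over_ff_const)
  show "w \<notin> range ff_const"
  proof
    assume "w \<in> range ff_const"
    then obtain c where "w = ff_const c" by blast
    hence "ff_x = ff_const (c ^ CARD('a) - c)" using assms by simp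
    thus False using ff_x_notin by blast
  qed
qed blast

lemma zero_in_GF: "0 \<in> (GF n :: 'a alg_closure set)"
  by (rule subring_type_0[OF subfield_type_subring[OF subfield_GF]])

lemma card_function_field_places:
  "card (rational_places K (function_field n d a b 0)) = card (rational_valuations K (function_field n d (a::'a) b 0))"
  unfolding function_field_def by (rule card_rational_places[OF subfield_constants generate_field_type(1)])

lemma N_count_cube:
  fixes a b :: 'a
  assumes ab: "a \<noteq> b" and p2: "p = 2"
  shows "N_count n 3 a b 0 = 1 + CARD('a)\<^sup>2 * card (trace_zero_elements 3 n :: 'a alg_closure set)"
proof -
  let ?q = "CARD('a)"
  obtain w\<^sub>0 w\<^sub>1 :: "'a ff_closure" where w: "w\<^sub>0 ^ ?q - w\<^sub>0 = ff_x" "w\<^sub>1 ^ ?q - w\<^sub>1 = ff_x powi 3"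
    "\<And>c. c \<in> rational_functions K w\<^sub>0 \<Longrightarrow> (w\<^sub>1 + c) ^ ?q - (w\<^sub>1 + c) \<in> rational_functions K w\<^sub>0 \<Longrightarrow>
      function_field n 3 a b 0 = adjoin (rational_functions K w\<^sub>0) (w\<^sub>1 + c)"
    using function_field_generators[OF ab] by blast
  let ?F = "rational_functions K w\<^sub>0"
  have q2: "?q \<ge> 2" by (rule CARD_ge_2)
  interpret artin_schreier_rational K w\<^sub>0 "w\<^sub>1 + w\<^sub>0 ^ 3" ?q
    by (rule artin_schreier_rational.intro[OF subfield_constants K_finite transcendental_generator[OF w(1)] q2 frob_ff])
  define H :: "'a ff_closure poly" where "H = Polynomial.monom 1 (2 * ?q + 1) + Polynomial.monom 1 (?q + 2)"
  have HK: "H \<in> polys_over K" unfolding H_def by (intro polys_over_add[OF Ks] polys_over_monom[OF Ks] Kc)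
  have dH: "Polynomial.degree H = 2 * ?q + 1"
  proof -
    have "Polynomial.degree (Polynomial.monom (1 :: 'a ff_closure) (?q + 2)) <
        Polynomial.degree (Polynomial.monom (1 :: 'a ff_closure) (2 * ?q + 1))"
      using q2 by (simp add: degree_monom_eq)
    thus ?thesis unfolding H_def by (simp add: degree_add_eq_left degree_monom_eq)
  qed
  \<comment> \<open>\<open>2 * q + 1\<close> is 1 modulo \<open>q\<close>.\<close>
  have cop: "coprime (2 * ?q + 1) ?q" 
    by (metis coprime_add_one_left coprime_mult_left_iff coprime_commute add.commute coprime_Suc_left_nat Suc_eq_plus1)
  \<comment> \<open>The pole order \<open>3 * q\<close> of \<open>x ^ 3\<close> is not prime to
    \<open>q\<close>. In characteristic 2, adding \<open>w\<^sub>0 ^ 3\<close> to the generator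
    cancels both pure cubes and leaves \<open>u ^ 2 * v + u * v ^ 2\<close> for
    \<open>u = w\<^sub>0 ^ q\<close> and \<open>v = w\<^sub>0\<close>.\<close>
  have cube: "(y ^ ?q - y) ^ 3 + ((y ^ 3) ^ ?q - y ^ 3) = poly H y" for y :: "'a ff_closure"
  proof -
    have "of_nat 2 = (0 :: 'a ff_closure)" using of_nat_CHAR[where 'a = "'a ff_closure"] by (simp only: CHAR_ff p2)
    hence two: "(2 :: 'a ff_closure) = 0" by simp
    \<comment> \<open>An identity of integer polynomials; everything that characteristic 2 removes
      is collected behind the factor 2.\<close>
    have cb: "(u - v) ^ 3 + (u ^ 3 - v ^ 3) = u ^ 2 * v + u * v ^ 2 + 2 * (u ^ 3 - v ^ 3 - 2 * u ^ 2 * v + u * v ^ 2)" for u v :: "'a ff_closure"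
      by (simp add: power2_eq_square power3_eq_cube algebra_simps)
    have "(y ^ 3) ^ ?q = (y ^ ?q) ^ 3" by (simp add: mult.commute flip: power_mult)
    hence "(y ^ ?q - y) ^ 3 + ((y ^ 3) ^ ?q - y ^ 3) = (y ^ ?q) ^ 2 * y + y ^ ?q * y ^ 2"
      using cb[of "y ^ ?q" y] two by simp
    also have "\<dots> = poly H y"
      by (simp add: H_def poly_monom power_add power_mult mult.commute power2_eq_square)
    finally show ?thesis .
  qed
  have w': "(w\<^sub>1 + w\<^sub>0 ^ 3) ^ ?q - (w\<^sub>1 + w\<^sub>0 ^ 3) = poly H w\<^sub>0"
    using cube[of w\<^sub>0] w(1,2) by (simp add: frob_ff_add algebra_simps)
  note Fs = subfield_type_subring[OF rational_functions_subfield[OF subfield_constants, of w\<^sub>0]]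
  have w0F: "w\<^sub>0 \<in> ?F" by (rule rational_functions_self[OF subfield_constants])
  have HF: "poly H w\<^sub>0 \<in> ?F"
    using HK polys_over_mono[OF rational_functions_base[OF subfield_constants, of w\<^sub>0]] w0F
    by (intro poly_polys_over[OF Fs]) auto
  have E: "function_field n 3 a b 0 = adjoin ?F (w\<^sub>1 + w\<^sub>0 ^ 3)"
    using HF w' by (intro w(3) subring_type_power[OF Fs] w0F) simp
  have "N_count n 3 a b 0 = 1 + card {(\<alpha>, \<beta>). \<alpha> \<in> K \<and> \<beta> \<in> K \<and> \<beta> ^ ?q - \<beta> = poly H \<alpha>}"
    unfolding N_count_def card_function_field_places unfolding E
    by (rule card_polynomial_case[OF HK _ _ w']) (use dH cop in auto)
  also have "card {(\<alpha>, \<beta>). \<alpha> \<in> K \<and> \<beta> \<in> K \<and> \<beta> ^ ?q - \<beta> = poly H \<alpha>} =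
      (\<Sum>\<alpha>\<in>GF n. card {\<beta>\<in>GF n. ff_const \<beta> ^ ?q - ff_const \<beta> = poly H (ff_const \<alpha> :: 'a ff_closure)})"
    by (rule card_pairs_constants)
  also have "\<dots> = (\<Sum>\<alpha>\<in>GF n. card {\<beta>\<in>GF n. \<beta> ^ ?q - \<beta> = (\<alpha> ^ ?q - \<alpha> :: 'a alg_closure) ^ 3})"
  proof (rule sum.cong)
    fix \<alpha> :: "'a alg_closure" assume \<alpha>: "\<alpha> \<in> GF n"
    have \<alpha>3: "\<alpha> ^ 3 \<in> GF n" by (rule GF_power[OF p card_eq \<alpha>])
    note G = subring_type_closed[OF subfield_type_subring[OF subfield_GF]]
    \<comment> \<open>The shift by \<open>\<alpha> ^ 3\<close> undoes the change of generator, so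
      the points become those of the original equation for \<open>x ^ 3\<close>.\<close>
    have eq: "ff_const \<beta> ^ ?q - ff_const \<beta> = poly H (ff_const \<alpha> :: 'a ff_closure) \<longleftrightarrow>
        (\<beta> - \<alpha> ^ 3) ^ ?q - (\<beta> - \<alpha> ^ 3) = (\<alpha> ^ ?q - \<alpha>) ^ 3" for \<beta>
      unfolding cube[symmetric] frob_diff1[OF p card_eq]
      by (simp add: algebra_simps flip: ff_const_power ff_const_simps(3-5))
    show "card {\<beta>\<in>GF n. ff_const \<beta> ^ ?q - ff_const \<beta> = poly H (ff_const \<alpha> :: 'a ff_closure)} =
        card {\<beta>\<in>GF n. \<beta> ^ ?q - \<beta> = (\<alpha> ^ ?q - \<alpha>) ^ 3}"
      unfolding eq
      by (rule bij_betw_same_card[of "\<lambda>\<beta>. \<beta> - \<alpha> ^ 3"], rule bij_betwI[where g = "\<lambda>\<beta>. \<beta> + \<alpha> ^ 3"])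
        (use \<alpha>3 in \<open>auto intro: G(4,6)\<close>)
  qed simp
  also have "\<dots> = ?q * (\<Sum>z | z \<in> GF n \<and> field_trace n z = 0. card {\<beta>\<in>GF n. \<beta> ^ ?q - \<beta> = (z :: 'a alg_closure) ^ 3})"
    by (rule sum_artin_schreier_image)
  also have "\<dots> = ?q * (\<Sum>z | z \<in> GF n \<and> field_trace n z = 0. if field_trace n ((z :: 'a alg_closure) ^ 3) = 0 then ?q else 0)"
    by (simp only: card_artin_schreier_roots[OF p card_eq])
  also have "\<dots> = ?q * (?q * card {z :: 'a alg_closure. (z \<in> GF n \<and> field_trace n z = 0) \<and> field_trace n (z ^ 3) = 0})"
    using finite_GF[OF p card_eq n] by (simp flip: sum.inter_filter)
  also have "{z :: 'a alg_closure. (z \<in> GF n \<and> field_trace n z = 0) \<and> field_trace n (z ^ 3) = 0} = trace_zero_elements 3 n"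
    by (simp add: trace_zero_elements_def)
  finally show ?thesis by (simp add: power2_eq_square)
qed

text \<open>The term \<open>2 * q\<close> collects the \<open>q\<close> ramified places and the
  \<open>q\<close> places over infinity. The remaining places come from nonzero \<open>z\<close>
  only, whence the \<open>- 1\<close>; since 0 is among the counted elements, this subtraction of
  naturals is exact.\<close>

lemma N_count_inverse:
  fixes a b :: 'a
  assumes ab: "a \<noteq> b"
  shows "N_count n (-1) a b 0 = 2 * CARD('a) + CARD('a)\<^sup>2 * (card (trace_zero_elements (-1) n :: 'a alg_closure set) - 1)"
    and "card (trace_zero_elements (-1) n :: 'a alg_closure set) > 0"
proof -
  let ?q = "CARD('a)"
  let ?T = "trace_zero_elements (-1) n :: 'a alg_closure set"
  obtain w\<^sub>0 w\<^sub>1 :: "'a ff_closure" where w: "w\<^sub>0 ^ ?q - w\<^sub>0 = ff_x" "w\<^sub>1 ^ ?q - w\<^sub>1 = ff_x powi (-1)"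
    "\<And>c. c \<in> rational_functions K w\<^sub>0 \<Longrightarrow> (w\<^sub>1 + c) ^ ?q - (w\<^sub>1 + c) \<in> rational_functions K w\<^sub>0 \<Longrightarrow>
      function_field n (-1) a b 0 = adjoin (rational_functions K w\<^sub>0) (w\<^sub>1 + c)"
    using function_field_generators[OF ab] by blast
  let ?F = "rational_functions K w\<^sub>0"
  have q2: "?q \<ge> 2" by (rule CARD_ge_2)
  interpret artin_schreier_rational K w\<^sub>0 w\<^sub>1 ?q
    by (rule artin_schreier_rational.intro[OF subfield_constants K_finite transcendental_generator[OF w(1)] q2 frob_ff])
  have w': "w\<^sub>1 ^ ?q - w\<^sub>1 = inverse (w\<^sub>0 ^ ?q - w\<^sub>0)" using w(1,2) by simp
  note F = rational_functions_subfield[OF subfield_constants, of w\<^sub>0]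
  note Fc = subring_type_closed[OF subfield_type_subring[OF F]]
  have w0F: "w\<^sub>0 \<in> ?F" by (rule rational_functions_self[OF subfield_constants])
  have E: "function_field n (-1) a b 0 = adjoin ?F w\<^sub>1"
    using w(3)[OF Fc(1)] w' subfield_type_inverse[OF F Fc(6)[OF Fc(7)[OF w0F] w0F]] by simp
  have finG: "finite (GF n :: 'a alg_closure set)" by (rule finite_GF[OF p card_eq n])
  have tr0: "field_trace n (0 :: 'a alg_closure) = 0"
    unfolding field_trace_def by (rule sum.neutral) (use q2 in \<open>auto simp: power_0_left\<close>)
  hence 0: "0 \<in> ?T" using zero_in_GF by (simp add: trace_zero_elements_def)
  have "?T \<subseteq> GF n" by (auto simp: trace_zero_elements_def)
  hence finT: "finite ?T" using finG finite_subset by blast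
  show "card ?T > 0" using 0 finT by (auto simp: card_gt_0_iff)
  have "N_count n (-1) a b 0 = 2 * card {\<alpha>\<in>K. \<alpha> ^ ?q = \<alpha>} +
      card {(\<alpha>, \<beta>). \<alpha> \<in> K \<and> \<beta> \<in> K \<and> \<alpha> ^ ?q \<noteq> \<alpha> \<and> \<beta> ^ ?q - \<beta> = inverse (\<alpha> ^ ?q - \<alpha>)}"
    unfolding N_count_def card_function_field_places unfolding E by (rule card_reciprocal_case[OF w'])
  also have "{\<alpha>\<in>K. \<alpha> ^ ?q = \<alpha>} = ff_const ` {\<alpha>\<in>GF n. \<alpha> ^ ?q - \<alpha> = (0 :: 'a alg_closure)}"
    by (auto simp flip: ff_const_power)
  also have "card \<dots> = card {\<alpha>\<in>GF n. \<alpha> ^ ?q - \<alpha> = (0 :: 'a alg_closure)}"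
    by (rule card_image) (simp add: inj_on_def)
  also have "\<dots> = ?q"
    unfolding card_artin_schreier_roots[OF p card_eq] using tr0 by simp
  also have "card {(\<alpha>, \<beta>). \<alpha> \<in> K \<and> \<beta> \<in> K \<and> \<alpha> ^ ?q \<noteq> \<alpha> \<and> \<beta> ^ ?q - \<beta> = inverse (\<alpha> ^ ?q - \<alpha>)} =
      (\<Sum>\<alpha>\<in>GF n. card {\<beta>\<in>GF n. ff_const \<alpha> ^ ?q \<noteq> ff_const \<alpha> \<and>
        ff_const \<beta> ^ ?q - ff_const \<beta> = inverse (ff_const \<alpha> ^ ?q - ff_const \<alpha> :: 'a ff_closure)})"
    by (rule card_pairs_constants)
  also have "\<dots> = (\<Sum>\<alpha>\<in>GF n. card {\<beta>\<in>GF n. (\<alpha> ^ ?q - \<alpha> :: 'a alg_closure) \<noteq> 0 \<and> \<beta> ^ ?q - \<beta> = inverse (\<alpha> ^ ?q - \<alpha>)})"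
    by (simp flip: ff_const_power ff_const_simps(4) ff_const_inverse)
  also have "\<dots> = ?q * (\<Sum>z | z \<in> GF n \<and> field_trace n z = 0. card {\<beta>\<in>GF n. z \<noteq> 0 \<and> \<beta> ^ ?q - \<beta> = inverse (z :: 'a alg_closure)})"
    by (rule sum_artin_schreier_image)
  also have "(\<Sum>z | z \<in> GF n \<and> field_trace n z = 0. card {\<beta>\<in>GF n. z \<noteq> 0 \<and> \<beta> ^ ?q - \<beta> = inverse (z :: 'a alg_closure)}) =
      (\<Sum>z | z \<in> GF n \<and> field_trace n z = 0. if z \<noteq> 0 \<and> field_trace n (inverse (z :: 'a alg_closure)) = 0 then ?q else 0)"
  proof (rule sum.cong)
    fix z :: "'a alg_closure"
    show "card {\<beta>\<in>GF n. z \<noteq> 0 \<and> \<beta> ^ ?q - \<beta> = inverse z} =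
        (if z \<noteq> 0 \<and> field_trace n (inverse z) = 0 then ?q else 0)"
      using card_artin_schreier_roots[OF p card_eq, of n "inverse z"] by (cases "z = 0") simp_all
  qed simp
  also have "\<dots> = ?q * card {z :: 'a alg_closure. (z \<in> GF n \<and> field_trace n z = 0) \<and> z \<noteq> 0 \<and> field_trace n (inverse z) = 0}"
    using finG by (simp flip: sum.inter_filter)
  also have "{z :: 'a alg_closure. (z \<in> GF n \<and> field_trace n z = 0) \<and> z \<noteq> 0 \<and> field_trace n (inverse z) = 0} = ?T - {0}"
    by (auto simp: trace_zero_elements_def)
  also have "card (?T - {0}) = card ?T - 1" using 0 finT by simp
  finally show "N_count n (-1) a b 0 = 2 * ?q + ?q\<^sup>2 * (card ?T - 1)" by (simp add: power2_eq_square)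
qed

text \<open>For \<open>d = -1\<close> the summand \<open>(q - 1)^2\<close> in \<open>H0\<close> is
  what \<open>2 * q + q^2 * (T - 1) - 1\<close> lacks to \<open>q^2 * T\<close>, where
  \<open>T\<close> is the number of trace-zero elements; for \<open>d = 3\<close> the count is
  \<open>1 + q^2 * T\<close>.\<close>

lemma H0_eq_card_trace_zero_elements:
  fixes a b :: 'a
  assumes ab: "a \<noteq> b" and d: "d \<in> {-1, 3}" "d = 3 \<longrightarrow> p = 2"
  shows "H0 d a b n = of_nat (card (trace_zero_elements d n :: 'a alg_closure set))"
proof (cases "d = 3")
  case True
  thus ?thesis using N_count_cube[OF ab] d(2) by (simp add: H0_def)
next
  case False
  hence d: "d = -1" using d(1) by simp
  define T where "T = card (trace_zero_elements (-1) n :: 'a alg_closure set)"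
  have T: "T > 0" and N: "N_count n (-1) a b 0 = 2 * CARD('a) + CARD('a)\<^sup>2 * (T - 1)"
    unfolding T_def using N_count_inverse[OF ab] by auto
  have "rat_of_nat (N_count n (-1) a b 0) = 2 * of_nat CARD('a) + of_nat CARD('a) ^ 2 * (of_nat T - 1)"
    unfolding N using T by (simp add: of_nat_diff)
  thus ?thesis unfolding d H0_def T_def[symmetric] by (simp add: field_simps power2_eq_square)
qed

end

theorem theorem4p5:
  fixes p r k s m :: nat and d :: int and a b :: "'a::{field,finite}"
  assumes "p \<in> {2, 3}" and "CARD('a) = p ^ r"
    and "d \<in> {-1, 3}" and "d = 3 \<longrightarrow> p = 2"
    and "a \<noteq> b"
    and "m = p ^ k * s" and "\<not> p dvd s"
  shows "rat_of_nat (G_count (0 :: 'a) d m) =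
    (\<Sum>t | t dvd s. rat_of_int (moebius_mu (s div t)) * H0 d a b (p ^ k * t))
      - rat_of_int (S_corr CARD('a) p k s)"
proof -
  have p: "prime p" using assms(1) by auto
  have "H0 d a b (p ^ k * t) = of_nat (card (trace_zero_elements d (p ^ k * t) :: 'a alg_closure set))"
    if "t dvd s" for t
  proof (rule H0_eq_card_trace_zero_elements[OF p assms(2) _ assms(5,3,4)])
    \<comment> \<open>\<open>s = 0\<close> is excluded, as \<open>p\<close> would divide it.\<close>
    have "t > 0" using that assms(7) by (auto intro: Nat.gr0I)
    thus "p ^ k * t > 0" using p by (simp add: prime_gt_0_nat)
  qed
  thus ?thesis using G_count_formula[OF p assms(2,7), of d k] unfolding assms(6) by simp
qed

end
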